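(* Let $\rho\in(0,1)$. For $\gamma_1<-1/2$ close to $-1/2$, set $\gamma_2=(\gamma_1+1/2)/\rho-1/2$ (so that $\gamma_1\ge\gamma_2$, $\gamma_i\in(-1,-1/2)$ and $\gamma_1+\gamma_2>-3/2$), and let $$Z_{\gamma_1,\gamma_2}=A(\gamma_1,\gamma_2)\int_{\mathbb{R}^2}\left(\int_0^1(s-x_1)_+^{\gamma_1}(s-x_2)_+^{\gamma_2}\,ds\right)dB_{x_1}dB_{x_2}.$$ Let $Y_\rho=\frac{a_\rho}{\sqrt2}(Z_1^2-1)+\frac{b_\rho}{\sqrt2}(Z_2^2-1)$ with $Z_1,Z_2$ independent standard normal random variables and $$a_\rho=\frac{(\rho+1)^{-1}+(2\sqrt\rho)^{-1}}{\sqrt{2(\rho+1)^{-2}+(2\rho)^{-1}}},\qquad b_\rho=\frac{(\rho+1)^{-1}-(2\sqrt\rho)^{-1}}{\sqrt{2(\rho+1)^{-2}+(2\rho)^{-1}}}.$$ Then there is a strictly positive constant $C_\rho$, depending only on $\rho$, such that as $\gamma_1\to-1/2$ (i.e. for all $\gamma_1<-1/2$ sufficiently close to $-1/2$), $$\mathbf{W}_2(Z_{\gamma_1,\gamma_2},Y_\rho)\le C_\rho\sqrt{-\gamma_1-\tfrac12}.$$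
   Context: $\mathbf{W}_2(F,G)=(\inf \mathbb{E}|X-Y|^2)^{1/2}$, the infimum being over all couplings $(X,Y)$ with $X\sim F$, $Y\sim G$ in law. $B$ is a standard two-sided Brownian motion and the double integral is a double Wiener–Itô integral on $\mathbb{R}^2$ (diagonal excluded). $u_+^{\gamma}=u^\gamma$ if $u>0$ and $0$ otherwise. With $B(\alpha,\beta)=\int_0^1u^{\alpha-1}(1-u)^{\beta-1}du$, the normalizing constant (which makes $\mathbb{E}[Z_{\gamma_1,\gamma_2}^2]=1$) is $$A(\gamma_1,\gamma_2)=\big[(\gamma_1+\gamma_2+2)(2(\gamma_1+\gamma_2)+3)\big]^{1/2}\big[B(\gamma_1+1,-\gamma_1-\gamma_2-1)B(\gamma_2+1,-\gamma_1-\gamma_2-1)+B(\gamma_1+1,-2\gamma_1-1)B(\gamma_2+1,-2\gamma_2-1)\big]^{-1/2}.$$ *)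

theory Defs
  imports "HOL-Probability.Probability"
begin

section \<open>Quadratic Wasserstein distance\<close>

definition couplings :: "real measure \<Rightarrow> real measure \<Rightarrow> (real \<times> real) measure set" where
  "couplings F G = {\<pi>. prob_space \<pi> \<and> sets \<pi> = sets borel \<and>
     distr \<pi> borel fst = F \<and> distr \<pi> borel snd = G}"

definition ennreal_sqrt :: "ennreal \<Rightarrow> ennreal" where
  "ennreal_sqrt x = (if x = \<top> then \<top> else ennreal (sqrt (enn2real x)))"

text \<open>The distance is valued in \<^typ>\<open>ennreal\<close>, so that couplings with infinite cost (and an
  empty set of couplings) contribute \<open>\<infinity>\<close> rather than a default value.\<close>

definition wasserstein2 :: "real measure \<Rightarrow> real measure \<Rightarrow> ennreal" where
  "wasserstein2 F G =
     ennreal_sqrt (INF \<pi>\<in>couplings F G. \<integral>\<^sup>+ (x, y). ennreal (\<bar>x - y\<bar>\<^sup>2) \<partial>\<pi>)"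


section \<open>Two-sided Brownian motion\<close>

locale two_sided_brownian_motion = prob_space M for M :: "'a measure" +
  fixes B :: "real \<Rightarrow> 'a \<Rightarrow> real"
  assumes measurable_BM: "\<And>t. B t \<in> borel_measurable M"
    and BM_zero: "AE \<omega> in M. B 0 \<omega> = 0"
    and BM_indep_increments: "\<And>(n::nat) t. strict_mono_on {..n} t \<Longrightarrow>
          indep_vars (\<lambda>_. borel) (\<lambda>i \<omega>. B (t (Suc i)) \<omega> - B (t i) \<omega>) {..<n}"
    and BM_gaussian_increments: "\<And>s t. s < t \<Longrightarrow>
          distributed M lborel (\<lambda>\<omega>. B t \<omega> - B s \<omega>) (normal_density 0 (sqrt (t - s)))"
    and BM_continuous_paths: "AE \<omega> in M. continuous_on UNIV (\<lambda>t. B t \<omega>)"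


section \<open>Double Wiener--Ito integral\<close>

text \<open>An entry \<open>(c, (a, b), (a', b'))\<close> stands for the elementary function
  \<open>c\<close> times the indicator of the rectangle \<open>(a, b] \<times> (a', b']\<close>. Both sides of the rectangle are
  required to be disjoint, i.e. the rectangle does not meet the diagonal; the integral of
  such an elementary function is the product of the increments. A list stands for the sum of
  its entries.\<close>

type_synonym rectangles = "(real \<times> (real \<times> real) \<times> (real \<times> real)) list"

definition off_diagonal :: "rectangles \<Rightarrow> bool" where
  "off_diagonal ps \<longleftrightarrow> (\<forall>(c, (a, b), (a', b')) \<in> set ps.
     a \<le> b \<and> a' \<le> b' \<and> {a<..b} \<inter> {a'<..b'} = {})"

definition step_fun :: "rectangles \<Rightarrow> real \<times> real \<Rightarrow> real" where
  "step_fun ps = (\<lambda>(x, y). \<Sum>(c, (a, b), (a', b'))\<leftarrow>ps.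
     c * indicator {a<..b} x * indicator {a'<..b'} y)"

definition step_integral :: "(real \<Rightarrow> 'a \<Rightarrow> real) \<Rightarrow> rectangles \<Rightarrow> 'a \<Rightarrow> real" where
  "step_integral B ps \<omega> = (\<Sum>(c, (a, b), (a', b'))\<leftarrow>ps.
     c * (B b \<omega> - B a \<omega>) * (B b' \<omega> - B a' \<omega>))"

text \<open>Extension to (not necessarily symmetric) square integrable integrands by \<open>L\<^sup>2\<close> limits.
  Square integrability of \<open>f\<close> is implied by its being an \<open>L\<^sup>2\<close> limit of step functions.\<close>

definition has_double_wiener_integral ::
    "'a measure \<Rightarrow> (real \<Rightarrow> 'a \<Rightarrow> real) \<Rightarrow> (real \<times> real \<Rightarrow> real) \<Rightarrow> ('a \<Rightarrow> real) \<Rightarrow> bool" where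
  "has_double_wiener_integral M B f Z \<longleftrightarrow>
     f \<in> borel_measurable lborel \<and> Z \<in> borel_measurable M \<and>
     (\<exists>ps :: nat \<Rightarrow> rectangles. (\<forall>n. off_diagonal (ps n)) \<and>
        (\<lambda>n. \<integral>\<^sup>+ x. ennreal ((step_fun (ps n) x - f x)\<^sup>2) \<partial>lborel) \<longlonglongrightarrow> 0 \<and>
        (\<lambda>n. \<integral>\<^sup>+ \<omega>. ennreal ((step_integral B (ps n) \<omega> - Z \<omega>)\<^sup>2) \<partial>M) \<longlonglongrightarrow> 0)"

text \<open>The integral is determined up to almost sure equality; a version is chosen.\<close>

definition double_wiener_integral ::
    "'a measure \<Rightarrow> (real \<Rightarrow> 'a \<Rightarrow> real) \<Rightarrow> (real \<times> real \<Rightarrow> real) \<Rightarrow> 'a \<Rightarrow> real" where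
  "double_wiener_integral M B f = (SOME Z. has_double_wiener_integral M B f Z)"


section \<open>The generalized Rosenblatt variable and its limit\<close>

definition pos_powr :: "real \<Rightarrow> real \<Rightarrow> real" where
  "pos_powr u \<gamma> = (if u > 0 then u powr \<gamma> else 0)"

text \<open>The inner integral diverges only for some points of the diagonal, a null set, where
  its value is 0 by the library's convention.\<close>

definition rosenblatt_kernel :: "real \<Rightarrow> real \<Rightarrow> real \<times> real \<Rightarrow> real" where
  "rosenblatt_kernel \<gamma>\<^sub>1 \<gamma>\<^sub>2 = (\<lambda>(x\<^sub>1, x\<^sub>2).
     LINT s:{0..1}|lborel. pos_powr (s - x\<^sub>1) \<gamma>\<^sub>1 * pos_powr (s - x\<^sub>2) \<gamma>\<^sub>2)"

definition rosenblatt_const :: "real \<Rightarrow> real \<Rightarrow> real" where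
  "rosenblatt_const \<gamma>\<^sub>1 \<gamma>\<^sub>2 =
     ((\<gamma>\<^sub>1 + \<gamma>\<^sub>2 + 2) * (2 * (\<gamma>\<^sub>1 + \<gamma>\<^sub>2) + 3)) powr (1/2) *
     (Beta (\<gamma>\<^sub>1 + 1) (- \<gamma>\<^sub>1 - \<gamma>\<^sub>2 - 1) * Beta (\<gamma>\<^sub>2 + 1) (- \<gamma>\<^sub>1 - \<gamma>\<^sub>2 - 1) +
      Beta (\<gamma>\<^sub>1 + 1) (- 2 * \<gamma>\<^sub>1 - 1) * Beta (\<gamma>\<^sub>2 + 1) (- 2 * \<gamma>\<^sub>2 - 1)) powr (- 1/2)"

definition rosenblatt_var ::
    "'a measure \<Rightarrow> (real \<Rightarrow> 'a \<Rightarrow> real) \<Rightarrow> real \<Rightarrow> real \<Rightarrow> 'a \<Rightarrow> real" where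
  "rosenblatt_var M B \<gamma>\<^sub>1 \<gamma>\<^sub>2 \<omega> =
     rosenblatt_const \<gamma>\<^sub>1 \<gamma>\<^sub>2 * double_wiener_integral M B (rosenblatt_kernel \<gamma>\<^sub>1 \<gamma>\<^sub>2) \<omega>"

definition a_coeff :: "real \<Rightarrow> real" where
  "a_coeff \<rho> = (1 / (\<rho> + 1) + 1 / (2 * sqrt \<rho>)) / sqrt (2 / (\<rho> + 1)\<^sup>2 + 1 / (2 * \<rho>))"

definition b_coeff :: "real \<Rightarrow> real" where
  "b_coeff \<rho> = (1 / (\<rho> + 1) - 1 / (2 * sqrt \<rho>)) / sqrt (2 / (\<rho> + 1)\<^sup>2 + 1 / (2 * \<rho>))"

definition limit_var :: "real \<Rightarrow> ('b \<Rightarrow> real) \<Rightarrow> ('b \<Rightarrow> real) \<Rightarrow> 'b \<Rightarrow> real" where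
  "limit_var \<rho> Z\<^sub>1 Z\<^sub>2 \<omega> =
     a_coeff \<rho> / sqrt 2 * ((Z\<^sub>1 \<omega>)\<^sup>2 - 1) + b_coeff \<rho> / sqrt 2 * ((Z\<^sub>2 \<omega>)\<^sup>2 - 1)"

end

theory Submission
  imports Defs
begin

text \<open>Write \<open>\<epsilon> = - \<gamma>\<^sub>1 - 1/2\<close>, so that \<open>\<gamma>\<^sub>1 = - 1/2 - \<epsilon>\<close> and \<open>\<gamma>\<^sub>2 = - 1/2 - \<epsilon> / \<rho>\<close>. As \<open>\<epsilon>\<close>
  tends to 0, the mass of the kernel escapes to \<open>- \<infinity>\<close>, where the inner integral hardly depends on
  \<open>s\<close>: for \<open>x, y \<le> - 1\<close> the kernel is close to the product of \<open>(- x) powr \<gamma>\<^sub>1\<close> and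
  \<open>(- y) powr \<gamma>\<^sub>2\<close>. The squared norm of this product is of order \<open>1 / \<epsilon>\<^sup>2\<close>, whereas everything
  else contributes only \<open>O(1 / \<epsilon>)\<close> (\<open>kernel_step_distance\<close>). The normalizing constant is of
  order \<open>\<epsilon>\<close> (\<open>rosenblatt_const_asymp\<close>), so replacing the kernel by its product part costs
  \<open>O(\<epsilon>)\<close> in mean square; this is where the rate \<open>sqrt \<epsilon>\<close> comes from.

  The product part is discretised on unit cells. Its double integral is, up to a diagonal
  term that is bounded in \<open>L\<^sup>2\<close>, the centred product of two linear combinations of independent
  standard normal increments. By the Gram--Schmidt procedure this product equals
  \<open>t (N\<^sup>2 - 1) + sqrt (s u - t\<^sup>2) N N'\<close> with independent standard normal \<open>N\<close> and \<open>N'\<close>, where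
  \<open>s\<close>, \<open>u\<close>, \<open>t\<close> are truncated power sums. After normalization both coefficients converge with an
  error \<open>O(\<epsilon>)\<close> (\<open>coefficient_asymptotics\<close>), and an orthogonal transformation of \<open>(N, N')\<close> turns the
  limiting form into the limit variable (\<open>limit_rotated\<close>). As all these variables live on the
  space of the Brownian motion, they provide a coupling (\<open>rosenblatt_coupling\<close>), and its cost
  bounds the Wasserstein distance (\<open>wasserstein2_le\<close>).

  Two general facts are used on the way. Off-diagonal step functions are dense in \<open>L\<^sup>2\<close> and
  the double integral is continuous on them (\<open>approx_step_nonneg\<close>,
  \<open>step_integral_second_moment\<close>), so the integral of the kernel exists and is close to the
  integral of any step function close to the kernel. And orthonormal combinations of independent
  standard normal variables are independent and standard normal, which is derived from the
  uniqueness of characteristic functions on the line (\<open>joint_law_std_normal\<close>).\<close>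

section \<open>Step functions on a common partition\<close>

lemma increment_partition:
  fixes F :: "real \<Rightarrow> real"
  assumes t: "strict_mono_on {..n} t" and ab: "a \<in> t ` {..n}" "b \<in> t ` {..n}" "a \<le> b"
  shows "F b - F a = (\<Sum>i<n. indicator {a<..b} (t (Suc i)) * (F (t (Suc i)) - F (t i)))"
proof -
  obtain p q where p: "p \<le> n" "a = t p" and q: "q \<le> n" "b = t q" using ab by auto
  have le: "t i \<le> t j \<longleftrightarrow> i \<le> j" if "i \<le> n" "j \<le> n" for i j
    using strict_mono_on_less_eq[OF t] that by auto
  have lt: "t i < t j \<longleftrightarrow> i < j" if "i \<le> n" "j \<le> n" for i j
    using le[OF that(2,1)] by (metis not_le)
  have pq: "p \<le> q" using ab p q le by simp
  have "(\<Sum>i<n. indicator {a<..b} (t (Suc i)) * (F (t (Suc i)) - F (t i)))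
      = (\<Sum>i<n. if i \<in> {p..<q} then F (t (Suc i)) - F (t i) else 0)"
    by (rule sum.cong) (auto simp: indicator_def lt le p q Suc_le_eq less_Suc_eq_le)
  also have "\<dots> = (\<Sum>i\<in>{..<n} \<inter> {p..<q}. F (t (Suc i)) - F (t i))"
    by (subst sum.inter_restrict) auto
  also have "{..<n} \<inter> {p..<q} = {p..<q}" using q by auto
  also have "(\<Sum>i=p..<q. F (t (Suc i)) - F (t i)) = F (t q) - F (t p)"
    by (rule sum_Suc_diff'[of p q "\<lambda>i. F (t i)"]) (rule pq)
  finally show ?thesis by (simp add: p q)
qed

definition endpoints :: "rectangles \<Rightarrow> real set" where
  "endpoints ps = (\<Union>(c, (a, b), (a', b')) \<in> set ps. {a, b, a', b'})"

lemma step_fun_Nil: "step_fun [] = (\<lambda>_. 0)"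
  by (auto simp: step_fun_def)

lemma step_fun_Cons:
  "step_fun ((c, (a, b), (a', b')) # ps) (x, y) =
     c * indicator {a<..b} x * indicator {a'<..b'} y + step_fun ps (x, y)"
  by (simp add: step_fun_def)

lemma off_diagonal_Cons:
  "off_diagonal ((c, (a, b), (a', b')) # ps) \<longleftrightarrow>
     a \<le> b \<and> a' \<le> b' \<and> {a<..b} \<inter> {a'<..b'} = {} \<and> off_diagonal ps"
  by (auto simp: off_diagonal_def)

text \<open>For the paths of a Brownian motion in place of both \<open>F\<close> and \<open>G\<close> the left-hand side is the
  integral of the step function; for the functions \<open>b \<mapsto> [x \<le> b]\<close> and \<open>b \<mapsto> [y \<le> b]\<close> it is
  the value of the step function at \<open>(x, y)\<close>. Intervals are open on the left, hence the
  coefficients are read off at the right end points of the cells.\<close>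

lemma bilinear_partition:
  fixes F G :: "real \<Rightarrow> real"
  assumes t: "strict_mono_on {..n} t" and "endpoints ps \<subseteq> t ` {..n}" "off_diagonal ps"
  shows "(\<Sum>(c, (a, b), (a', b'))\<leftarrow>ps. c * (F b - F a) * (G b' - G a')) =
    (\<Sum>i<n. \<Sum>j<n. step_fun ps (t (Suc i), t (Suc j)) *
        ((F (t (Suc i)) - F (t i)) * (G (t (Suc j)) - G (t j))))"
  using assms(2,3)
proof (induction ps)
  case Nil
  then show ?case by (simp add: step_fun_Nil)
next
  case (Cons p ps)
  obtain c a b a' b' where p: "p = (c, (a, b), (a', b'))" by (metis prod.exhaust)
  have e: "a \<in> t ` {..n}" "b \<in> t ` {..n}" "a' \<in> t ` {..n}" "b' \<in> t ` {..n}"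
    "endpoints ps \<subseteq> t ` {..n}"
    using Cons.prems(1) by (auto simp: p endpoints_def)
  have o: "a \<le> b" "a' \<le> b'" "off_diagonal ps"
    using Cons.prems(2) by (auto simp: p off_diagonal_Cons)
  have "c * (F b - F a) * (G b' - G a') = (\<Sum>i<n. \<Sum>j<n.
     c * indicator {a<..b} (t (Suc i)) * indicator {a'<..b'} (t (Suc j)) *
        ((F (t (Suc i)) - F (t i)) * (G (t (Suc j)) - G (t j))))"
    unfolding increment_partition[OF t e(1,2) o(1)] increment_partition[OF t e(3,4) o(2)]
      mult.assoc sum_product
    unfolding sum_distrib_left by (intro sum.cong refl) (simp only: mult_ac)
  then show ?case
    using Cons.IH[OF e(5) o(3)]
    by (simp add: p step_fun_Cons sum.distrib distrib_right)
qed

lemma step_fun_diagonal: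
  assumes "off_diagonal ps"
  shows "step_fun ps (x, x) = 0"
  using assms
proof (induction ps)
  case (Cons p ps)
  obtain c a b a' b' where p: "p = (c, (a, b), (a', b'))" by (metis prod.exhaust)
  then show ?case using Cons by (auto simp: off_diagonal_Cons step_fun_Cons indicator_def)
qed (simp add: step_fun_Nil)

lemma finite_partition:
  fixes E :: "real set"
  assumes "finite E"
  obtains n :: nat and t where "strict_mono_on {..n} t" "E \<subseteq> t ` {..n}"
proof (rule that)
  \<comment> \<open>the number 0 only makes the list of division points non-empty\<close>
  let ?xs = "sorted_list_of_set (insert 0 E)"
  have f: "finite (insert 0 E)" using assms by auto
  have l: "length ?xs = card (insert 0 E)" by (rule length_sorted_list_of_set)
  then have l0: "length ?xs > 0" using f by (simp only: card_gt_0_iff l) auto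
  then have "{..length ?xs - 1} = {..<length ?xs}" by auto
  then show "strict_mono_on {..length ?xs - 1} ((!) ?xs)"
    using strict_sorted_list_of_set[of "insert 0 E"] f
    by (auto simp only: strict_mono_on_def sorted_wrt_iff_nth_less lessThan_iff)
  show "E \<subseteq> (!) ?xs ` {..length ?xs - 1}"
    unfolding \<open>{..length ?xs - 1} = {..<length ?xs}\<close>
  proof
    fix x assume "x \<in> E"
    then have "x \<in> set ?xs" using f by (simp only: set_sorted_list_of_set insert_iff simp_thms)
    then show "x \<in> (!) ?xs ` {..<length ?xs}" unfolding in_set_conv_nth by blast
  qed
qed

lemma square_sum_orthogonal:
  fixes e z :: "'i \<Rightarrow> real"
  assumes "finite A" and "\<And>i. i \<in> A \<Longrightarrow> e i * e i = e i" and "\<And>i j. i \<in> A \<Longrightarrow> j \<in> A \<Longrightarrow> i \<noteq> j \<Longrightarrow> e i * e j = 0"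
  shows "(\<Sum>i\<in>A. z i * e i)\<^sup>2 = (\<Sum>i\<in>A. (z i)\<^sup>2 * e i)"
proof -
  have "(\<Sum>i\<in>A. z i * e i)\<^sup>2 = (\<Sum>i\<in>A. \<Sum>j\<in>A. if j = i then (z i)\<^sup>2 * e i else 0)"
    unfolding power2_eq_square sum_product
  proof (intro sum.cong refl)
    fix i j assume "i \<in> A" "j \<in> A"
    have "z i * e i * (z j * e j) = z i * z j * (e i * e j)" by (simp add: mult_ac)
    then show "z i * e i * (z j * e j) = (if j = i then z i * z i * e i else 0)"
      using assms(2,3)[of i] \<open>i \<in> A\<close> \<open>j \<in> A\<close> by auto
  qed
  also have "\<dots> = (\<Sum>i\<in>A. (z i)\<^sup>2 * e i)" using assms(1) by (simp add: sum.delta')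
  finally show ?thesis .
qed

lemma nn_integral_step_fun_square:
  assumes t: "strict_mono_on {..n} t" and "endpoints ps \<subseteq> t ` {..n}" "off_diagonal ps"
  shows "(\<integral>\<^sup>+ x. ennreal ((step_fun ps x)\<^sup>2) \<partial>lborel) =
    ennreal (\<Sum>i<n. \<Sum>j<n. (step_fun ps (t (Suc i), t (Suc j)))\<^sup>2 *
        ((t (Suc i) - t i) * (t (Suc j) - t j)))"
proof -
  let ?c = "\<lambda>i j. step_fun ps (t (Suc i), t (Suc j))"
  let ?I = "\<lambda>i. {t i<..t (Suc i)}"
  let ?e = "\<lambda>x i. indicator (?I i) x :: real"
  have tl: "t i < t (Suc i)" if "i < n" for i using t that by (auto simp: strict_mono_on_def)
  have ind: "(if x \<le> b then 1 else 0) - (if x \<le> a then 1 else 0) = (indicator {a<..b} x :: real)" if "a \<le> b" for a b x :: real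
    using that by (auto simp: indicator_def)
  have cells: "step_fun ps (x, y) = (\<Sum>i<n. \<Sum>j<n. ?c i j * (?e x i * ?e y j))" for x y
  proof -
    have "step_fun ps (x, y) = (\<Sum>(c, (a, b), (a', b'))\<leftarrow>ps. 
       c * ((if x \<le> b then 1 else 0) - (if x \<le> a then 1 else 0)) * 
       ((if y \<le> b' then 1 else 0) - (if y \<le> a' then 1 else 0)))"
      unfolding step_fun_def using assms(3)
      by (auto simp: off_diagonal_def ind intro!: arg_cong[where f=sum_list] map_cong)
    also have "\<dots> = (\<Sum>i<n. \<Sum>j<n. ?c i j * (?e x i * ?e y j))"
      unfolding bilinear_partition[OF assms, of "\<lambda>b. if x \<le> b then 1 else 0" "\<lambda>b. if y \<le> b then 1 else 0"]
      by (intro sum.cong refl) (simp add: ind[OF less_imp_le[OF tl]])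
    finally show ?thesis .
  qed
  have ee: "?e x i * ?e x i = ?e x i" "i < n \<Longrightarrow> j < n \<Longrightarrow> i \<noteq> j \<Longrightarrow> ?e x i * ?e x j = 0" for x i j
  proof -
    show "?e x i * ?e x i = ?e x i" by (auto simp: indicator_def)
    assume ij: "i < n" "j < n" "i \<noteq> j"
    have *: "t k \<le> t l" if "k \<le> l" "l \<le> n" for k l
      using t that by (metis atMost_iff le_trans strict_mono_on_leD)
    show "?e x i * ?e x j = 0"
      using ij *[of "Suc i" j] *[of "Suc j" i]
      by (cases "i < j") (auto simp: indicator_def)
  qed
  have sq: "(step_fun ps (x, y))\<^sup>2 = (\<Sum>i<n. \<Sum>j<n. (?c i j)\<^sup>2 * (?e x i * ?e y j))" for x y
  proof -
    have o: "(\<Sum>i<n. z i * ?e x i)\<^sup>2 = (\<Sum>i<n. (z i)\<^sup>2 * ?e x i)" for x z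
      by (rule square_sum_orthogonal[OF finite_lessThan ee(1)]) (auto simp only: lessThan_iff intro!: ee(2))
    have "(step_fun ps (x, y))\<^sup>2 = (\<Sum>i<n. (\<Sum>j<n. ?c i j * ?e y j) * ?e x i)\<^sup>2"
      unfolding sum_distrib_right
      by (rule arg_cong[where f="\<lambda>u. u\<^sup>2"], rule trans[OF cells], intro sum.cong refl) (simp only: mult_ac)
    also have "\<dots> = (\<Sum>i<n. (\<Sum>j<n. (?c i j)\<^sup>2 * ?e y j) * ?e x i)"
      unfolding o ..
    also have "\<dots> = (\<Sum>i<n. \<Sum>j<n. (?c i j)\<^sup>2 * (?e x i * ?e y j))"
      unfolding sum_distrib_right by (intro sum.cong refl) (simp only: mult_ac)
    finally show ?thesis .
  qed
  have box: "ennreal (\<Sum>i<n. \<Sum>j<n. (?c i j)\<^sup>2 * (?e x i * ?e y j)) =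
     (\<Sum>i<n. \<Sum>j<n. ennreal ((?c i j)\<^sup>2) * indicator (?I i \<times> ?I j) (x, y))" for x y
  proof -
    have "(\<Sum>i<n. \<Sum>j<n. ennreal ((?c i j)\<^sup>2) * indicator (?I i \<times> ?I j) (x, y)) =
      (\<Sum>i<n. \<Sum>j<n. ennreal ((?c i j)\<^sup>2 * (?e x i * ?e y j)))"
      by (intro sum.cong refl) (auto simp: indicator_def)
    also have "\<dots> = (\<Sum>i<n. ennreal (\<Sum>j<n. (?c i j)\<^sup>2 * (?e x i * ?e y j)))"
      by (intro sum.cong refl sum_ennreal) simp
    also have "\<dots> = ennreal (\<Sum>i<n. \<Sum>j<n. (?c i j)\<^sup>2 * (?e x i * ?e y j))"
      by (intro sum_ennreal sum_nonneg) simp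
    finally show ?thesis ..
  qed
  have em: "emeasure lborel (?I i \<times> ?I j) = ennreal ((t (Suc i) - t i) * (t (Suc j) - t j))" if "i < n" "j < n" for i j
    using tl[OF that(1)] tl[OF that(2)]
    by (subst lborel_prod[symmetric], subst lborel.emeasure_pair_measure_Times)
       (auto simp: ennreal_mult)
  have m: "?I i \<times> ?I j \<in> sets lborel" for i j
    by (simp add: borel_Times)
  have "(\<integral>\<^sup>+ x. ennreal ((step_fun ps x)\<^sup>2) \<partial>lborel) =
     (\<integral>\<^sup>+ z. (\<Sum>i<n. \<Sum>j<n. ennreal ((?c i j)\<^sup>2) * indicator (?I i \<times> ?I j) z) \<partial>lborel)"
  proof (rule nn_integral_cong)
    fix z :: "real \<times> real"
    obtain x y where z: "z = (x, y)" by (cases z)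
    show "ennreal ((step_fun ps z)\<^sup>2) = (\<Sum>i<n. \<Sum>j<n. ennreal ((?c i j)\<^sup>2) * indicator (?I i \<times> ?I j) z)"
      unfolding z by (rule trans[OF arg_cong[OF sq, of ennreal] box])
  qed
  also have "\<dots> = (\<Sum>i<n. \<integral>\<^sup>+ z. (\<Sum>j<n. ennreal ((?c i j)\<^sup>2) * indicator (?I i \<times> ?I j) z) \<partial>lborel)"
    by (intro nn_integral_sum borel_measurable_sum borel_measurable_times_ennreal
        borel_measurable_const borel_measurable_indicator m)
  also have "\<dots> = (\<Sum>i<n. \<Sum>j<n. \<integral>\<^sup>+ z. ennreal ((?c i j)\<^sup>2) * indicator (?I i \<times> ?I j) z \<partial>lborel)"
    by (intro sum.cong refl nn_integral_sum borel_measurable_times_ennreal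
        borel_measurable_const borel_measurable_indicator m)
  also have "\<dots> = (\<Sum>i<n. \<Sum>j<n. ennreal ((?c i j)\<^sup>2) * emeasure lborel (?I i \<times> ?I j))"
    using m by (intro sum.cong refl nn_integral_cmult_indicator)
  also have "\<dots> = (\<Sum>i<n. \<Sum>j<n. ennreal ((?c i j)\<^sup>2 * ((t (Suc i) - t i) * (t (Suc j) - t j))))"
    by (intro sum.cong refl) (simp only: em lessThan_iff ennreal_mult' zero_le_power2)
  also have "\<dots> = (\<Sum>i<n. ennreal (\<Sum>j<n. (?c i j)\<^sup>2 * ((t (Suc i) - t i) * (t (Suc j) - t j))))"
    using tl by (intro sum.cong refl sum_ennreal mult_nonneg_nonneg) (auto intro: less_imp_le)
  also have "\<dots> = ennreal (\<Sum>i<n. \<Sum>j<n. (?c i j)\<^sup>2 * ((t (Suc i) - t i) * (t (Suc j) - t j)))"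
    using tl by (intro sum_ennreal sum_nonneg mult_nonneg_nonneg) (auto intro: less_imp_le)
  finally show ?thesis .
qed

section \<open>Second moments of quadratic forms in independent variables\<close>

abbreviation square_dist :: "'b measure \<Rightarrow> ('b \<Rightarrow> real) \<Rightarrow> ('b \<Rightarrow> real) \<Rightarrow> ennreal" where
  "square_dist M f g \<equiv> \<integral>\<^sup>+ x. ennreal ((f x - g x)\<^sup>2) \<partial>M"

lemma power2_sum_le: "(x + y)\<^sup>2 \<le> 2 * x\<^sup>2 + 2 * y\<^sup>2" for x y :: real
  using sum_squares_bound[of x y] by (simp add: power2_sum)

locale indep_centred = prob_space M for M :: "'a measure" +
  fixes X :: "nat \<Rightarrow> 'a \<Rightarrow> real" and n :: nat and d :: "nat \<Rightarrow> real"
  assumes indep: "indep_vars (\<lambda>_. borel) X {..<n}"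
    and moments: "\<And>i k. i < n \<Longrightarrow> integrable M (\<lambda>\<omega>. X i \<omega> ^ k)"
    and mean: "\<And>i. i < n \<Longrightarrow> expectation (X i) = 0"
    and var: "\<And>i. i < n \<Longrightarrow> expectation (\<lambda>\<omega>. (X i \<omega>)\<^sup>2) = d i"
begin

lemma product_moment:
  shows product_moment_integrable: "integrable M (\<lambda>\<omega>. \<Prod>m<n. X m \<omega> ^ e m)"
    and product_moment_eq: "expectation (\<lambda>\<omega>. \<Prod>m<n. X m \<omega> ^ e m) = (\<Prod>m<n. expectation (\<lambda>\<omega>. X m \<omega> ^ e m))"
proof -
  have i: "indep_vars (\<lambda>_. borel) (\<lambda>m \<omega>. X m \<omega> ^ e m) {..<n}"
    by (rule indep_vars_compose2[OF indep]) simp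
  show "integrable M (\<lambda>\<omega>. \<Prod>m<n. X m \<omega> ^ e m)"
    by (rule indep_vars_integrable[OF _ i]) (auto intro: moments)
  show "expectation (\<lambda>\<omega>. \<Prod>m<n. X m \<omega> ^ e m) = (\<Prod>m<n. expectation (\<lambda>\<omega>. X m \<omega> ^ e m))"
    by (rule indep_vars_lebesgue_integral[OF _ i]) (auto intro: moments)
qed

text \<open>Truth values as exponents express a mixed moment as one product over all indices, whatever
  coincidences there are among \<open>i\<close>, \<open>j\<close>, \<open>k\<close>, \<open>l\<close>.\<close>

lemma quadruple_as_product:
  assumes "i < n" "j < n" "k < n" "l < n"
  shows "X i \<omega> * X j \<omega> * (X k \<omega> * X l \<omega>) =
    (\<Prod>m<n. X m \<omega> ^ (of_bool (m = i) + of_bool (m = j) + of_bool (m = k) + of_bool (m = l)))"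
proof -
  have *: "(\<Prod>m<n. X m \<omega> ^ of_bool (m = i)) = X i \<omega>" if "i < n" for i
  proof -
    have "(\<Prod>m<n. X m \<omega> ^ of_bool (m = i)) = (\<Prod>m<n. if m = i then X m \<omega> else 1)"
      by (rule prod.cong) auto
    then show ?thesis using that by (simp add: prod.delta)
  qed
  show ?thesis by (simp add: power_add prod.distrib * assms)
qed

text \<open>Two distinct pairs leave some index that occurs exactly once among \<open>i\<close>, \<open>j\<close>, \<open>k\<close>, \<open>l\<close>; by
  independence it contributes the factor \<open>expectation (X m) = 0\<close>.\<close>

lemma pair_products:
  assumes "i < n" "j < n" "k < n" "l < n" "i \<noteq> j" "k \<noteq> l"
  shows pair_products_integrable: "integrable M (\<lambda>\<omega>. X i \<omega> * X j \<omega> * (X k \<omega> * X l \<omega>))"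
    and pair_products_orthogonal: "{i, j} \<noteq> {k, l} \<Longrightarrow> expectation (\<lambda>\<omega>. X i \<omega> * X j \<omega> * (X k \<omega> * X l \<omega>)) = 0"
proof -
  show "integrable M (\<lambda>\<omega>. X i \<omega> * X j \<omega> * (X k \<omega> * X l \<omega>))"
    unfolding quadruple_as_product[OF assms(1-4)] by (rule product_moment_integrable)
  assume ne: "{i, j} \<noteq> {k, l}"
  define e :: "nat \<Rightarrow> nat" where "e m = of_bool (m = i) + of_bool (m = j) + of_bool (m = k) + of_bool (m = l)" for m
  have "i \<notin> {k, l} \<or> j \<notin> {k, l}" using ne assms by auto
  then have "\<exists>m<n. e m = 1"
  proof
    assume "i \<notin> {k, l}" then show ?thesis using assms by (intro exI[of _ i]) (auto simp: e_def)
  next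
    assume "j \<notin> {k, l}" then show ?thesis using assms by (intro exI[of _ j]) (auto simp: e_def)
  qed
  then obtain m where "m < n" "e m = 1" by auto
  then have "(\<Prod>m<n. expectation (\<lambda>\<omega>. X m \<omega> ^ e m)) = 0"
    by (intro prod_zero bexI[of _ m]) (auto simp: mean)
  then show "expectation (\<lambda>\<omega>. X i \<omega> * X j \<omega> * (X k \<omega> * X l \<omega>)) = 0"
    unfolding quadruple_as_product[OF assms(1-4)] e_def[symmetric] product_moment_eq .
qed

lemma pair_product_norm:
  assumes "i < n" "j < n" "i \<noteq> j"
  shows "expectation (\<lambda>\<omega>. (X i \<omega> * X j \<omega>)\<^sup>2) = d i * d j"
proof -
  define e :: "nat \<Rightarrow> nat" where "e m = of_bool (m = i) + of_bool (m = j) + of_bool (m = i) + of_bool (m = j)" for m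
  have "(\<Prod>m<n. expectation (\<lambda>\<omega>. X m \<omega> ^ e m)) = (\<Prod>m\<in>{i, j}. expectation (\<lambda>\<omega>. X m \<omega> ^ e m))"
    by (rule prod.mono_neutral_right) (use assms in \<open>auto simp: e_def prob_space\<close>)
  also have "\<dots> = d i * d j"
    using assms by (simp add: e_def var numeral_2_eq_2[symmetric])
  finally show ?thesis
    unfolding power2_eq_square quadruple_as_product[OF assms(1,2,1,2)] e_def[symmetric] product_moment_eq .
qed

end

lemma (in prob_space) orthogonal_family_square:
  fixes F :: "'i \<Rightarrow> 'a \<Rightarrow> real"
  assumes "finite A"
    and int: "\<And>a b. a \<in> A \<Longrightarrow> b \<in> A \<Longrightarrow> integrable M (\<lambda>\<omega>. F a \<omega> * F b \<omega>)"
    and orth: "\<And>a b. a \<in> A \<Longrightarrow> b \<in> A \<Longrightarrow> a \<noteq> b \<Longrightarrow> expectation (\<lambda>\<omega>. F a \<omega> * F b \<omega>) = 0"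
  shows orthogonal_family_integrable: "integrable M (\<lambda>\<omega>. (\<Sum>a\<in>A. c a * F a \<omega>)\<^sup>2)"
    and orthogonal_family_expectation: "expectation (\<lambda>\<omega>. (\<Sum>a\<in>A. c a * F a \<omega>)\<^sup>2) = (\<Sum>a\<in>A. (c a)\<^sup>2 * expectation (\<lambda>\<omega>. (F a \<omega>)\<^sup>2))"
proof -
  have sq: "(\<Sum>a\<in>A. c a * F a \<omega>)\<^sup>2 = (\<Sum>a\<in>A. \<Sum>b\<in>A. (c a * c b) * (F a \<omega> * F b \<omega>))" for \<omega>
    unfolding power2_eq_square sum_product by (intro sum.cong refl) simp
  show "integrable M (\<lambda>\<omega>. (\<Sum>a\<in>A. c a * F a \<omega>)\<^sup>2)"
    unfolding sq by (intro Bochner_Integration.integrable_sum integrable_mult_right int)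
  have "expectation (\<lambda>\<omega>. (\<Sum>a\<in>A. c a * F a \<omega>)\<^sup>2) = (\<Sum>a\<in>A. \<Sum>b\<in>A. (c a * c b) * expectation (\<lambda>\<omega>. F a \<omega> * F b \<omega>))"
    unfolding sq by (simp add: Bochner_Integration.integral_sum int)
  also have "\<dots> = (\<Sum>a\<in>A. \<Sum>b\<in>A. if a = b then (c a)\<^sup>2 * expectation (\<lambda>\<omega>. (F a \<omega>)\<^sup>2) else 0)"
    by (intro sum.cong refl) (auto simp: orth power2_eq_square)
  finally show "expectation (\<lambda>\<omega>. (\<Sum>a\<in>A. c a * F a \<omega>)\<^sup>2) = (\<Sum>a\<in>A. (c a)\<^sup>2 * expectation (\<lambda>\<omega>. (F a \<omega>)\<^sup>2))"
    using assms(1) by simp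
qed

context indep_centred
begin

lemma triangle_form_second_moment:
  assumes A: "A \<subseteq> {..<n} \<times> {..<n}" "\<And>i j. (i, j) \<in> A \<Longrightarrow> i \<noteq> j \<and> (j, i) \<notin> A"
  shows "integrable M (\<lambda>\<omega>. (\<Sum>(i, j)\<in>A. c i j * (X i \<omega> * X j \<omega>))\<^sup>2)"
    and "expectation (\<lambda>\<omega>. (\<Sum>(i, j)\<in>A. c i j * (X i \<omega> * X j \<omega>))\<^sup>2) = (\<Sum>(i, j)\<in>A. (c i j)\<^sup>2 * (d i * d j))"
proof -
  define F where "F = (\<lambda>(i, j) \<omega>. X i \<omega> * X j \<omega>)"
  have fin: "finite A" using A(1) finite_subset by blast
  have int: "integrable M (\<lambda>\<omega>. F a \<omega> * F b \<omega>)" if "a \<in> A" "b \<in> A" for a b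
    using that A by (cases a; cases b) (force simp: F_def intro!: pair_products_integrable)
  have orth: "expectation (\<lambda>\<omega>. F a \<omega> * F b \<omega>) = 0" if "a \<in> A" "b \<in> A" "a \<noteq> b" for a b
  proof -
    obtain i j k l where ab: "a = (i, j)" "b = (k, l)" by (metis prod.exhaust)
    have "{i, j} \<noteq> {k, l}" using that A(2) by (auto simp: ab doubleton_eq_iff)
    moreover have "i < n" "j < n" "k < n" "l < n" "i \<noteq> j" "k \<noteq> l" using that A by (auto simp: ab)
    ultimately show ?thesis unfolding F_def ab by (simp add: pair_products_orthogonal)
  qed
  have s: "(\<Sum>(i, j)\<in>A. c i j * (X i \<omega> * X j \<omega>)) = (\<Sum>a\<in>A. case_prod c a * F a \<omega>)" for \<omega>
    by (intro sum.cong) (auto simp: F_def)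
  show "integrable M (\<lambda>\<omega>. (\<Sum>(i, j)\<in>A. c i j * (X i \<omega> * X j \<omega>))\<^sup>2)"
    unfolding s by (rule orthogonal_family_integrable[OF fin int orth])
  have "expectation (\<lambda>\<omega>. (F a \<omega>)\<^sup>2) = (case a of (i, j) \<Rightarrow> d i * d j)" if "a \<in> A" for a
    using that A by (cases a) (force simp: F_def intro!: pair_product_norm)
  then show "expectation (\<lambda>\<omega>. (\<Sum>(i, j)\<in>A. c i j * (X i \<omega> * X j \<omega>))\<^sup>2) = (\<Sum>(i, j)\<in>A. (c i j)\<^sup>2 * (d i * d j))"
    unfolding s by (subst orthogonal_family_expectation[OF fin int orth]) (auto intro!: sum.cong)
qed

text \<open>Within the upper and within the lower triangle the products \<open>X i * X j\<close> are orthogonal. The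
  factor 2 pays for estimating the two triangles separately.\<close>

lemma off_diagonal_form_second_moment:
  assumes c: "\<And>i. c i i = 0"
  shows "(\<integral>\<^sup>+ \<omega>. ennreal ((\<Sum>i<n. \<Sum>j<n. c i j * (X i \<omega> * X j \<omega>))\<^sup>2) \<partial>M)
    \<le> ennreal (2 * (\<Sum>i<n. \<Sum>j<n. (c i j)\<^sup>2 * (d i * d j)))"
proof -
  let ?U = "{(i, j). i < j \<and> j < n}" and ?L = "{(i, j). j < i \<and> i < n}"
  let ?D = "{(i, j). i = j \<and> i < n}"
  define Q where "Q A \<omega> = (\<Sum>(i, j)\<in>A. c i j * (X i \<omega> * X j \<omega>))" for A \<omega>
  have fin: "finite ?U" "finite ?L" "finite ?D"
    by (rule finite_subset[of _ "{..<n} \<times> {..<n}"]; auto)+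
  have sp: "(\<Sum>i<n. \<Sum>j<n. g i j) = (\<Sum>(i,j)\<in>?U. g i j) + (\<Sum>(i,j)\<in>?L. g i j)" if "\<And>i. g i i = 0" for g :: "nat \<Rightarrow> nat \<Rightarrow> real"
  proof -
    have "(\<Sum>i<n. \<Sum>j<n. g i j) = (\<Sum>(i,j)\<in>{..<n} \<times> {..<n}. g i j)"
      by (simp add: sum.cartesian_product)
    also have "{..<n} \<times> {..<n} = (?U \<union> ?L) \<union> ?D" by auto
    also have "(\<Sum>(i,j)\<in>(?U \<union> ?L) \<union> ?D. g i j) = (\<Sum>(i,j)\<in>?U. g i j) + (\<Sum>(i,j)\<in>?L. g i j) + (\<Sum>(i,j)\<in>?D. g i j)"
      using fin by (subst sum.union_disjoint, auto)+
    also have "(\<Sum>(i,j)\<in>?D. g i j) = 0" by (rule sum.neutral) (use that in auto)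
    finally show ?thesis by simp
  qed
  have U: "integrable M (\<lambda>\<omega>. (Q ?U \<omega>)\<^sup>2)" "expectation (\<lambda>\<omega>. (Q ?U \<omega>)\<^sup>2) = (\<Sum>(i,j)\<in>?U. (c i j)\<^sup>2 * (d i * d j))"
    unfolding Q_def by (rule triangle_form_second_moment; auto)+
  have L: "integrable M (\<lambda>\<omega>. (Q ?L \<omega>)\<^sup>2)" "expectation (\<lambda>\<omega>. (Q ?L \<omega>)\<^sup>2) = (\<Sum>(i,j)\<in>?L. (c i j)\<^sup>2 * (d i * d j))"
    unfolding Q_def by (rule triangle_form_second_moment; auto)+
  have "(\<integral>\<^sup>+ \<omega>. ennreal ((\<Sum>i<n. \<Sum>j<n. c i j * (X i \<omega> * X j \<omega>))\<^sup>2) \<partial>M) 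
     = (\<integral>\<^sup>+ \<omega>. ennreal ((Q ?U \<omega> + Q ?L \<omega>)\<^sup>2) \<partial>M)"
    unfolding Q_def by (subst sp) (auto simp: c)
  also have "\<dots> \<le> (\<integral>\<^sup>+ \<omega>. ennreal (2 * (Q ?U \<omega>)\<^sup>2 + 2 * (Q ?L \<omega>)\<^sup>2) \<partial>M)"
    by (intro nn_integral_mono ennreal_leI) (rule power2_sum_le)
  also have "\<dots> = ennreal (expectation (\<lambda>\<omega>. 2 * (Q ?U \<omega>)\<^sup>2 + 2 * (Q ?L \<omega>)\<^sup>2))"
    by (rule nn_integral_eq_integral) (use U L in auto)
  also have "expectation (\<lambda>\<omega>. 2 * (Q ?U \<omega>)\<^sup>2 + 2 * (Q ?L \<omega>)\<^sup>2) =
     2 * ((\<Sum>(i,j)\<in>?U. (c i j)\<^sup>2 * (d i * d j)) + (\<Sum>(i,j)\<in>?L. (c i j)\<^sup>2 * (d i * d j)))"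
    using U L by simp
  also have "\<dots> = 2 * (\<Sum>i<n. \<Sum>j<n. (c i j)\<^sup>2 * (d i * d j))"
    by (subst sp) (auto simp: c)
  finally show ?thesis .
qed

lemma diagonal_form_second_moment:
  assumes d: "\<And>i. i < n \<Longrightarrow> d i = 1" and four: "\<And>i. i < n \<Longrightarrow> expectation (\<lambda>\<omega>. X i \<omega> ^ 4) = 3"
  shows "(\<integral>\<^sup>+ \<omega>. ennreal ((\<Sum>i<n. w i * ((X i \<omega>)\<^sup>2 - 1))\<^sup>2) \<partial>M) = ennreal (2 * (\<Sum>i<n. (w i)\<^sup>2))"
proof -
  define F where "F i \<omega> = (X i \<omega>)\<^sup>2 - 1" for i \<omega>
  have sq: "F i \<omega> * F j \<omega> = (X i \<omega> * X j \<omega>)\<^sup>2 - (X i \<omega>)\<^sup>2 - (X j \<omega>)\<^sup>2 + 1" for i j \<omega>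
    by (simp add: F_def algebra_simps power2_eq_square)
  have sq1: "F i \<omega> * F i \<omega> = (X i \<omega>)^4 - 2 * (X i \<omega>)\<^sup>2 + 1" for i \<omega>
    by (simp add: F_def algebra_simps power2_eq_square power4_eq_xxxx)
  have pint: "integrable M (\<lambda>\<omega>. (X i \<omega> * X j \<omega>)\<^sup>2)" if "i < n" "j < n" "i \<noteq> j" for i j
    using pair_products_integrable[OF that(1,2,1,2,3,3)] by (simp add: power2_eq_square)
  have int: "integrable M (\<lambda>\<omega>. F i \<omega> * F j \<omega>)" if "i < n" "j < n" for i j
  proof (cases "i = j")
    case True
    then show ?thesis using that by (simp add: sq1 moments)
  next
    case False
    then show ?thesis unfolding sq using that by (intro Bochner_Integration.integrable_add Bochner_Integration.integrable_diff pint moments) auto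
  qed
  have orth: "expectation (\<lambda>\<omega>. F i \<omega> * F j \<omega>) = 0" if "i < n" "j < n" "i \<noteq> j" for i j
    unfolding sq using that by (simp add: pint moments pair_product_norm var d prob_space)
  have nrm: "expectation (\<lambda>\<omega>. F i \<omega> * F i \<omega>) = 2" if "i < n" for i
    unfolding sq1 using that by (simp add: moments four var d prob_space)
  have "(\<integral>\<^sup>+ \<omega>. ennreal ((\<Sum>i<n. w i * F i \<omega>)\<^sup>2) \<partial>M) = ennreal (expectation (\<lambda>\<omega>. (\<Sum>i<n. w i * F i \<omega>)\<^sup>2))"
    by (intro nn_integral_eq_integral orthogonal_family_integrable) (auto intro: int orth)
  also have "expectation (\<lambda>\<omega>. (\<Sum>i<n. w i * F i \<omega>)\<^sup>2) = (\<Sum>i<n. (w i)\<^sup>2 * expectation (\<lambda>\<omega>. (F i \<omega>)\<^sup>2))"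
    by (intro orthogonal_family_expectation) (auto intro: int orth)
  also have "\<dots> = 2 * (\<Sum>i<n. (w i)\<^sup>2)"
    by (simp add: power2_eq_square nrm sum_distrib_left mult.commute)
  finally show ?thesis by (simp add: F_def)
qed

end

lemma (in two_sided_brownian_motion) increments_indep_centred:
  assumes t: "strict_mono_on {..n} t"
  shows "indep_centred M (\<lambda>i \<omega>. B (t (Suc i)) \<omega> - B (t i) \<omega>) n (\<lambda>i. t (Suc i) - t i)"
proof
  fix i k assume i: "i < n"
  then have lt: "t i < t (Suc i)" using t by (auto simp: strict_mono_on_def)
  let ?s = "sqrt (t (Suc i) - t i)"
  note D = BM_gaussian_increments[OF lt]
  have s: "0 < ?s" using lt by simp
  show "integrable M (\<lambda>\<omega>. (B (t (Suc i)) \<omega> - B (t i) \<omega>) ^ k)"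
    using integrable_normal_moment[of ?s 0 k] s distributed_integrable[OF D, of "\<lambda>x. x ^ k"] by simp
  show "expectation (\<lambda>\<omega>. B (t (Suc i)) \<omega> - B (t i) \<omega>) = 0"
    by (rule normal_distributed_expectation[OF s D])
  then show "expectation (\<lambda>\<omega>. (B (t (Suc i)) \<omega> - B (t i) \<omega>)\<^sup>2) = t (Suc i) - t i"
    using normal_distributed_variance[OF s D] lt by simp
qed (rule BM_indep_increments[OF t])

section \<open>Density of off-diagonal step functions\<close>

text \<open>The closure of the elementary functions in \<open>L\<^sup>2\<close> of the plane.\<close>

definition approx_step :: "(real \<times> real \<Rightarrow> real) \<Rightarrow> bool" where
  "approx_step f \<longleftrightarrow> f \<in> borel_measurable lborel \<and>
     (\<forall>e>0. \<exists>ps. off_diagonal ps \<and> (square_dist lborel (step_fun ps) f) \<le> ennreal e)"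

lemma step_fun_append: "step_fun (ps @ qs) x = step_fun ps x + step_fun qs x"
  by (cases x) (simp add: step_fun_def)

lemma step_integral_append: "step_integral B (ps @ qs) \<omega> = step_integral B ps \<omega> + step_integral B qs \<omega>"
  by (simp add: step_integral_def)

lemma off_diagonal_append: "off_diagonal (ps @ qs) \<longleftrightarrow> off_diagonal ps \<and> off_diagonal qs"
  by (simp add: off_diagonal_def ball_Un)

definition scale_rectangles :: "real \<Rightarrow> rectangles \<Rightarrow> rectangles" where
  "scale_rectangles k = map (\<lambda>(c, r). (k * c, r))"

lemma off_diagonal_scale: "off_diagonal ps \<Longrightarrow> off_diagonal (scale_rectangles k ps)"
  by (fastforce simp: off_diagonal_def scale_rectangles_def)

lemma step_fun_scale: "step_fun (scale_rectangles k ps) x = k * step_fun ps x"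
  by (cases x) (induction ps; auto simp: step_fun_def scale_rectangles_def algebra_simps)

lemma step_integral_scale: "step_integral B (scale_rectangles k ps) \<omega> = k * step_integral B ps \<omega>"
  by (induction ps) (auto simp: step_integral_def scale_rectangles_def algebra_simps)

lemma step_fun_measurable [measurable]: "step_fun ps \<in> borel_measurable borel"
proof (induction ps)
  case (Cons p ps)
  obtain c a b a' b' where p: "p = (c, (a, b), (a', b'))" by (metis prod.exhaust)
  have "step_fun (p # ps) = (\<lambda>x. c * indicator ({a<..b} \<times> {a'<..b'}) x + step_fun ps x)"
    by (auto simp: p step_fun_def indicator_def)
  then show ?case using Cons
    by (auto intro!: borel_measurable_add borel_measurable_times borel_measurable_indicator borel_Times)
qed (simp add: step_fun_Nil)

lemma nn_integral_square_triangle: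
  fixes f g h :: "'b \<Rightarrow> real"
  assumes [measurable]: "f \<in> borel_measurable M" "g \<in> borel_measurable M" "h \<in> borel_measurable M"
  shows "(square_dist M f h) \<le>
    2 * (square_dist M f g) + 2 * (square_dist M g h)"
proof -
  have "(square_dist M f h) \<le>
      (\<integral>\<^sup>+ x. 2 * ennreal ((f x - g x)\<^sup>2) + 2 * ennreal ((g x - h x)\<^sup>2) \<partial>M)"
  proof (rule nn_integral_mono)
    fix x
    have "(f x - h x)\<^sup>2 \<le> 2 * (f x - g x)\<^sup>2 + 2 * (g x - h x)\<^sup>2"
      using power2_sum_le[of "f x - g x" "g x - h x"] by simp
    then have "ennreal ((f x - h x)\<^sup>2) \<le> ennreal (2 * (f x - g x)\<^sup>2 + 2 * (g x - h x)\<^sup>2)"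
      by (rule ennreal_leI)
    then show "ennreal ((f x - h x)\<^sup>2) \<le> 2 * ennreal ((f x - g x)\<^sup>2) + 2 * ennreal ((g x - h x)\<^sup>2)"
      by (simp add: ennreal_mult)
  qed
  also have "\<dots> = 2 * (square_dist M f g) + 2 * (square_dist M g h)"
    by (simp add: nn_integral_add nn_integral_cmult)
  finally show ?thesis .
qed

lemma approx_step_closed:
  assumes f: "f \<in> borel_measurable lborel"
    and "\<And>e. e > 0 \<Longrightarrow> \<exists>g. approx_step g \<and> (square_dist lborel g f) \<le> ennreal e"
  shows "approx_step f"
  unfolding approx_step_def
proof (intro conjI allI impI f)
  fix e :: real assume e: "e > 0"
  then obtain g where g: "approx_step g" "(square_dist lborel g f) \<le> ennreal (e/4)"
    using assms(2)[of "e/4"] by auto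
  from g(1) e obtain ps where ps: "off_diagonal ps" "(square_dist lborel (step_fun ps) g) \<le> ennreal (e/4)"
    unfolding approx_step_def by (metis zero_less_divide_iff zero_less_numeral)
  have gm: "g \<in> borel_measurable lborel" using g by (simp add: approx_step_def)
  have "(square_dist lborel (step_fun ps) f) \<le> 2 * ennreal (e/4) + 2 * ennreal (e/4)"
    by (rule order_trans[OF nn_integral_square_triangle[where g=g]])
       (use f gm ps g in \<open>auto intro!: add_mono mult_left_mono\<close>)
  also have "\<dots> = ennreal e"
    using e by (simp add: ennreal_mult'[symmetric] ennreal_plus[symmetric] flip: ennreal_numeral del: ennreal_plus)
  finally show "\<exists>ps. off_diagonal ps \<and> (square_dist lborel (step_fun ps) f) \<le> ennreal e"
    using ps by blast
qed

lemma approx_step_step: "off_diagonal ps \<Longrightarrow> approx_step (step_fun ps)"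
  unfolding approx_step_def by (auto intro!: exI[of _ ps])

lemma approx_step_zero: "approx_step (\<lambda>_. 0)"
  using approx_step_step[of "[]"] by (simp add: step_fun_Nil off_diagonal_def)

lemma approx_step_add:
  assumes "approx_step f" "approx_step g"
  shows "approx_step (\<lambda>x. f x + g x)"
  unfolding approx_step_def
proof (intro conjI allI impI)
  have fm[measurable]: "f \<in> borel_measurable borel" and gm[measurable]: "g \<in> borel_measurable borel"
    using assms by (auto simp: approx_step_def)
  show "(\<lambda>x. f x + g x) \<in> borel_measurable lborel" by simp
  fix e :: real assume e: "e > 0"
  obtain ps where ps: "off_diagonal ps" "(square_dist lborel (step_fun ps) f) \<le> ennreal (e/4)"
    using assms(1) e unfolding approx_step_def by (metis zero_less_divide_iff zero_less_numeral)
  obtain qs where qs: "off_diagonal qs" "(square_dist lborel (step_fun qs) g) \<le> ennreal (e/4)"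
    using assms(2) e unfolding approx_step_def by (metis zero_less_divide_iff zero_less_numeral)
  have "(\<integral>\<^sup>+ x. ennreal ((step_fun (ps @ qs) x - (f x + g x))\<^sup>2) \<partial>lborel) \<le>
     2 * (\<integral>\<^sup>+ x. ennreal (((step_fun ps x + step_fun qs x) - (f x + step_fun qs x))\<^sup>2) \<partial>lborel) +
     2 * (\<integral>\<^sup>+ x. ennreal (((f x + step_fun qs x) - (f x + g x))\<^sup>2) \<partial>lborel)"
    unfolding step_fun_append by (rule nn_integral_square_triangle) simp_all
  also have "\<dots> \<le> 2 * ennreal (e/4) + 2 * ennreal (e/4)"
    using ps qs by (auto intro!: add_mono mult_left_mono)
  also have "\<dots> = ennreal e"
    using e by (simp add: ennreal_mult'[symmetric] ennreal_plus[symmetric] flip: ennreal_numeral del: ennreal_plus)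
  finally show "\<exists>ps. off_diagonal ps \<and> (\<integral>\<^sup>+ x. ennreal ((step_fun ps x - (f x + g x))\<^sup>2) \<partial>lborel) \<le> ennreal e"
    using ps qs by (auto simp: off_diagonal_append intro!: exI[of _ "ps @ qs"])
qed

lemma approx_step_cmult:
  assumes "approx_step f"
  shows "approx_step (\<lambda>x. k * f x)"
  unfolding approx_step_def
proof (intro conjI allI impI)
  have fm[measurable]: "f \<in> borel_measurable borel"
    using assms by (auto simp: approx_step_def)
  show "(\<lambda>x. k * f x) \<in> borel_measurable lborel" by simp
  fix e :: real assume e: "e > 0"
  define d where "d = e / (k\<^sup>2 + 1)"
  have d: "d > 0" "k\<^sup>2 * d \<le> e"
  proof -
    have "k\<^sup>2 + 1 > 0" by (smt (verit) zero_le_power2)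
    then show "d > 0" using e by (simp add: d_def)
    have "k\<^sup>2 * d \<le> (k\<^sup>2 + 1) * d" using \<open>d > 0\<close> by simp
    also have "\<dots> = e" using \<open>k\<^sup>2 + 1 > 0\<close> by (simp add: d_def)
    finally show "k\<^sup>2 * d \<le> e" .
  qed
  obtain ps where ps: "off_diagonal ps" "(square_dist lborel (step_fun ps) f) \<le> ennreal d"
    using assms(1) d(1) unfolding approx_step_def by blast
  have "(\<integral>\<^sup>+ x. ennreal ((step_fun (scale_rectangles k ps) x - k * f x)\<^sup>2) \<partial>lborel) =
    (\<integral>\<^sup>+ x. ennreal (k\<^sup>2) * ennreal ((step_fun ps x - f x)\<^sup>2) \<partial>lborel)"
    by (intro nn_integral_cong) (simp add: step_fun_scale ennreal_mult'[symmetric] power_mult_distrib[symmetric] right_diff_distrib)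
  also have "\<dots> = ennreal (k\<^sup>2) * (square_dist lborel (step_fun ps) f)"
    by (rule nn_integral_cmult) simp
  also have "\<dots> \<le> ennreal (k\<^sup>2) * ennreal d" using ps by (auto intro: mult_left_mono)
  also have "\<dots> \<le> ennreal e" using d by (simp add: ennreal_mult'[symmetric] ennreal_leI)
  finally show "\<exists>ps. off_diagonal ps \<and> (\<integral>\<^sup>+ x. ennreal ((step_fun ps x - k * f x)\<^sup>2) \<partial>lborel) \<le> ennreal e"
    using ps off_diagonal_scale by blast
qed

lemma approx_step_diff: "approx_step f \<Longrightarrow> approx_step g \<Longrightarrow> approx_step (\<lambda>x. f x - g x)"
  using approx_step_add[OF _ approx_step_cmult[of g "-1"], of f] by simp

lemma approx_step_sum:
  "finite I \<Longrightarrow> (\<And>i. i \<in> I \<Longrightarrow> approx_step (f i)) \<Longrightarrow> approx_step (\<lambda>x. \<Sum>i\<in>I. f i x)"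
  by (induction I rule: finite_induct) (auto intro: approx_step_zero approx_step_add)

lemma approx_step_dominated:
  fixes U :: "nat \<Rightarrow> real \<times> real \<Rightarrow> real"
  assumes U: "\<And>k. approx_step (U k)" and [measurable]: "f \<in> borel_measurable borel" "g \<in> borel_measurable borel"
    and lim: "AE x in lborel. (\<lambda>k. U k x) \<longlonglongrightarrow> f x"
    and bound: "\<And>k. AE x in lborel. \<bar>U k x - f x\<bar> \<le> g x" and g: "(\<integral>\<^sup>+ x. ennreal ((g x)\<^sup>2) \<partial>lborel) < \<infinity>"
  shows "approx_step f"
proof (rule approx_step_closed)
  have Um[measurable]: "U k \<in> borel_measurable borel" for k using U[of k] by (simp add: approx_step_def)
  have "(\<lambda>k. \<integral>\<^sup>+ x. ennreal ((U k x - f x)\<^sup>2) \<partial>lborel) \<longlonglongrightarrow> (\<integral>\<^sup>+ x. 0 \<partial>(lborel :: (real \<times> real) measure))"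
  proof (rule nn_integral_dominated_convergence[where w="\<lambda>x. ennreal ((g x)\<^sup>2)"])
    show "AE x in lborel. ennreal ((U k x - f x)\<^sup>2) \<le> ennreal ((g x)\<^sup>2)" for k
      using bound[of k]
    proof eventually_elim
      case (elim x)
      then have "\<bar>U k x - f x\<bar>\<^sup>2 \<le> (g x)\<^sup>2" by (intro power_mono) auto
      then show ?case by (intro ennreal_leI) simp
    qed
    show "AE x in lborel. (\<lambda>k. ennreal ((U k x - f x)\<^sup>2)) \<longlonglongrightarrow> 0"
      using lim
    proof eventually_elim
      case (elim x)
      have "(\<lambda>k. (U k x - f x)\<^sup>2) \<longlonglongrightarrow> (f x - f x)\<^sup>2" by (intro tendsto_intros elim)
      then have "(\<lambda>k. ennreal ((U k x - f x)\<^sup>2)) \<longlonglongrightarrow> ennreal ((f x - f x)\<^sup>2)" by (rule tendsto_ennrealI)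
      then show ?case by simp
    qed
  qed (use g in auto)
  then have lim0: "(\<lambda>k. \<integral>\<^sup>+ x. ennreal ((U k x - f x)\<^sup>2) \<partial>lborel) \<longlonglongrightarrow> 0" by simp
  fix e :: real assume "e > 0"
  then have "\<forall>\<^sub>F k in sequentially. (square_dist lborel (U k) f) < ennreal e"
    by (intro order_tendstoD(2)[OF lim0]) simp
  then obtain k where "(square_dist lborel (U k) f) < ennreal e"
    by (auto simp: eventually_sequentially)
  then show "\<exists>g. approx_step g \<and> (square_dist lborel g f) \<le> ennreal e"
    using U by (intro exI[of _ "U k"]) auto
qed simp

lemma approx_step_disjoint_UN:
  fixes A :: "nat \<Rightarrow> (real \<times> real) set"
  assumes ap: "\<And>i. approx_step (indicator (A i))" and dj: "disjoint_family A"
    and [measurable]: "\<And>i. A i \<in> sets borel" and fin: "emeasure lborel (\<Union>i. A i) < \<infinity>"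
  shows "approx_step (indicator (\<Union>i. A i))"
proof (rule approx_step_dominated[where g="indicator (\<Union>i. A i)"])
  fix k
  have eq: "indicator (\<Union>i<k. A i) = (\<lambda>x. \<Sum>i<k. indicator (A i) x :: real)"
    using dj by (intro ext indicator_UN_disjoint) (auto simp: disjoint_family_on_def)
  show "approx_step (indicator (\<Union>i<k. A i))"
    unfolding eq by (intro approx_step_sum ap) auto
  show "AE x in lborel. \<bar>indicator (\<Union>i<k. A i) x - indicator (\<Union>i. A i) x\<bar> \<le> (indicator (\<Union>i. A i) x :: real)"
    by (auto simp: indicator_def)
next
  show "AE x in lborel. (\<lambda>k. indicator (\<Union>i<k. A i) x :: real) \<longlonglongrightarrow> indicator (\<Union>i. A i) x"
    by (intro AE_I2 LIMSEQ_indicator_UN)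
  have "(\<integral>\<^sup>+ x. ennreal ((indicator (\<Union>i. A i) x)\<^sup>2) \<partial>lborel) = emeasure lborel (\<Union>i. A i)"
    by (subst nn_integral_indicator[symmetric], simp) (intro nn_integral_cong, auto simp: indicator_def)
  then show "(\<integral>\<^sup>+ x. ennreal ((indicator (\<Union>i. A i) x)\<^sup>2) \<partial>lborel) < \<infinity>" using fin by simp
qed simp_all

definition off_diagonal_rectangle :: "(real \<times> real) set \<Rightarrow> bool" where
  "off_diagonal_rectangle R \<longleftrightarrow> (\<exists>a b c d. R = {a<..b} \<times> {c<..d} \<and> {a<..b} \<inter> {c<..d} = {})"

lemma approx_step_rectangle:
  assumes "off_diagonal_rectangle R"
  shows "approx_step (indicator R)"
proof -
  obtain a b c d where R: "R = {a<..b} \<times> {c<..d}" "{a<..b} \<inter> {c<..d} = {}"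
    using assms by (auto simp: off_diagonal_rectangle_def)
  show ?thesis
  proof (cases "a \<le> b \<and> c \<le> d")
    case True
    then have "off_diagonal [(1, (a, b), (c, d))]" using R by (auto simp: off_diagonal_def)
    moreover have "step_fun [(1, (a, b), (c, d))] = indicator R"
      by (auto simp: step_fun_def R indicator_def)
    ultimately show ?thesis using approx_step_step by metis
  next
    case False
    then have "indicator R = (\<lambda>_. 0 :: real)" by (auto simp: R indicator_def)
    then show ?thesis using approx_step_zero by simp
  qed
qed

lemma off_diagonal_rectangle_Int:
  assumes "off_diagonal_rectangle R"
  shows "off_diagonal_rectangle ({a<..b} \<times> {c<..d} \<inter> R)"
proof -
  obtain a' b' c' d' where R: "R = {a'<..b'} \<times> {c'<..d'}" "{a'<..b'} \<inter> {c'<..d'} = {}"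
    using assms by (auto simp: off_diagonal_rectangle_def)
  have "{a<..b} \<times> {c<..d} \<inter> R = {max a a'<..min b b'} \<times> {max c c'<..min d d'}" by (auto simp: R)
  moreover have "{max a a'<..min b b'} \<inter> {max c c'<..min d d'} = {}" using R(2) by auto
  ultimately show ?thesis unfolding off_diagonal_rectangle_def by blast
qed

lemma sets_borel_plane:
  "sets (borel :: (real \<times> real) measure) =
     sigma_sets UNIV {R. \<exists>a b c d. R = {a<..b} \<times> {c<..d}}"
proof -
  let ?G = "range (\<lambda>(a, b). {a<..b::real})"
  have cover: "\<exists>E\<subseteq>?G. countable E \<and> UNIV = \<Union>E"
  proof (intro exI conjI)
    show "range (\<lambda>n::nat. {- real n<..real n}) \<subseteq> ?G" by auto
    show "UNIV = \<Union>(range (\<lambda>n::nat. {- real n<..real n}))"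
    proof (intro equalityI subsetI)
      fix x :: real
      obtain n where "\<bar>x\<bar> < real n" using reals_Archimedean2 by blast
      then show "x \<in> \<Union>(range (\<lambda>n::nat. {- real n<..real n}))" by (intro UN_I[of n]) auto
    qed simp
  qed simp
  have "(borel :: (real \<times> real) measure) = borel \<Otimes>\<^sub>M borel" by (rule borel_prod[symmetric])
  also have "\<dots> = sigma UNIV ?G \<Otimes>\<^sub>M sigma UNIV ?G" using borel_sigma_sets_Ioc by simp
  also have "\<dots> = sigma (UNIV \<times> UNIV) {a \<times> b | a b. a \<in> ?G \<and> b \<in> ?G}"
    by (rule sigma_prod) (use cover in auto)
  also have "{a \<times> b | a b. a \<in> ?G \<and> b \<in> ?G} = {R. \<exists>a b c d. R = {a<..b} \<times> {c<..d}}" by auto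
  finally have "sets (borel :: (real \<times> real) measure) = sets (sigma UNIV {R. \<exists>a b c d. R = {a<..b} \<times> {c<..d :: real}})"
    by (metis UNIV_Times_UNIV)
  also have "\<dots> = sigma_sets UNIV {R. \<exists>a b c d. R = {a<..b} \<times> {c<..d}}"
    by (rule sets_measure_of) simp
  finally show ?thesis .
qed

lemma emeasure_rectangle_finite:
  "emeasure lborel ({a<..b::real} \<times> {c<..d::real}) < \<infinity>"
  by (subst lborel_prod[symmetric], subst lborel.emeasure_pair_measure_Times)
     (cases "a \<le> b"; cases "c \<le> d"; auto simp: ennreal_mult_less_top)+

text \<open>Inside one fixed off-diagonal rectangle a Dynkin argument applies: intersecting the generating
  rectangles with it keeps them off the diagonal, and complements have finite measure.\<close>

lemma approx_step_Int_rectangle: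
  assumes R: "off_diagonal_rectangle R" and A: "A \<in> sets borel"
  shows "approx_step (indicator (A \<inter> R))"
proof -
  let ?G = "{R. \<exists>a b c d. R = {a<..b} \<times> {c<..d}} :: (real \<times> real) set set"
  have Rb: "R \<in> sets borel" and Rf: "emeasure lborel R < \<infinity>"
    using R emeasure_rectangle_finite by (auto simp: off_diagonal_rectangle_def borel_Times)
  have "Int_stable ?G"
  proof (rule Int_stableI)
    fix X Y assume "X \<in> ?G" "Y \<in> ?G"
    then obtain a b c d a' b' c' d' where "X = {a<..b} \<times> {c<..d}" "Y = {a'<..b'} \<times> {c'<..d'}" by auto
    then have "X \<inter> Y = {max a a'<..min b b'} \<times> {max c c'<..min d d'}" by auto
    then show "X \<inter> Y \<in> ?G" by blast
  qed
  moreover have "?G \<subseteq> Pow UNIV" by simp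
  moreover have "A \<in> sigma_sets UNIV ?G" using A by (simp add: sets_borel_plane)
  ultimately show ?thesis
  proof (induction rule: sigma_sets_induct_disjoint)
    case (basic A)
    then show ?case using approx_step_rectangle off_diagonal_rectangle_Int[OF R] by auto
  next
    case empty
    show ?case using approx_step_zero by simp
  next
    case (compl A)
    have "indicator ((UNIV - A) \<inter> R) = (\<lambda>x. indicator R x - indicator (A \<inter> R) x :: real)"
      by (auto simp: indicator_def)
    then show ?case using approx_step_diff[OF approx_step_rectangle[OF R] compl.IH] by simp
  next
    case (union A)
    have m: "A i \<inter> R \<in> sets borel" for i using union.hyps(2) Rb by (auto simp: sets_borel_plane[symmetric])
    have "approx_step (indicator (\<Union>i. A i \<inter> R))"
    proof (rule approx_step_disjoint_UN)
      show "disjoint_family (\<lambda>i. A i \<inter> R)" using union.hyps(1) by (auto simp: disjoint_family_on_def)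
      have "emeasure lborel (\<Union>i. A i \<inter> R) \<le> emeasure lborel R"
        by (rule emeasure_mono) (use Rb in auto)
      then show "emeasure lborel (\<Union>i. A i \<inter> R) < \<infinity>" using Rf by simp
    qed (use union.IH m in auto)
    moreover have "(\<Union>i. A i \<inter> R) = \<Union>(range A) \<inter> R" by auto
    ultimately show ?case by simp
  qed
qed

lemma diagonal_null: "AE z in lborel. fst z \<noteq> (snd z :: real)"
proof -
  have "closed {z :: real \<times> real. fst z = snd z}" by (intro closed_Collect_eq continuous_intros)
  then have "{z :: real \<times> real. fst z = snd z} \<in> sets borel" by (rule borel_closed)
  then have "- {z :: real \<times> real. fst z = snd z} \<in> sets borel" by simp
  then have m: "{z \<in> space (lborel \<Otimes>\<^sub>M lborel). fst z \<noteq> (snd z :: real)} \<in> sets (lborel \<Otimes>\<^sub>M lborel)"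
    by (simp only: lborel_prod sets_lborel space_lborel Compl_eq) simp
  have "AE x in lborel. AE y in lborel. x \<noteq> (y :: real)"
  proof (rule AE_I2)
    fix x :: real
    show "AE y in lborel. x \<noteq> y" using AE_lborel_singleton[of x] by eventually_elim auto
  qed
  with m have "AE z in lborel \<Otimes>\<^sub>M lborel. fst z \<noteq> (snd z :: real)"
    by (subst (asm) lborel_pair.AE_pair_iff) simp_all
  then show ?thesis by (simp only: lborel_prod)
qed

text \<open>Two distinct coordinates are separated by a rational number \<open>q\<close>, so the rectangles
  \<open>{p<..q} \<times> {q<..s}\<close> with rational corners, and their reflections, cover the complement of the
  diagonal.\<close>

lemma off_diagonal_cover:
  obtains R :: "nat \<Rightarrow> (real \<times> real) set" where "\<And>k. off_diagonal_rectangle (R k)" "(\<Union>k. R k) = {z. fst z \<noteq> snd z}"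
proof -
  define S where "S = (\<Union>p\<in>\<rat>. \<Union>q\<in>\<rat>. \<Union>s\<in>\<rat>. {{p<..q} \<times> {q<..s}, {q<..s} \<times> {p<..q :: real}})"
  have c: "countable S" unfolding S_def by (intro countable_UN countable_rat) auto
  have ne: "S \<noteq> {}" unfolding S_def by (auto intro: Rats_0)
  have r: "off_diagonal_rectangle X" if XS: "X \<in> S" for X
  proof -
    obtain p q s where "X = {p<..q} \<times> {q<..s} \<or> X = {q<..s} \<times> {p<..q}" using XS unfolding S_def by (elim UN_E insertE) auto
    moreover have "{p<..q} \<inter> {q<..s} = {}" "{q<..s} \<inter> {p<..q} = {}" by auto
    ultimately show ?thesis unfolding off_diagonal_rectangle_def by blast
  qed
  have ex: "\<exists>p\<in>\<rat>. \<exists>q\<in>\<rat>. \<exists>s\<in>\<rat>. p < x \<and> x < q \<and> q < y \<and> y < s" if "x < y" for x y :: real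
    using Rats_dense_in_real[of "x - 1" x] Rats_dense_in_real[OF that] Rats_dense_in_real[of y "y + 1"] by auto
  have "\<Union>S = {z. fst z \<noteq> snd z}"
  proof (intro equalityI subsetI)
    fix z assume "z \<in> \<Union>S" then show "z \<in> {z. fst z \<noteq> snd z}" unfolding S_def by auto
  next
    fix z :: "real \<times> real" assume "z \<in> {z. fst z \<noteq> snd z}"
    then have "fst z \<noteq> snd z" by (rule CollectD)
    then consider "fst z < snd z" | "snd z < fst z" unfolding neq_iff by blast
    then show "z \<in> \<Union>S"
    proof cases
      case 1
      obtain p q s where pqs: "p \<in> \<rat>" "q \<in> \<rat>" "s \<in> \<rat>" "p < fst z" "fst z < q" "q < snd z" "snd z < s" using ex[OF 1] by blast
      have "{p<..q} \<times> {q<..s} \<in> S" unfolding S_def 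
        by (rule UN_I[OF pqs(1)], rule UN_I[OF pqs(2)], rule UN_I[OF pqs(3)]) simp
      moreover have "z \<in> {p<..q} \<times> {q<..s}" using pqs by (simp add: mem_Times_iff)
      ultimately show ?thesis by blast
    next
      case 2
      obtain p q s where pqs: "p \<in> \<rat>" "q \<in> \<rat>" "s \<in> \<rat>" "p < snd z" "snd z < q" "q < fst z" "fst z < s" using ex[OF 2] by blast
      have "{q<..s} \<times> {p<..q} \<in> S" unfolding S_def 
        by (rule UN_I[OF pqs(1)], rule UN_I[OF pqs(2)], rule UN_I[OF pqs(3)]) simp
      moreover have "z \<in> {q<..s} \<times> {p<..q}" using pqs by (simp add: mem_Times_iff)
      ultimately show ?thesis by blast
    qed
  qed
  with c ne r show ?thesis
    by (intro that[of "from_nat_into S"]) (auto simp: from_nat_into range_from_nat_into)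
qed

text \<open>The diagonal is a null set. Disjointifying the cover of its complement splits the set into
  countably many pieces, each of which lies in a single off-diagonal rectangle.\<close>

lemma approx_step_finite_measure:
  assumes A[measurable]: "A \<in> sets borel" and fin: "emeasure lborel A < \<infinity>"
  shows "approx_step (indicator A)"
proof -
  obtain R :: "nat \<Rightarrow> (real \<times> real) set"
    where R: "\<And>k. off_diagonal_rectangle (R k)" "(\<Union>k. R k) = {z. fst z \<noteq> snd z}"
    by (rule off_diagonal_cover) (rule that)
  have Rb[measurable]: "R k \<in> sets borel" for k
    using R(1)[of k] by (auto simp: off_diagonal_rectangle_def borel_Times)
  have Db: "disjointed R k \<in> sets borel" for k
    using sets.range_disjointed_sets[of R] Rb by blast
  define D where "D k = A \<inter> disjointed R k" for k
  have Dm: "D k \<in> sets borel" for k using Db by (auto simp: D_def)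
  have U: "(\<Union>k. D k) = A \<inter> {z. fst z \<noteq> snd z}"
    unfolding D_def R(2)[symmetric] UN_disjointed_eq[symmetric, of R] by auto
  have ap: "approx_step (indicator (\<Union>k. D k))"
  proof (rule approx_step_disjoint_UN)
    fix k
    have "D k = D k \<inter> R k" using disjointed_subset[of R k] by (auto simp: D_def)
    then show "approx_step (indicator (D k))" using approx_step_Int_rectangle[OF R(1) Dm] by metis
    show "disjoint_family D" using disjoint_family_disjointed[of R] unfolding D_def disjoint_family_on_def by auto
    have "emeasure lborel (\<Union>k. D k) \<le> emeasure lborel A"
      by (rule emeasure_mono) (auto simp: D_def)
    then show "emeasure lborel (\<Union>k. D k) < \<infinity>" using fin by simp
  qed (rule Dm)
  show ?thesis
  proof (rule approx_step_dominated[where U="\<lambda>_. indicator (\<Union>k. D k)" and g="\<lambda>_. 0"])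
    show "AE x in lborel. (\<lambda>k. indicator (\<Union>k. D k) x :: real) \<longlonglongrightarrow> indicator A x"
      using diagonal_null by eventually_elim (auto simp: U indicator_def)
    show "AE x in lborel. \<bar>indicator (\<Union>k. D k) x - indicator A x :: real\<bar> \<le> 0"
      using diagonal_null by eventually_elim (auto simp: U indicator_def)
  qed (use ap in auto)
qed

lemma approx_step_nonneg:
  assumes "f \<in> borel_measurable borel" "\<And>x. 0 \<le> f x" "(\<integral>\<^sup>+ x. ennreal ((f x)\<^sup>2) \<partial>lborel) < \<infinity>"
  shows "approx_step f"
  using assms
proof (induction rule: borel_measurable_induct_real)
  case (set A)
  have "(\<integral>\<^sup>+ x. ennreal ((indicator A x)\<^sup>2) \<partial>lborel) = emeasure lborel A"
    using set by (subst nn_integral_indicator[symmetric], simp) (intro nn_integral_cong, auto simp: indicator_def)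
  then show ?case using set approx_step_finite_measure by simp
next
  case (mult u c)
  show ?case
  proof (cases "c = 0")
    case True
    then show ?thesis using approx_step_zero by simp
  next
    case False
    have [measurable]: "u \<in> borel_measurable borel" by fact
    have "(\<integral>\<^sup>+ x. ennreal ((c * u x)\<^sup>2) \<partial>lborel) = ennreal (c\<^sup>2) * (\<integral>\<^sup>+ x. ennreal ((u x)\<^sup>2) \<partial>lborel)"
      by (subst nn_integral_cmult[symmetric]) (auto simp: power_mult_distrib ennreal_mult')
    then have "(\<integral>\<^sup>+ x. ennreal ((u x)\<^sup>2) \<partial>lborel) < \<infinity>"
      using mult.prems False by (auto simp: ennreal_mult_less_top)
    then show ?thesis using mult approx_step_cmult by blast
  qed
next
  case (add u v)
  have "(\<integral>\<^sup>+ x. ennreal ((u x)\<^sup>2) \<partial>lborel) \<le> (\<integral>\<^sup>+ x. ennreal ((v x + u x)\<^sup>2) \<partial>lborel)"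
    using add by (intro nn_integral_mono ennreal_leI power_mono) auto
  moreover have "(\<integral>\<^sup>+ x. ennreal ((v x)\<^sup>2) \<partial>lborel) \<le> (\<integral>\<^sup>+ x. ennreal ((v x + u x)\<^sup>2) \<partial>lborel)"
    using add by (intro nn_integral_mono ennreal_leI power_mono) auto
  ultimately show ?case using add by (intro approx_step_add) auto
next
  case (seq U)
  have le: "U i x \<le> f x" for i x
    using seq.hyps(3) seq.hyps(4)[of x] by (intro incseq_le) (auto simp only: incseq_def le_fun_def space_borel UNIV_I)
  show ?case
  proof (rule approx_step_dominated[where U=U and g=f])
    fix i
    have "(\<integral>\<^sup>+ x. ennreal ((U i x)\<^sup>2) \<partial>lborel) \<le> (\<integral>\<^sup>+ x. ennreal ((f x)\<^sup>2) \<partial>lborel)"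
      using seq le by (intro nn_integral_mono ennreal_leI power_mono) auto
    then show "approx_step (U i)" using seq by simp
    show "AE x in lborel. \<bar>U i x - f x\<bar> \<le> f x" using le seq.hyps(2) by (auto intro!: AE_I2)
  next
    show "f \<in> borel_measurable borel"
      by (rule borel_measurable_LIMSEQ_real[where u=U]) (use seq in auto)
    then show "f \<in> borel_measurable borel" .
  qed (use seq in auto)
qed

section \<open>The double integral as an \<open>L\<^sup>2\<close> limit\<close>

context two_sided_brownian_motion
begin

lemma step_integral_measurable [measurable]: "step_integral B ps \<in> borel_measurable M"
proof (induction ps)
  case (Cons p ps)
  obtain c a b a' b' where p: "p = (c, (a, b), (a', b'))" by (metis prod.exhaust)
  have "step_integral B (p # ps) = (\<lambda>\<omega>. c * (B b \<omega> - B a \<omega>) * (B b' \<omega> - B a' \<omega>) + step_integral B ps \<omega>)"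
    by (auto simp: p step_integral_def)
  then show ?case using Cons
    by (auto intro!: borel_measurable_add borel_measurable_times borel_measurable_diff measurable_BM)
next
  case Nil
  have "step_integral B [] = (\<lambda>_. 0)" by (auto simp: step_integral_def)
  then show ?case by simp
qed

text \<open>The Wiener--Ito isometry for elementary functions, with the symmetrization estimated by a
  factor 2.\<close>

lemma step_integral_second_moment:
  assumes ps: "off_diagonal ps"
  shows "(\<integral>\<^sup>+ \<omega>. ennreal ((step_integral B ps \<omega>)\<^sup>2) \<partial>M) \<le> 2 * (\<integral>\<^sup>+ x. ennreal ((step_fun ps x)\<^sup>2) \<partial>lborel)"
proof -
  have "finite (endpoints ps)" by (auto simp: endpoints_def)
  then obtain n :: nat and t where t: "strict_mono_on {..n} t" "endpoints ps \<subseteq> t ` {..n}"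
    by (rule finite_partition)
  interpret I: indep_centred M "\<lambda>i \<omega>. B (t (Suc i)) \<omega> - B (t i) \<omega>" n "\<lambda>i. t (Suc i) - t i"
    by (rule increments_indep_centred[OF t(1)])
  define c where "c i j = step_fun ps (t (Suc i), t (Suc j))" for i j
  have c0: "c i i = 0" for i unfolding c_def by (rule step_fun_diagonal[OF ps])
  have eq: "step_integral B ps \<omega> = (\<Sum>i<n. \<Sum>j<n. c i j * ((B (t (Suc i)) \<omega> - B (t i) \<omega>) * (B (t (Suc j)) \<omega> - B (t j) \<omega>)))" for \<omega>
    unfolding step_integral_def c_def by (rule bilinear_partition[OF t ps])
  have "(\<integral>\<^sup>+ \<omega>. ennreal ((step_integral B ps \<omega>)\<^sup>2) \<partial>M)
    \<le> ennreal (2 * (\<Sum>i<n. \<Sum>j<n. (c i j)\<^sup>2 * ((t (Suc i) - t i) * (t (Suc j) - t j))))"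
    unfolding eq by (rule I.off_diagonal_form_second_moment[OF c0])
  also have "\<dots> = 2 * (\<integral>\<^sup>+ x. ennreal ((step_fun ps x)\<^sup>2) \<partial>lborel)"
    unfolding nn_integral_step_fun_square[OF t ps] c_def by (simp add: ennreal_mult')
  finally show ?thesis .
qed

lemma step_integral_diff_second_moment:
  assumes "off_diagonal ps" "off_diagonal qs"
  shows "(square_dist M (step_integral B ps) (step_integral B qs))
    \<le> 2 * (square_dist lborel (step_fun ps) (step_fun qs))"
  using step_integral_second_moment[of "ps @ scale_rectangles (-1) qs"] assms
  by (simp add: off_diagonal_append off_diagonal_scale step_integral_append step_integral_scale
      step_fun_append step_fun_scale)

end

text \<open>The Riesz--Fischer theorem. On a probability space an \<open>L\<^sup>2\<close> Cauchy sequence is Cauchy in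
  \<open>L\<^sup>1\<close>, so a subsequence converges almost surely, and Fatou's lemma shows that its limit is
  also the limit in \<open>L\<^sup>2\<close>.\<close>

lemma (in prob_space) L2_complete:
  fixes s :: "nat \<Rightarrow> 'a \<Rightarrow> real"
  assumes s[measurable]: "\<And>n. s n \<in> borel_measurable M"
    and L2: "\<And>n. (\<integral>\<^sup>+ x. ennreal ((s n x)\<^sup>2) \<partial>M) < \<infinity>"
    and cauchy: "\<And>e. e > 0 \<Longrightarrow> \<exists>N. \<forall>i\<ge>N. \<forall>j\<ge>N. (square_dist M (s i) (s j)) \<le> ennreal e"
  obtains Z where "Z \<in> borel_measurable M" "(\<lambda>n. \<integral>\<^sup>+ x. ennreal ((s n x - Z x)\<^sup>2) \<partial>M) \<longlonglongrightarrow> 0"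
proof -
  have int2: "integrable M (\<lambda>x. (s n x)\<^sup>2)" for n
    using L2[of n] by (intro integrableI_bounded) auto
  have int: "integrable M (s n)" for n
  proof (rule Bochner_Integration.integrable_bound[of _ "\<lambda>x. 1 + (s n x)\<^sup>2"])
    have "\<bar>y\<bar> \<le> 1 + y\<^sup>2" for y :: real
      using sum_squares_bound[of "\<bar>y\<bar>" 1] by simp
    then show "AE x in M. norm (s n x) \<le> norm (1 + (s n x)\<^sup>2)" by (intro AE_I2) (simp add: add_nonneg_nonneg)
  qed (use int2 in auto)
  have c1: "\<exists>N. \<forall>i\<ge>N. \<forall>j\<ge>N. LINT x|M. norm (s i x - s j x) < e" if e: "e > 0" for e
  proof -
    obtain N where N: "(square_dist M (s i) (s j)) \<le> ennreal (e\<^sup>2/2)" if "i \<ge> N" "j \<ge> N" for i j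
      using cauchy[of "e\<^sup>2/2"] e by auto
    have "LINT x|M. norm (s i x - s j x) < e" if ij: "i \<ge> N" "j \<ge> N" for i j
    proof -
      let ?d = "\<lambda>x. s i x - s j x"
      have fin: "(\<integral>\<^sup>+ x. ennreal ((?d x)\<^sup>2) \<partial>M) < \<infinity>" using N[OF ij] le_less_trans ennreal_less_top by (metis infinity_ennreal_def)
      have d2: "integrable M (\<lambda>x. (?d x)\<^sup>2)" using fin by (intro integrableI_bounded) auto
      have E: "expectation (\<lambda>x. (?d x)\<^sup>2) \<le> e\<^sup>2/2"
        using N[OF ij] e by (intro integral_real_bounded) auto
      have "\<bar>y\<bar> \<le> e/2 + y\<^sup>2 / (2*e)" for y
        using sum_squares_bound[of "\<bar>y\<bar>" e] e by (simp add: field_simps power2_eq_square)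
      then have "LINT x|M. norm (?d x) \<le> LINT x|M. e/2 + (?d x)\<^sup>2 / (2*e)"
        using int d2 by (intro integral_mono) auto
      also have "\<dots> = e/2 + expectation (\<lambda>x. (?d x)\<^sup>2) / (2*e)"
        using d2 by (simp add: prob_space)
      also have "\<dots> \<le> e/2 + (e\<^sup>2/2) / (2*e)" using E e by (intro add_left_mono divide_right_mono) auto
      also have "\<dots> < e" using e by (simp add: power2_eq_square)
      finally show ?thesis .
    qed
    then show ?thesis by blast
  qed
  obtain r where r: "strict_mono r" "AE x in M. Cauchy (\<lambda>i. s (r i) x)"
    by (rule cauchy_L1_AE_cauchy_subseq[of M s]) (use int c1 in auto)
  define Z where "Z x = lim (\<lambda>i. s (r i) x)" for x
  have Zm[measurable]: "Z \<in> borel_measurable M" unfolding Z_def by (rule borel_measurable_lim_metric) simp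
  have lim: "AE x in M. (\<lambda>i. s (r i) x) \<longlonglongrightarrow> Z x"
    using r(2) by eventually_elim (simp add: Z_def convergent_LIMSEQ_iff[symmetric] Cauchy_convergent)
  have bound: "\<exists>N. \<forall>n\<ge>N. (square_dist M (s n) Z) \<le> ennreal e" if e: "e > 0" for e
  proof -
    obtain N where N: "(square_dist M (s i) (s j)) \<le> ennreal e" if "i \<ge> N" "j \<ge> N" for i j
      using cauchy[OF e] by auto
    have "(square_dist M (s n) Z) \<le> ennreal e" if n: "n \<ge> N" for n
    proof -
      have "(square_dist M (s n) Z) = (\<integral>\<^sup>+ x. liminf (\<lambda>i. ennreal ((s n x - s (r i) x)\<^sup>2)) \<partial>M)"
      proof (rule nn_integral_cong_AE, use lim in eventually_elim)
        case (elim x)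
        have "(\<lambda>i. ennreal ((s n x - s (r i) x)\<^sup>2)) \<longlonglongrightarrow> ennreal ((s n x - Z x)\<^sup>2)"
          by (intro tendsto_ennrealI tendsto_intros elim)
        then show ?case by (rule lim_imp_Liminf[OF trivial_limit_sequentially, symmetric])
      qed
      also have "\<dots> \<le> liminf (\<lambda>i. \<integral>\<^sup>+ x. ennreal ((s n x - s (r i) x)\<^sup>2) \<partial>M)"
        by (rule nn_integral_liminf) simp
      also have "\<dots> \<le> limsup (\<lambda>i. \<integral>\<^sup>+ x. ennreal ((s n x - s (r i) x)\<^sup>2) \<partial>M)"
        by (rule Liminf_le_Limsup) simp
      also have "\<dots> \<le> ennreal e"
      proof (rule Limsup_bounded, rule eventually_sequentiallyI[of N])
        fix i assume "N \<le> i"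
        then have "N \<le> r i" using seq_suble[OF r(1), of i] by simp
        then show "(square_dist M (s n) (s (r i))) \<le> ennreal e" by (rule N[OF n])
      qed
      finally show ?thesis .
    qed
    then show ?thesis by blast
  qed
  have "(\<lambda>n. \<integral>\<^sup>+ x. ennreal ((s n x - Z x)\<^sup>2) \<partial>M) \<longlonglongrightarrow> 0"
  proof (rule order_tendstoI)
    fix a :: ennreal assume "0 < a"
    then obtain b where b: "0 < b" "b < a" using dense by blast
    then obtain e where "b = ennreal e" "e \<ge> 0" by (cases b) auto
    with b have e: "e > 0" "ennreal e < a" by (auto simp: less_le)
    then show "\<forall>\<^sub>F n in sequentially. (square_dist M (s n) Z) < a"
      using bound[OF e(1)] unfolding eventually_sequentially by (meson le_less_trans)
  qed simp
  with Zm show ?thesis by (rule that)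
qed

context two_sided_brownian_motion
begin

lemma double_wiener_integral_exists:
  assumes f: "f \<in> borel_measurable borel" "\<And>x. 0 \<le> f x" "(\<integral>\<^sup>+ x. ennreal ((f x)\<^sup>2) \<partial>lborel) < \<infinity>"
  shows "\<exists>Z. has_double_wiener_integral M B f Z"
proof -
  have [measurable]: "f \<in> borel_measurable borel" by fact
  let ?D = "\<lambda>ps. \<integral>\<^sup>+ x. ennreal ((step_fun ps x - f x)\<^sup>2) \<partial>lborel"
  have "approx_step f" by (rule approx_step_nonneg[OF f])
  then have "\<forall>n. \<exists>ps. off_diagonal ps \<and> ?D ps \<le> ennreal (1 / real (Suc n))"
    unfolding approx_step_def by simp
  then obtain ps where ps: "\<And>n. off_diagonal (ps n)" "\<And>n. ?D (ps n) \<le> ennreal (1 / real (Suc n))"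
    by metis
  have lim: "(\<lambda>n. ?D (ps n)) \<longlonglongrightarrow> 0"
  proof (rule tendsto_sandwich[OF _ _ tendsto_const])
    have "(\<lambda>n. ennreal (1 / real (Suc n))) \<longlonglongrightarrow> ennreal 0"
      by (intro tendsto_ennrealI LIMSEQ_inverse_real_of_nat[unfolded inverse_eq_divide])
    then show "(\<lambda>n. ennreal (1 / real (Suc n))) \<longlonglongrightarrow> 0" by simp
  qed (use ps in auto)
  have dif: "(square_dist M (step_integral B (ps i)) (step_integral B (ps j))) \<le> 4 * ?D (ps i) + 4 * ?D (ps j)" for i j
  proof -
    have "(square_dist M (step_integral B (ps i)) (step_integral B (ps j))) \<le>
       2 * (square_dist lborel (step_fun (ps i)) (step_fun (ps j)))"
      by (rule step_integral_diff_second_moment[OF ps(1) ps(1)])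
    also have "\<dots> \<le> 2 * (2 * ?D (ps i) + 2 * (square_dist lborel f (step_fun (ps j))))"
      by (intro mult_left_mono nn_integral_square_triangle) auto
    also have "\<dots> = 4 * ?D (ps i) + 4 * ?D (ps j)"
      by (simp add: power2_commute distrib_left mult.assoc[symmetric])
    finally show ?thesis .
  qed
  obtain Z where Z: "Z \<in> borel_measurable M" "(\<lambda>n. \<integral>\<^sup>+ \<omega>. ennreal ((step_integral B (ps n) \<omega> - Z \<omega>)\<^sup>2) \<partial>M) \<longlonglongrightarrow> 0"
  proof (rule L2_complete[of "\<lambda>n. step_integral B (ps n)"])
    fix n
    have "(\<integral>\<^sup>+ x. ennreal ((step_fun (ps n) x)\<^sup>2) \<partial>lborel) \<le> 2 * ?D (ps n) + 2 * (\<integral>\<^sup>+ x. ennreal ((f x - 0)\<^sup>2) \<partial>lborel)"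
      using nn_integral_square_triangle[of "step_fun (ps n)" lborel f "\<lambda>_. 0"] by simp
    also have "\<dots> < \<infinity>"
    proof -
      have "?D (ps n) < \<infinity>" using ps(2)[of n] ennreal_less_top by (metis infinity_ennreal_def le_less_trans)
      then show ?thesis using f(3) by (simp add: ennreal_mult_less_top)
    qed
    finally have "2 * (\<integral>\<^sup>+ x. ennreal ((step_fun (ps n) x)\<^sup>2) \<partial>lborel) < \<infinity>" by (simp add: ennreal_mult_less_top)
    then show "(\<integral>\<^sup>+ \<omega>. ennreal ((step_integral B (ps n) \<omega>)\<^sup>2) \<partial>M) < \<infinity>"
      by (rule le_less_trans[OF step_integral_second_moment[OF ps(1)]])
  next
    fix e :: real assume e: "e > 0"
    have "\<forall>\<^sub>F n in sequentially. ?D (ps n) < ennreal (e/8)"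
      using e by (intro order_tendstoD(2)[OF lim]) simp
    then obtain N where N: "\<And>n. n \<ge> N \<Longrightarrow> ?D (ps n) < ennreal (e/8)" by (auto simp: eventually_sequentially)
    have "(square_dist M (step_integral B (ps i)) (step_integral B (ps j))) \<le> ennreal e" if "i \<ge> N" "j \<ge> N" for i j
    proof -
      have "4 * ?D (ps i) + 4 * ?D (ps j) \<le> 4 * ennreal (e/8) + 4 * ennreal (e/8)"
        using N that by (intro add_mono mult_left_mono less_imp_le) auto
      also have "\<dots> = ennreal e"
        using e by (simp add: ennreal_mult'[symmetric] ennreal_plus[symmetric] flip: ennreal_numeral del: ennreal_plus)
      finally show ?thesis using dif[of i j] by (rule order_trans[rotated])
    qed
    then show "\<exists>N. \<forall>i\<ge>N. \<forall>j\<ge>N. (square_dist M (step_integral B (ps i)) (step_integral B (ps j))) \<le> ennreal e"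
      by blast
  qed (use that in auto)
  have "has_double_wiener_integral M B f Z"
    unfolding has_double_wiener_integral_def using ps(1) lim Z by auto
  then show ?thesis by blast
qed

text \<open>Continuity of the integral, for an arbitrary version \<open>Z\<close>. The constant 8 collects the factor 2
  of the bound for step functions and two applications of \<open>(a + b)\<^sup>2 \<le> 2 a\<^sup>2 + 2 b\<^sup>2\<close>.\<close>

lemma double_wiener_integral_approx:
  assumes Z: "has_double_wiener_integral M B f Z" and qs: "off_diagonal qs"
  shows "(square_dist M Z (step_integral B qs))
    \<le> 8 * (square_dist lborel f (step_fun qs))"
proof -
  have [measurable]: "f \<in> borel_measurable borel" "Z \<in> borel_measurable M"
    using Z by (auto simp: has_double_wiener_integral_def)
  obtain ps where ps: "\<And>n. off_diagonal (ps n)"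
      "(\<lambda>n. \<integral>\<^sup>+ x. ennreal ((step_fun (ps n) x - f x)\<^sup>2) \<partial>lborel) \<longlonglongrightarrow> 0"
      "(\<lambda>n. \<integral>\<^sup>+ \<omega>. ennreal ((step_integral B (ps n) \<omega> - Z \<omega>)\<^sup>2) \<partial>M) \<longlonglongrightarrow> 0"
    using Z by (auto simp: has_double_wiener_integral_def)
  let ?u = "\<lambda>n. \<integral>\<^sup>+ x. ennreal ((step_fun (ps n) x - f x)\<^sup>2) \<partial>lborel"
  let ?v = "\<lambda>n. \<integral>\<^sup>+ \<omega>. ennreal ((step_integral B (ps n) \<omega> - Z \<omega>)\<^sup>2) \<partial>M"
  let ?w = "\<integral>\<^sup>+ x. ennreal ((f x - step_fun qs x)\<^sup>2) \<partial>lborel"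
  have "(square_dist M Z (step_integral B qs)) \<le> 2 * ?v n + 8 * ?u n + 8 * ?w" for n
  proof -
    have "(square_dist M Z (step_integral B qs))
       \<le> 2 * (square_dist M Z (step_integral B (ps n))) +
         2 * (square_dist M (step_integral B (ps n)) (step_integral B qs))"
      by (rule nn_integral_square_triangle) auto
    also have "\<dots> \<le> 2 * ?v n + 2 * (2 * (2 * ?u n + 2 * ?w))"
    proof (intro add_mono mult_left_mono)
      have "(square_dist M (step_integral B (ps n)) (step_integral B qs))
         \<le> 2 * (square_dist lborel (step_fun (ps n)) (step_fun qs))"
        by (rule step_integral_diff_second_moment[OF ps(1) qs])
      also have "\<dots> \<le> 2 * (2 * ?u n + 2 * ?w)"
        by (intro mult_left_mono nn_integral_square_triangle) auto
      finally show "(square_dist M (step_integral B (ps n)) (step_integral B qs)) \<le> 2 * (2 * ?u n + 2 * ?w)" .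
    qed (simp_all add: power2_commute)
    also have "\<dots> = 2 * ?v n + 8 * ?u n + 8 * ?w" by (simp add: distrib_left mult.assoc[symmetric] add.assoc)
    finally show ?thesis .
  qed
  moreover have "(\<lambda>n. 2 * ?v n + 8 * ?u n + 8 * ?w) \<longlonglongrightarrow> 2 * 0 + 8 * 0 + 8 * ?w"
    by (intro tendsto_add ennreal_tendsto_cmult ps tendsto_const) auto
  ultimately show ?thesis by (intro LIMSEQ_le_const[where X="\<lambda>n. 2 * ?v n + 8 * ?u n + 8 * ?w"]) auto
qed

end

section \<open>Orthonormal combinations of independent normal variables\<close>

text \<open>The uniqueness theorem for characteristic functions, applied to the law of \<open>X\<close> under the
  probability measure with density \<open>w / c\<close>.\<close>

lemma (in prob_space) weighted_law_std_normal:
  assumes X[measurable]: "random_variable borel X" and w[measurable]: "w \<in> borel_measurable M"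
    and w0: "\<And>\<omega>. 0 \<le> w \<omega>" and wb: "\<And>\<omega>. w \<omega> \<le> b" and c: "c > 0"
    and cf: "\<And>s. expectation (\<lambda>\<omega>. w \<omega> *\<^sub>R iexp (s * X \<omega>)) = of_real (c * exp (- s\<^sup>2 / 2))"
    and A[measurable]: "A \<in> sets borel"
  shows "expectation (\<lambda>\<omega>. w \<omega> * indicator A (X \<omega>)) = c * measure std_normal_distribution A"
proof -
  define M' where "M' = density M (\<lambda>\<omega>. ennreal (w \<omega> / c))"
  have wi: "integrable M w"
    by (rule integrable_const_bound[of _ b]) (use w0 wb in \<open>auto intro!: AE_I2 simp: abs_le_iff intro: order_trans\<close>)
  have "expectation (\<lambda>\<omega>. complex_of_real (w \<omega>)) = of_real c"
    using cf[of 0] by (simp add: scaleR_conv_of_real del: integral_complex_of_real)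
  then have "of_real (expectation w) = (of_real c :: complex)"
    by (simp only: integral_complex_of_real)
  then have Ew: "expectation w = c" by (simp only: of_real_eq_iff)
  have dens: "(\<integral>x. f x \<partial>M') = expectation (\<lambda>\<omega>. (w \<omega> / c) *\<^sub>R f \<omega>)" if "f \<in> borel_measurable M"
    for f :: "'a \<Rightarrow> 'b::{banach, second_countable_topology}"
    unfolding M'_def using that w0 c by (intro integral_density) auto
  have "emeasure M' (space M') = \<integral>\<^sup>+ \<omega>. ennreal (w \<omega> / c) \<partial>M"
    unfolding M'_def by (simp add: emeasure_density cong: nn_integral_cong_simp)
  also have "\<dots> = ennreal (expectation (\<lambda>\<omega>. w \<omega> / c))"
    using wi w0 c by (intro nn_integral_eq_integral) auto
  also have "\<dots> = 1" using Ew c by simp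
  finally have "prob_space M'" by (rule prob_spaceI)
  then interpret M': prob_space M' .
  have X'[measurable]: "X \<in> borel_measurable M'" using X by (simp add: M'_def)
  have "real_distribution (distr M' borel X)" by (rule M'.real_distribution_distr) simp
  moreover have "real_distribution std_normal_distribution" by (rule real_dist_normal_dist)
  moreover have "char (distr M' borel X) = char std_normal_distribution"
  proof
    fix s
    have "char (distr M' borel X) s = expectation (\<lambda>\<omega>. (w \<omega> / c) *\<^sub>R iexp (s * X \<omega>))"
      unfolding char_def by (subst integral_distr) (auto intro!: dens)
    also have "\<dots> = expectation (\<lambda>\<omega>. (1 / c) *\<^sub>R (w \<omega> *\<^sub>R iexp (s * X \<omega>)))" by simp
    also have "\<dots> = (1 / c) *\<^sub>R expectation (\<lambda>\<omega>. w \<omega> *\<^sub>R iexp (s * X \<omega>))" by (rule integral_scaleR_right)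
    also have "\<dots> = char std_normal_distribution s"
      unfolding cf char_std_normal_distribution using c by (simp add: scaleR_conv_of_real)
    finally show "char (distr M' borel X) s = char std_normal_distribution s" .
  qed
  ultimately have "distr M' borel X = std_normal_distribution" by (rule Levy_uniqueness)
  then have "measure std_normal_distribution A = measure (distr M' borel X) A" by simp
  also have "\<dots> = (\<integral>x. indicator A (X x) \<partial>M')"
  proof -
    have "(\<integral>x. indicator A x \<partial>distr M' borel X) = (\<integral>x. indicator A (X x) \<partial>M' :: real)"
      by (subst integral_distr) simp_all
    then show ?thesis by simp
  qed
  also have "\<dots> = expectation (\<lambda>\<omega>. (w \<omega> / c) *\<^sub>R indicator A (X \<omega>))" by (rule dens) simp
  also have "\<dots> = expectation (\<lambda>\<omega>. w \<omega> * indicator A (X \<omega>)) / c" by simp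
  finally show ?thesis using c by simp
qed

lemma (in prob_space) integrable_iexp_real:
  assumes [measurable]: "random_variable borel X"
  shows "integrable M (\<lambda>\<omega>. iexp (X \<omega>))"
  by (rule integrable_const_bound[of _ 1]) auto

text \<open>Uniqueness in two dimensions from uniqueness on the line. As the joint characteristic function
  factorizes, tilting the measure by the positive weight \<open>2 + cos (t V + \<theta>)\<close> leaves the law of
  \<open>U\<close> unchanged. This yields the expectation of \<open>exp (\<i> t V)\<close> on every event \<open>U \<in> A\<close>, and a
  second application, with the indicator of this event as weight, yields the law of \<open>V\<close> on it.\<close>

lemma (in prob_space) joint_law_std_normal:
  assumes U[measurable]: "random_variable borel U" and V[measurable]: "random_variable borel V"
    and cf: "\<And>s t. expectation (\<lambda>\<omega>. iexp (s * U \<omega> + t * V \<omega>)) = of_real (exp (- s\<^sup>2 / 2) * exp (- t\<^sup>2 / 2))"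
  shows "distr M (borel \<Otimes>\<^sub>M borel) (\<lambda>\<omega>. (U \<omega>, V \<omega>)) = std_normal_distribution \<Otimes>\<^sub>M std_normal_distribution"
proof -
  interpret S: real_distribution std_normal_distribution by (rule real_dist_normal_dist)
  let ?\<phi> = "\<lambda>s. exp (- s\<^sup>2 / 2) :: real"
  define F where "F s t \<omega> = iexp (s * U \<omega> + t * V \<omega>)" for s t \<omega>
  have Fi: "integrable M (F s t)" for s t unfolding F_def by (rule integrable_iexp_real) simp
  have FE: "expectation (F s t) = of_real (?\<phi> s * ?\<phi> t)" for s t unfolding F_def by (rule cf)
  have PA: "expectation (\<lambda>\<omega>. (2 + cos (t * V \<omega> + \<theta>)) * indicat_real A (U \<omega>)) = (2 + cos \<theta> * ?\<phi> t) * measure std_normal_distribution A"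
    if A[measurable]: "A \<in> sets borel" for A t \<theta>
  proof (rule weighted_law_std_normal[where b=3])
    fix \<omega> show "0 \<le> 2 + cos (t * V \<omega> + \<theta>)" "2 + cos (t * V \<omega> + \<theta>) \<le> 3"
      using cos_ge_minus_one[of "t * V \<omega> + \<theta>"] cos_le_one[of "t * V \<omega> + \<theta>"] by linarith+
  next
    have "\<bar>cos \<theta> * ?\<phi> t\<bar> \<le> 1 * 1" unfolding abs_mult
      by (intro mult_mono) (auto simp: abs_cos_le_one)
    then show "0 < 2 + cos \<theta> * ?\<phi> t" by linarith
  next
    fix s
    have h: "complex_of_real (2 + cos y) = 2 + (cis y + cis (- y)) / 2" for y
      by (simp add: complex_eq_iff)
    have "(2 + cos (t * V \<omega> + \<theta>)) *\<^sub>R iexp (s * U \<omega>) =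
        2 * F s 0 \<omega> + (cis \<theta> / 2 * F s t \<omega> + cis (- \<theta>) / 2 * F s (- t) \<omega>)" for \<omega>
      unfolding F_def scaleR_conv_of_real h cis_conv_exp[symmetric]
      by (simp add: cis_mult algebra_simps add_divide_distrib)
    then have "expectation (\<lambda>\<omega>. (2 + cos (t * V \<omega> + \<theta>)) *\<^sub>R iexp (s * U \<omega>)) =
       2 * of_real (?\<phi> s * ?\<phi> 0) + (cis \<theta> / 2 * of_real (?\<phi> s * ?\<phi> t) + cis (- \<theta>) / 2 * of_real (?\<phi> s * ?\<phi> (- t)))"
      by (simp only: FE[symmetric]) (simp add: Fi)
    also have "\<dots> = of_real ((2 + cos \<theta> * ?\<phi> t) * ?\<phi> s)"
      by (simp add: complex_eq_iff algebra_simps)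
    finally show "expectation (\<lambda>\<omega>. (2 + cos (t * V \<omega> + \<theta>)) *\<^sub>R iexp (s * U \<omega>)) = of_real ((2 + cos \<theta> * ?\<phi> t) * ?\<phi> s)" .
  qed (use that in simp_all)
  have PU: "expectation (\<lambda>\<omega>. indicat_real A (U \<omega>)) = measure std_normal_distribution A"
    if A[measurable]: "A \<in> sets borel" for A
    using PA[OF A, of 0 0] by simp
  have cosA: "expectation (\<lambda>\<omega>. cos (t * V \<omega> + \<theta>) * indicat_real A (U \<omega>)) = cos \<theta> * ?\<phi> t * measure std_normal_distribution A"
    if A[measurable]: "A \<in> sets borel" for A t \<theta>
  proof -
    have i: "integrable M (\<lambda>\<omega>. cos (t * V \<omega> + \<theta>) * indicat_real A (U \<omega>))"
      by (rule integrable_const_bound[of _ 1]) (auto simp: indicator_def abs_cos_le_one)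
    have i2: "integrable M (\<lambda>\<omega>. indicat_real A (U \<omega>))"
      by (rule integrable_const_bound[of _ 1]) (auto simp: indicator_def)
    show ?thesis using PA[OF A, of t \<theta>] i i2 PU[OF A] by (simp add: distrib_right)
  qed
  have joint: "prob {\<omega> \<in> space M. U \<omega> \<in> A \<and> V \<omega> \<in> B'} = measure std_normal_distribution A * measure std_normal_distribution B'"
    if A[measurable]: "A \<in> sets borel" and B[measurable]: "B' \<in> sets borel" for A B'
  proof -
    have e: "prob {\<omega> \<in> space M. U \<omega> \<in> A \<and> V \<omega> \<in> B'} = expectation (\<lambda>\<omega>. indicat_real A (U \<omega>) * indicat_real B' (V \<omega>))"
    proof -
      have "prob {\<omega> \<in> space M. U \<omega> \<in> A \<and> V \<omega> \<in> B'} = expectation (indicator {\<omega> \<in> space M. U \<omega> \<in> A \<and> V \<omega> \<in> B'})"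
        by (subst Bochner_Integration.integral_indicator) (rule arg_cong[where f=prob], auto)
      also have "\<dots> = expectation (\<lambda>\<omega>. indicat_real A (U \<omega>) * indicat_real B' (V \<omega>))"
        by (rule Bochner_Integration.integral_cong) (auto simp: indicator_def)
      finally show ?thesis .
    qed
    show ?thesis
    proof (cases "measure std_normal_distribution A = 0")
      case True
      have "expectation (\<lambda>\<omega>. indicat_real A (U \<omega>) * indicat_real B' (V \<omega>)) \<le> expectation (\<lambda>\<omega>. indicat_real A (U \<omega>))"
        by (intro integral_mono integrable_const_bound[of _ 1]) (auto simp: indicator_def)
      then have "expectation (\<lambda>\<omega>. indicat_real A (U \<omega>) * indicat_real B' (V \<omega>)) \<le> 0" using PU[OF A] True by simp
      moreover have "expectation (\<lambda>\<omega>. indicat_real A (U \<omega>) * indicat_real B' (V \<omega>)) \<ge> 0"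
        by (intro integral_nonneg_AE) auto
      ultimately show ?thesis using e True by simp
    next
      case False
      have "expectation (\<lambda>\<omega>. indicat_real A (U \<omega>) * indicat_real B' (V \<omega>)) = measure std_normal_distribution A * measure std_normal_distribution B'"
      proof (rule weighted_law_std_normal[where b=1])
        show "measure std_normal_distribution A > 0" using False measure_nonneg[of std_normal_distribution A] by linarith
        fix t
        have i: "integrable M (\<lambda>\<omega>. cos (t * V \<omega> + \<theta>) * indicat_real A (U \<omega>))" for \<theta>
          by (rule integrable_const_bound[of _ 1]) (auto simp: indicator_def abs_cos_le_one)
        \<comment> \<open>the phases 0 and \<open>- pi / 2\<close> give the real and the imaginary part\<close>
        have sh: "cos (x + (- pi / 2)) = sin x" for x :: real
          by (simp add: cos_diff)
        have "indicat_real A (U \<omega>) *\<^sub>R iexp (t * V \<omega>) = of_real (cos (t * V \<omega> + 0) * indicat_real A (U \<omega>)) +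
           \<i> * of_real (cos (t * V \<omega> + (- pi / 2)) * indicat_real A (U \<omega>))" for \<omega>
          unfolding sh by (auto simp: indicator_def complex_eq_iff Re_exp Im_exp)
        then have "expectation (\<lambda>\<omega>. indicat_real A (U \<omega>) *\<^sub>R iexp (t * V \<omega>)) =
           of_real (expectation (\<lambda>\<omega>. cos (t * V \<omega> + 0) * indicat_real A (U \<omega>))) +
           \<i> * of_real (expectation (\<lambda>\<omega>. cos (t * V \<omega> + (- pi / 2)) * indicat_real A (U \<omega>)))"
          using i[of 0] i[of "- pi / 2"]
          by (simp del: of_real_mult add: integral_complex_of_real)
        also have "\<dots> = of_real (measure std_normal_distribution A * ?\<phi> t)"
          unfolding cosA[OF A] by simp
        finally show "expectation (\<lambda>\<omega>. indicat_real A (U \<omega>) *\<^sub>R iexp (t * V \<omega>)) = of_real (measure std_normal_distribution A * ?\<phi> t)" .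
      qed (auto simp: indicator_def)
      with e show ?thesis by simp
    qed
  qed
  have "std_normal_distribution \<Otimes>\<^sub>M std_normal_distribution = distr M (borel \<Otimes>\<^sub>M borel) (\<lambda>\<omega>. (U \<omega>, V \<omega>))"
  proof (rule pair_measure_eqI)
    show "sigma_finite_measure std_normal_distribution" by unfold_locales
    then show "sigma_finite_measure std_normal_distribution" .
    show "sets (std_normal_distribution \<Otimes>\<^sub>M std_normal_distribution) = sets (distr M (borel \<Otimes>\<^sub>M borel) (\<lambda>\<omega>. (U \<omega>, V \<omega>)))"
      by (simp cong: sets_pair_measure_cong)
    fix A B' assume "A \<in> sets std_normal_distribution" "B' \<in> sets std_normal_distribution"
    then have [measurable]: "A \<in> sets borel" "B' \<in> sets borel" by auto
    have "emeasure (distr M (borel \<Otimes>\<^sub>M borel) (\<lambda>\<omega>. (U \<omega>, V \<omega>))) (A \<times> B') = emeasure M {\<omega> \<in> space M. U \<omega> \<in> A \<and> V \<omega> \<in> B'}"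
      by (subst emeasure_distr) (auto intro!: arg_cong[where f="emeasure M"])
    also have "\<dots> = ennreal (measure std_normal_distribution A * measure std_normal_distribution B')"
      by (simp add: emeasure_eq_measure joint)
    finally show "emeasure std_normal_distribution A * emeasure std_normal_distribution B' = emeasure (distr M (borel \<Otimes>\<^sub>M borel) (\<lambda>\<omega>. (U \<omega>, V \<omega>))) (A \<times> B')"
      by (simp add: S.emeasure_eq_measure ennreal_mult)
  qed
  then show ?thesis ..
qed

lemma (in prob_space) char_linear_combination:
  fixes n :: nat
  assumes ind: "indep_vars (\<lambda>_. borel) X {..<n}"
    and D: "\<And>i. i < n \<Longrightarrow> distributed M lborel (X i) std_normal_density"
  shows "expectation (\<lambda>\<omega>. iexp (\<Sum>i<n. c i * X i \<omega>)) = of_real (exp (- (\<Sum>i<n. (c i)\<^sup>2) / 2))"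
proof -
  have [measurable]: "random_variable borel (X i)" if "i < n" for i
    using D[OF that] by (simp add: distributed_def)
  have one: "expectation (\<lambda>\<omega>. iexp (c * X i \<omega>)) = of_real (exp (- c\<^sup>2 / 2))" if i: "i < n" for c i
  proof -
    have "distr M lborel (X i) = std_normal_distribution" using D[OF i] by (simp add: distributed_def)
    then have "char (distr M lborel (X i)) c = of_real (exp (- c\<^sup>2 / 2))" by (simp add: char_std_normal_distribution)
    then show ?thesis unfolding char_def using i by (subst (asm) integral_distr) auto
  qed
  have "expectation (\<lambda>\<omega>. iexp (\<Sum>i<n. c i * X i \<omega>)) = expectation (\<lambda>\<omega>. \<Prod>i<n. iexp (c i * X i \<omega>))"
  proof (intro Bochner_Integration.integral_cong refl)
    fix \<omega>
    have "\<i> * complex_of_real (\<Sum>i<n. c i * X i \<omega>) = (\<Sum>i<n. \<i> * complex_of_real (c i * X i \<omega>))"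
      unfolding of_real_sum sum_distrib_left ..
    then show "iexp (\<Sum>i<n. c i * X i \<omega>) = (\<Prod>i<n. iexp (c i * X i \<omega>))"
      by (simp only: exp_sum finite_lessThan)
  qed
  also have "\<dots> = (\<Prod>i<n. expectation (\<lambda>\<omega>. iexp (c i * X i \<omega>)))"
  proof (rule indep_vars_lebesgue_integral)
    show "indep_vars (\<lambda>_. borel) (\<lambda>i \<omega>. iexp (c i * X i \<omega>)) {..<n}"
      by (rule indep_vars_compose2[OF ind]) simp
  qed (simp, rule integrable_iexp_real, simp)
  also have "\<dots> = (\<Prod>i<n. of_real (exp (- (c i)\<^sup>2 / 2)))" by (intro prod.cong refl one) simp
  also have "\<dots> = of_real (exp (\<Sum>i<n. - (c i)\<^sup>2 / 2))"
    unfolding of_real_prod[symmetric] by (subst exp_sum) simp_all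
  also have "(\<Sum>i<n. - (c i)\<^sup>2 / 2) = - (\<Sum>i<n. (c i)\<^sup>2) / 2" by (simp add: sum_negf sum_divide_distrib)
  finally show ?thesis .
qed

lemma (in prob_space) orthonormal_combinations_law:
  fixes n :: nat
  assumes ind: "indep_vars (\<lambda>_. borel) X {..<n}"
    and D: "\<And>i. i < n \<Longrightarrow> distributed M lborel (X i) std_normal_density"
    and on: "(\<Sum>i<n. (u i)\<^sup>2) = 1" "(\<Sum>i<n. (v i)\<^sup>2) = 1" "(\<Sum>i<n. u i * v i) = 0"
  shows "distr M (borel \<Otimes>\<^sub>M borel) (\<lambda>\<omega>. (\<Sum>i<n. u i * X i \<omega>, \<Sum>i<n. v i * X i \<omega>)) =
    std_normal_distribution \<Otimes>\<^sub>M std_normal_distribution"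
proof (rule joint_law_std_normal)
  have [measurable]: "random_variable borel (X i)" if "i < n" for i
    using D[OF that] by (simp add: distributed_def)
  show "random_variable borel (\<lambda>\<omega>. \<Sum>i<n. u i * X i \<omega>)" "random_variable borel (\<lambda>\<omega>. \<Sum>i<n. v i * X i \<omega>)"
    by (auto intro!: borel_measurable_sum borel_measurable_times)
  fix s t
  have "(\<Sum>i<n. (s * u i + t * v i)\<^sup>2) = s\<^sup>2 * (\<Sum>i<n. (u i)\<^sup>2) + t\<^sup>2 * (\<Sum>i<n. (v i)\<^sup>2) + 2 * s * t * (\<Sum>i<n. u i * v i)"
    by (simp add: sum_distrib_left sum.distrib[symmetric] power2_eq_square algebra_simps)
  then have q: "(\<Sum>i<n. (s * u i + t * v i)\<^sup>2) = s\<^sup>2 + t\<^sup>2" by (simp add: on)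
  have ex: "exp (- s\<^sup>2 / 2) * exp (- t\<^sup>2 / 2) = exp (- (s\<^sup>2 + t\<^sup>2) / 2)"
    by (simp add: exp_add[symmetric] diff_divide_distrib)
  have l: "s * (\<Sum>i<n. u i * X i \<omega>) + t * (\<Sum>i<n. v i * X i \<omega>) = (\<Sum>i<n. (s * u i + t * v i) * X i \<omega>)" for \<omega>
    by (simp add: sum_distrib_left sum.distrib distrib_right mult.assoc)
  show "expectation (\<lambda>\<omega>. iexp (s * (\<Sum>i<n. u i * X i \<omega>) + t * (\<Sum>i<n. v i * X i \<omega>))) = of_real (exp (- s\<^sup>2 / 2) * exp (- t\<^sup>2 / 2))"
    unfolding l ex q[symmetric] by (rule char_linear_combination[OF ind D])
qed

section \<open>Power sums and first-order asymptotics\<close>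

lemma powr_decrement_bounds:
  fixes x y p :: real
  assumes "0 < x" "x < y" "p < 0"
  shows "- p * (y - x) * y powr (p - 1) \<le> x powr p - y powr p"
    and "x powr p - y powr p \<le> - p * (y - x) * x powr (p - 1)"
proof -
  have "\<exists>z>x. z < y \<and> y powr p - x powr p = (y - x) * (p * z powr (p - 1))"
    using assms by (intro MVT2) (auto intro!: has_real_derivative_powr)
  then obtain z where z: "x < z" "z < y" "y powr p - x powr p = (y - x) * (p * z powr (p - 1))" by blast
  then have e: "x powr p - y powr p = (- p * (y - x)) * z powr (p - 1)" by (simp add: algebra_simps)
  have nn: "0 \<le> - p * (y - x)" using assms by (intro mult_nonneg_nonneg) auto
  have "y powr (p - 1) \<le> z powr (p - 1)" using z assms by (intro powr_mono2') auto
  from mult_left_mono[OF this nn] show "- p * (y - x) * y powr (p - 1) \<le> x powr p - y powr p" unfolding e .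
  have "z powr (p - 1) \<le> x powr (p - 1)" using z assms by (intro powr_mono2') auto
  from mult_left_mono[OF this nn] show "x powr p - y powr p \<le> - p * (y - x) * x powr (p - 1)" unfolding e .
qed

text \<open>By the mean value theorem, \<open>\<delta>\<close> times the summands interlace with the differences of the
  telescoping sequence \<open>k powr (- \<delta>)\<close>. The sum is the zeta function at \<open>1 + \<delta>\<close>, with its simple
  pole at 1.\<close>

lemma power_sum_bounds:
  fixes \<delta> :: real
  assumes d: "\<delta> > 0"
  shows "summable (\<lambda>k. real (Suc k) powr (- 1 - \<delta>))"
    and "1 \<le> \<delta> * (\<Sum>k. real (Suc k) powr (- 1 - \<delta>))"
    and "\<delta> * (\<Sum>k. real (Suc k) powr (- 1 - \<delta>)) \<le> 1 + \<delta>"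
proof -
  define g where "g k = real (Suc k) powr (- \<delta>)" for k
  define a where "a k = real (Suc k) powr (- 1 - \<delta>)" for k
  have lo: "\<delta> * a (Suc k) \<le> g k - g (Suc k)" and hi: "g k - g (Suc k) \<le> \<delta> * a k" for k
    using powr_decrement_bounds[of "real (Suc k)" "real (Suc (Suc k))" "- \<delta>"] d
    by (simp_all add: g_def a_def minus_diff_commute)
  have "((\<lambda>x::real. x powr (- \<delta>)) \<longlongrightarrow> 0) at_top" using d by (intro tendsto_neg_powr filterlim_ident) auto
  then have "(\<lambda>n. real n powr (- \<delta>)) \<longlonglongrightarrow> 0"
    by (rule filterlim_compose[OF _ filterlim_real_sequentially])
  then have g0: "g \<longlonglongrightarrow> 0" unfolding g_def by (rule LIMSEQ_Suc)
  have D: "(\<lambda>k. g k - g (Suc k)) sums 1"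
    using telescope_sums'[OF g0] by (simp add: g_def)
  have "summable (\<lambda>k. \<delta> * a (Suc k))"
    by (rule summable_comparison_test'[OF sums_summable[OF D], of 0]) (use lo d in \<open>auto simp: a_def\<close>)
  then have sS: "summable (\<lambda>k. a (Suc k))" using d by (simp add: summable_mult_D)
  then have s: "summable a" by (simp add: summable_Suc_iff)
  have "1 = (\<Sum>k. g k - g (Suc k))" using D by (simp add: sums_iff)
  also have "\<dots> \<le> (\<Sum>k. \<delta> * a k)" by (intro suminf_le hi sums_summable[OF D] summable_mult s)
  also have "\<dots> = \<delta> * suminf a" by (rule suminf_mult[OF s])
  finally have 1: "1 \<le> \<delta> * suminf a" .
  have "\<delta> * suminf a = \<delta> * (a 0 + (\<Sum>k. a (Suc k)))" using suminf_split_head[OF s] by simp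
  also have "\<dots> = \<delta> + (\<Sum>k. \<delta> * a (Suc k))" 
    by (simp only: distrib_left suminf_mult[OF sS]) (simp add: a_def)
  also have "(\<Sum>k. \<delta> * a (Suc k)) \<le> (\<Sum>k. g k - g (Suc k))"
    by (intro suminf_le lo sums_summable[OF D] summable_mult sS)
  also have "\<dots> = 1" using D by (simp add: sums_iff)
  finally have 2: "\<delta> * suminf a \<le> 1 + \<delta>" by simp
  show "summable (\<lambda>k. real (Suc k) powr (- 1 - \<delta>))"
    "1 \<le> \<delta> * (\<Sum>k. real (Suc k) powr (- 1 - \<delta>))"
    "\<delta> * (\<Sum>k. real (Suc k) powr (- 1 - \<delta>)) \<le> 1 + \<delta>"
    using s 1 2 by (simp_all add: a_def[abs_def])
qed

text \<open>\<open>f x = l + O(x)\<close> as \<open>x\<close> tends to 0 from the right.\<close>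

definition lin_approx :: "(real \<Rightarrow> real) \<Rightarrow> real \<Rightarrow> bool" where
  "lin_approx f l \<longleftrightarrow> (\<exists>C\<ge>0. \<forall>\<^sub>F x in at_right 0. \<bar>f x - l\<bar> \<le> C * x)"

lemma lin_approxI:
  assumes "\<forall>\<^sub>F x in at_right 0. \<bar>f x - l\<bar> \<le> C * x"
  shows "lin_approx f l"
  unfolding lin_approx_def
proof (intro exI conjI)
  show "\<forall>\<^sub>F x in at_right 0. \<bar>f x - l\<bar> \<le> \<bar>C\<bar> * x"
    using assms eventually_at_right_less[of 0]
  proof eventually_elim
    case (elim x)
    have "C * x \<le> \<bar>C\<bar> * x" using elim(2) by (intro mult_right_mono) auto
    with elim(1) show ?case by linarith
  qed
qed simp

lemma lin_approx_cong:
  assumes "lin_approx f l" "\<forall>\<^sub>F x in at_right 0. f x = g x"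
  shows "lin_approx g l"
proof -
  obtain C where "\<forall>\<^sub>F x in at_right 0. \<bar>f x - l\<bar> \<le> C * x" using assms(1) by (auto simp: lin_approx_def)
  then have "\<forall>\<^sub>F x in at_right 0. \<bar>g x - l\<bar> \<le> C * x" using assms(2) by eventually_elim simp
  then show ?thesis by (rule lin_approxI)
qed

lemma lin_approx_tendsto:
  assumes "lin_approx f l"
  shows "(f \<longlongrightarrow> l) (at_right 0)"
proof -
  obtain C where C: "\<forall>\<^sub>F x in at_right 0. \<bar>f x - l\<bar> \<le> C * x" using assms by (auto simp: lin_approx_def)
  have "((\<lambda>x. f x - l) \<longlongrightarrow> 0) (at_right 0)"
  proof (rule Lim_null_comparison)
    show "\<forall>\<^sub>F x in at_right 0. norm (f x - l) \<le> C * x" using C by simp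
    have "((\<lambda>x. C * x) \<longlongrightarrow> C * 0) (at_right 0)" by (intro tendsto_intros)
    then show "((\<lambda>x. C * x) \<longlongrightarrow> 0) (at_right 0)" by simp
  qed
  then show ?thesis by (simp add: LIM_zero_iff)
qed

lemma lin_approx_const: "lin_approx (\<lambda>_. c) c"
  by (rule lin_approxI[of _ _ 0]) simp

lemma lin_approx_diff:
  assumes "lin_approx f l" "lin_approx g m"
  shows "lin_approx (\<lambda>x. f x - g x) (l - m)"
proof -
  obtain C D where "\<forall>\<^sub>F x in at_right 0. \<bar>f x - l\<bar> \<le> C * x" "\<forall>\<^sub>F x in at_right 0. \<bar>g x - m\<bar> \<le> D * x"
    using assms by (auto simp: lin_approx_def)
  then have "\<forall>\<^sub>F x in at_right 0. \<bar>(f x - g x) - (l - m)\<bar> \<le> (C + D) * x"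
    by eventually_elim (simp add: distrib_right)
  then show ?thesis by (rule lin_approxI)
qed

lemma lin_approx_mult:
  assumes "lin_approx f l" "lin_approx g m"
  shows "lin_approx (\<lambda>x. f x * g x) (l * m)"
proof -
  obtain C D where C: "C \<ge> 0" "\<forall>\<^sub>F x in at_right 0. \<bar>f x - l\<bar> \<le> C * x"
    and D: "D \<ge> 0" "\<forall>\<^sub>F x in at_right 0. \<bar>g x - m\<bar> \<le> D * x"
    using assms by (auto simp: lin_approx_def)
  have "\<forall>\<^sub>F x in at_right 0. \<bar>g x - m\<bar> < 1"
    using tendstoD[OF lin_approx_tendsto[OF assms(2)], of 1] by (simp add: dist_real_def)
  then have "\<forall>\<^sub>F x in at_right 0. \<bar>f x * g x - l * m\<bar> \<le> (C * (\<bar>m\<bar> + 1) + \<bar>l\<bar> * D) * x"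
    using C(2) D(2)
  proof eventually_elim
    case (elim x)
    have "f x * g x - l * m = (f x - l) * g x + l * (g x - m)" by (simp add: algebra_simps)
    then have "\<bar>f x * g x - l * m\<bar> \<le> \<bar>f x - l\<bar> * \<bar>g x\<bar> + \<bar>l\<bar> * \<bar>g x - m\<bar>"
      by (metis abs_mult abs_triangle_ineq)
    also have "\<dots> \<le> (C * x) * (\<bar>m\<bar> + 1) + \<bar>l\<bar> * (D * x)"
      using elim by (intro add_mono mult_mono mult_left_mono) auto
    finally show ?case by (simp add: algebra_simps)
  qed
  then show ?thesis by (rule lin_approxI)
qed

lemma lin_approx_sqrt:
  assumes f: "lin_approx f l" and l: "l > 0"
  shows "lin_approx (\<lambda>x. sqrt (f x)) (sqrt l)"
proof -
  obtain C where C: "\<forall>\<^sub>F x in at_right 0. \<bar>f x - l\<bar> \<le> C * x" using f by (auto simp: lin_approx_def)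
  have "\<forall>\<^sub>F x in at_right 0. 0 < f x" by (rule order_tendstoD(1)[OF lin_approx_tendsto[OF f] l])
  with C have "\<forall>\<^sub>F x in at_right 0. \<bar>sqrt (f x) - sqrt l\<bar> \<le> (C / sqrt l) * x"
  proof eventually_elim
    case (elim x)
    have "(sqrt (f x) - sqrt l) * (sqrt (f x) + sqrt l) = f x - l"
      using elim l by (simp add: algebra_simps)
    then have "\<bar>sqrt (f x) - sqrt l\<bar> * (sqrt (f x) + sqrt l) = \<bar>f x - l\<bar>"
      using elim l by (metis abs_mult abs_of_nonneg add_nonneg_nonneg less_imp_le real_sqrt_ge_zero)
    moreover have "\<bar>sqrt (f x) - sqrt l\<bar> * sqrt l \<le> \<bar>sqrt (f x) - sqrt l\<bar> * (sqrt (f x) + sqrt l)"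
      using elim by (intro mult_left_mono) auto
    ultimately have "\<bar>sqrt (f x) - sqrt l\<bar> * sqrt l \<le> C * x" using elim by linarith
    then show ?case using l by (simp add: field_simps)
  qed
  then show ?thesis by (rule lin_approxI)
qed

lemma lin_approx_inverse:
  assumes f: "lin_approx f l" and l: "l > 0"
  shows "lin_approx (\<lambda>x. 1 / f x) (1 / l)"
proof -
  obtain C where C: "\<forall>\<^sub>F x in at_right 0. \<bar>f x - l\<bar> \<le> C * x" using f by (auto simp: lin_approx_def)
  have "\<forall>\<^sub>F x in at_right 0. l / 2 < f x" using l by (intro order_tendstoD(1)[OF lin_approx_tendsto[OF f]]) simp
  with C have "\<forall>\<^sub>F x in at_right 0. \<bar>1 / f x - 1 / l\<bar> \<le> (C * (2 / l\<^sup>2)) * x"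
  proof eventually_elim
    case (elim x)
    have fp: "f x > 0" using elim l by linarith
    have "\<bar>1 / f x - 1 / l\<bar> = \<bar>f x - l\<bar> * (1 / (f x * l))"
      using fp l by (simp add: field_simps abs_if)
    also have "\<dots> \<le> (C * x) * (2 / l\<^sup>2)"
    proof (rule mult_mono)
      show "1 / (f x * l) \<le> 2 / l\<^sup>2" using elim fp l by (simp add: field_simps power2_eq_square)
      show "0 \<le> C * x" using elim(1) abs_ge_zero order_trans by blast
    qed (use elim fp l in auto)
    finally show ?case by (simp add: mult_ac)
  qed
  then show ?thesis by (rule lin_approxI)
qed

lemma lin_approx_deriv:
  assumes "(f has_real_derivative D) (at 0)"
  shows "lin_approx f (f 0)"
proof -
  have "((\<lambda>x. (f x - f 0) / x) \<longlongrightarrow> D) (at 0)" using assms by (simp add: has_field_derivative_iff)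
  then have "((\<lambda>x. (f x - f 0) / x) \<longlongrightarrow> D) (at_right 0)" by (rule tendsto_within_subset) simp
  then have "\<forall>\<^sub>F x in at_right 0. dist ((f x - f 0) / x) D < 1" by (rule tendstoD) simp
  then have "\<forall>\<^sub>F x in at_right 0. \<bar>f x - f 0\<bar> \<le> (\<bar>D\<bar> + 1) * x"
    using eventually_at_right_less[of 0]
  proof eventually_elim
    case (elim x)
    then have "\<bar>(f x - f 0) / x\<bar> \<le> \<bar>D\<bar> + 1" by (simp add: dist_real_def)
    then show ?case using elim by (simp add: abs_divide field_simps)
  qed
  then show ?thesis by (rule lin_approxI)
qed

lemma lin_approx_add:
  assumes "lin_approx f l" "lin_approx g m"
  shows "lin_approx (\<lambda>x. f x + g x) (l + m)"
  using lin_approx_diff[OF assms(1) lin_approx_diff[OF lin_approx_const[of 0] assms(2)]] by simp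

text \<open>The pole of \<open>Gamma (m x)\<close> at \<open>x = 0\<close> is cancelled by the factor \<open>x\<close>: the function
  \<open>Gamma (1/2 - a x) Gamma (1 + m x) / (m Gamma (1/2 - a x + m x))\<close> is a differentiable
  continuation through 0.\<close>

lemma lin_approx_Beta:
  fixes a m :: real
  assumes m: "m > 0"
  shows "lin_approx (\<lambda>x. x * Beta (1/2 - a * x) (m * x)) (1 / m)"
proof -
  define h where "h x = Gamma (1/2 - a * x) * Gamma (1 + m * x) / (m * Gamma (1/2 - a * x + m * x))" for x
  have np: "(1/2::real) \<notin> \<int>\<^sub>\<le>\<^sub>0" "(1::real) \<notin> \<int>\<^sub>\<le>\<^sub>0"
    by (auto dest: nonpos_Ints_nonpos)
  have "Gamma (1/2::real) > 0" by (rule Gamma_real_pos) simp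
  then have Gn: "Gamma (1/2::real) \<noteq> 0" by linarith
  have arg: "1/2 - a * 0 + m * 0 = (1/2 :: real)" by simp
  have nz: "m * Gamma (1/2 - a * 0 + m * 0) \<noteq> 0"
    unfolding arg using Gn m by (metis less_irrefl mult_eq_0_iff)
  have "\<exists>D. (h has_real_derivative D) (at 0)"
    unfolding h_def[abs_def]
    by (intro exI) (rule derivative_eq_intros refl nz | use np m in \<open>simp; fail\<close>)+
  then obtain D where "(h has_real_derivative D) (at 0)" by blast
  then have "lin_approx h (h 0)" by (rule lin_approx_deriv)
  moreover have "h 0 = 1 / m"
    unfolding h_def arg using Gn by (simp del: Gamma_eq_zero_iff)
  moreover have "\<forall>\<^sub>F x in at_right 0. h x = x * Beta (1/2 - a * x) (m * x)"
    using eventually_at_right_less[of 0]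
  proof eventually_elim
    case (elim x)
    have "m * x \<notin> \<int>\<^sub>\<le>\<^sub>0" using elim m by (auto dest!: nonpos_Ints_nonpos simp: mult_le_0_iff)
    then have "Gamma (1 + m * x) = m * x * Gamma (m * x)" by (subst add.commute) (rule Gamma_plus1)
    then show ?case using elim m by (simp add: h_def Beta_def)
  qed
  ultimately show ?thesis by (metis lin_approx_cong)
qed

section \<open>The normalizing constant and the limiting quadratic form\<close>

text \<open>The limiting correlation \<open>r\<close> of the two Gaussian sums. The form
  \<open>p (N\<^sup>2 - 1) + q N N'\<close> with the coefficients below is the normalized centred product of the
  standard normal variables \<open>N\<close> and \<open>r N + sqrt (1 - r\<^sup>2) N'\<close> with correlation \<open>r\<close>; note that
  \<open>sqrt (1 - r\<^sup>2) = (1 - \<rho>) / (1 + \<rho>)\<close>.\<close>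

definition corr :: "real \<Rightarrow> real" where
  "corr \<rho> = 2 * sqrt \<rho> / (1 + \<rho>)"

definition p_coeff :: "real \<Rightarrow> real" where
  "p_coeff \<rho> = corr \<rho> / sqrt (1 + (corr \<rho>)\<^sup>2)"

definition q_coeff :: "real \<Rightarrow> real" where
  "q_coeff \<rho> = (1 - \<rho>) / (1 + \<rho>) / sqrt (1 + (corr \<rho>)\<^sup>2)"

lemma corr_bounds:
  assumes "0 < \<rho>" "\<rho> < 1"
  shows "0 < corr \<rho>" "corr \<rho> < 1" "((1 - \<rho>) / (1 + \<rho>))\<^sup>2 = 1 - (corr \<rho>)\<^sup>2"
proof -
  show "0 < corr \<rho>" using assms by (simp add: corr_def)
  have sq: "(corr \<rho>)\<^sup>2 = 4 * \<rho> / (1 + \<rho>)\<^sup>2" using assms by (simp add: corr_def power_divide power_mult_distrib)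
  have "(1 + \<rho>)\<^sup>2 > 0" using assms by simp
  then show e: "((1 - \<rho>) / (1 + \<rho>))\<^sup>2 = 1 - (corr \<rho>)\<^sup>2"
    unfolding sq by (simp add: power_divide field_simps) (simp add: power2_eq_square algebra_simps)
  have "((1 - \<rho>) / (1 + \<rho>))\<^sup>2 > 0" using assms by simp
  then have "(corr \<rho>)\<^sup>2 < 1\<^sup>2" using e by simp
  then show "corr \<rho> < 1" by (rule power2_less_imp_less) simp
qed

lemma limit_coeffs:
  assumes "0 < \<rho>" "\<rho> < 1"
  shows "a_coeff \<rho> / sqrt 2 = (1 + corr \<rho>) / (2 * sqrt (1 + (corr \<rho>)\<^sup>2))"
    and "b_coeff \<rho> / sqrt 2 = (corr \<rho> - 1) / (2 * sqrt (1 + (corr \<rho>)\<^sup>2))"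
proof -
  define t where "t = 2 * sqrt \<rho>"
  define r where "r = corr \<rho>"
  define S where "S = sqrt (1 + r\<^sup>2)"
  have t: "t > 0" "t\<^sup>2 = 4 * \<rho>" using assms by (simp_all add: t_def power_mult_distrib)
  have S: "S > 0" "S\<^sup>2 = 1 + r\<^sup>2" unfolding S_def by (simp_all add: add_pos_nonneg add_nonneg_nonneg)
  have i1: "1 / (\<rho> + 1) = r / t" unfolding r_def corr_def t_def[symmetric] using t by (simp add: add.commute)
  have i2: "1 / (2 * sqrt \<rho>) = 1 / t" by (simp add: t_def)
  have "2 / (\<rho> + 1)\<^sup>2 + 1 / (2 * \<rho>) = 2 * (1 / (\<rho> + 1))\<^sup>2 + 2 / (4 * \<rho>)" by (simp add: power_divide)
  also have "\<dots> = 2 * (1 + r\<^sup>2) / t\<^sup>2"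
    unfolding i1 t(2)[symmetric] using t(1) by (simp add: power_divide add_divide_distrib)
  finally have e: "2 / (\<rho> + 1)\<^sup>2 + 1 / (2 * \<rho>) = 2 * (1 + r\<^sup>2) / t\<^sup>2" .
  have "sqrt (2 / (\<rho> + 1)\<^sup>2 + 1 / (2 * \<rho>)) = sqrt 2 * S / t"
    unfolding e S_def real_sqrt_divide real_sqrt_mult real_sqrt_abs using t(1) by simp
  then have "a_coeff \<rho> = (r / t + 1 / t) / (sqrt 2 * S / t)" "b_coeff \<rho> = (r / t - 1 / t) / (sqrt 2 * S / t)"
    unfolding a_coeff_def b_coeff_def i1 i2 by simp_all
  then have "a_coeff \<rho> = (1 + r) / (sqrt 2 * S)" "b_coeff \<rho> = (r - 1) / (sqrt 2 * S)"
    using t(1) by (simp_all add: add_divide_distrib[symmetric] diff_divide_distrib[symmetric])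
  then have "a_coeff \<rho> / sqrt 2 = (1 + r) / ((sqrt 2 * sqrt 2) * S)" "b_coeff \<rho> / sqrt 2 = (r - 1) / ((sqrt 2 * sqrt 2) * S)"
    by (simp_all add: mult_ac)
  then show "a_coeff \<rho> / sqrt 2 = (1 + corr \<rho>) / (2 * sqrt (1 + (corr \<rho>)\<^sup>2))"
    "b_coeff \<rho> / sqrt 2 = (corr \<rho> - 1) / (2 * sqrt (1 + (corr \<rho>)\<^sup>2))"
    unfolding S_def r_def by simp_all
qed

text \<open>Cosine and sine of the half angle, where the full angle has cosine \<open>corr \<rho>\<close>; they are the
  entries of the orthogonal matrix that diagonalizes this form.\<close>

definition rot_cos :: "real \<Rightarrow> real" where "rot_cos \<rho> = sqrt ((1 + corr \<rho>) / 2)"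
definition rot_sin :: "real \<Rightarrow> real" where "rot_sin \<rho> = sqrt ((1 - corr \<rho>) / 2)"

lemma rot_squares:
  assumes "0 < \<rho>" "\<rho> < 1"
  shows "(rot_cos \<rho>)\<^sup>2 = (1 + corr \<rho>) / 2" "(rot_sin \<rho>)\<^sup>2 = (1 - corr \<rho>) / 2"
    "rot_cos \<rho> * rot_sin \<rho> = (1 - \<rho>) / (1 + \<rho>) / 2"
proof -
  note c = corr_bounds[OF assms]
  show "(rot_cos \<rho>)\<^sup>2 = (1 + corr \<rho>) / 2" "(rot_sin \<rho>)\<^sup>2 = (1 - corr \<rho>) / 2"
    using c by (simp_all add: rot_cos_def rot_sin_def)
  have "rot_cos \<rho> * rot_sin \<rho> = sqrt ((1 + corr \<rho>) / 2 * ((1 - corr \<rho>) / 2))"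
    by (simp only: rot_cos_def rot_sin_def real_sqrt_mult)
  also have "(1 + corr \<rho>) / 2 * ((1 - corr \<rho>) / 2) = ((1 - \<rho>) / (1 + \<rho>) / 2)\<^sup>2"
    unfolding power_divide[of _ 2] c(3) by (simp add: power2_eq_square algebra_simps)
  also have "sqrt \<dots> = (1 - \<rho>) / (1 + \<rho>) / 2" using assms by simp
  finally show "rot_cos \<rho> * rot_sin \<rho> = (1 - \<rho>) / (1 + \<rho>) / 2" .
qed

lemma limit_rotated:
  fixes U V :: real
  assumes "0 < \<rho>" "\<rho> < 1"
  shows "a_coeff \<rho> / sqrt 2 * ((rot_cos \<rho> * U + rot_sin \<rho> * V)\<^sup>2 - 1) +
      b_coeff \<rho> / sqrt 2 * ((rot_sin \<rho> * U - rot_cos \<rho> * V)\<^sup>2 - 1) =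
    p_coeff \<rho> * (U\<^sup>2 - 1) + q_coeff \<rho> * (U * V)"
proof -
  define r where "r = corr \<rho>"
  define w where "w = (1 - \<rho>) / (1 + \<rho>)"
  define S where "S = sqrt (1 + r\<^sup>2)"
  define c s where "c = rot_cos \<rho>" and "s = rot_sin \<rho>"
  have S: "S > 0" unfolding S_def by (simp add: add_pos_nonneg)
  have cs: "c\<^sup>2 = (1 + r) / 2" "s\<^sup>2 = (1 - r) / 2" "c * s = w / 2"
    using rot_squares[OF assms] by (simp_all add: c_def s_def r_def w_def)
  have w: "w\<^sup>2 = 1 - r\<^sup>2" using corr_bounds(3)[OF assms] by (simp add: w_def r_def)
  have e: "2 * S * (a_coeff \<rho> / sqrt 2) = 1 + r" "2 * S * (b_coeff \<rho> / sqrt 2) = r - 1"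
    "S * p_coeff \<rho> = r" "S * q_coeff \<rho> = w"
    using S unfolding limit_coeffs[OF assms] p_coeff_def q_coeff_def by (simp_all add: S_def r_def w_def)
  have "(1 + r) * ((c * U + s * V)\<^sup>2 - 1) + (r - 1) * ((s * U - c * V)\<^sup>2 - 1) =
     ((1 + r) * c\<^sup>2 + (r - 1) * s\<^sup>2) * U\<^sup>2 + ((1 + r) * s\<^sup>2 + (r - 1) * c\<^sup>2) * V\<^sup>2 + 4 * (c * s) * (U * V) - 2 * r"
    by (simp add: power2_eq_square algebra_simps)
  also have "\<dots> = 2 * r * (U\<^sup>2 - 1) + 2 * w * (U * V)"
    unfolding cs by (simp add: power2_eq_square field_simps)
  finally have id: "(1 + r) * ((c * U + s * V)\<^sup>2 - 1) + (r - 1) * ((s * U - c * V)\<^sup>2 - 1) = 2 * r * (U\<^sup>2 - 1) + 2 * w * (U * V)" .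
  have "2 * S * (a_coeff \<rho> / sqrt 2 * ((c * U + s * V)\<^sup>2 - 1) + b_coeff \<rho> / sqrt 2 * ((s * U - c * V)\<^sup>2 - 1)) =
    (2 * S * (a_coeff \<rho> / sqrt 2)) * ((c * U + s * V)\<^sup>2 - 1) + (2 * S * (b_coeff \<rho> / sqrt 2)) * ((s * U - c * V)\<^sup>2 - 1)"
    by (simp only: distrib_left mult.assoc)
  also have "\<dots> = 2 * (S * p_coeff \<rho>) * (U\<^sup>2 - 1) + 2 * (S * q_coeff \<rho>) * (U * V)"
    unfolding e by (rule id)
  also have "\<dots> = 2 * S * (p_coeff \<rho> * (U\<^sup>2 - 1) + q_coeff \<rho> * (U * V))"
    by (simp only: distrib_left mult_ac)
  finally show ?thesis using S by (simp add: c_def s_def)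
qed

lemma lin_approx_linear: "lin_approx (\<lambda>x. c - d * x) c"
  by (rule lin_approxI[of _ _ "\<bar>d\<bar>"])
     (use eventually_at_right_less[of 0] in \<open>eventually_elim, simp add: abs_mult\<close>)

text \<open>In terms of \<open>\<epsilon>\<close> each of the four Beta values has a simple pole at 0, with residue given by
  \<open>lin_approx_Beta\<close>; the square of the constant is therefore \<open>\<epsilon>\<^sup>2\<close> times a function that has a
  positive limit with error \<open>O(\<epsilon>)\<close>.\<close>

lemma rosenblatt_const_asymp:
  assumes "0 < \<rho>" "\<rho> < 1"
  shows "lin_approx (\<lambda>\<epsilon>. rosenblatt_const (- 1/2 - \<epsilon>) (- 1/2 - \<epsilon> / \<rho>) / \<epsilon>) (2 / (sqrt \<rho> * sqrt (1 + (corr \<rho>)\<^sup>2)))"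
proof -
  define m where "m = 1 + 1 / \<rho>"
  have m: "m > 0" using assms by (simp add: m_def add_pos_pos)
  define D where "D \<epsilon> = (\<epsilon> * Beta (1/2 - 1 * \<epsilon>) (m * \<epsilon>)) * (\<epsilon> * Beta (1/2 - (1/\<rho>) * \<epsilon>) (m * \<epsilon>)) +
     (\<epsilon> * Beta (1/2 - 1 * \<epsilon>) (2 * \<epsilon>)) * (\<epsilon> * Beta (1/2 - (1/\<rho>) * \<epsilon>) ((2/\<rho>) * \<epsilon>))" for \<epsilon>
  define N where "N \<epsilon> = (1 - m * \<epsilon>) * (1 - (2 * m) * \<epsilon>)" for \<epsilon>
  define \<Lambda> where "\<Lambda> = 1 / m * (1 / m) + 1 / 2 * (1 / (2 / \<rho>))"
  have \<Lambda>: "\<Lambda> = (sqrt \<rho> * sqrt (1 + (corr \<rho>)\<^sup>2) / 2)\<^sup>2"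
  proof -
    have "(sqrt \<rho> * sqrt (1 + (corr \<rho>)\<^sup>2) / 2)\<^sup>2 = \<rho> * (1 + (corr \<rho>)\<^sup>2) / 4"
      using assms by (simp add: power_divide power_mult_distrib)
    also have "\<dots> = \<rho> * (1 + 4 * \<rho> / (1 + \<rho>)\<^sup>2) / 4"
      using assms by (simp add: corr_def power_divide power_mult_distrib)
    also have "\<rho> * (1 + 4 * \<rho> / (1 + \<rho>)\<^sup>2) / 4 = \<rho> / 4 + (\<rho> / (1 + \<rho>))\<^sup>2"
      by (simp add: power_divide power2_eq_square[of \<rho>] field_simps)
    also have "\<rho> / (1 + \<rho>) = 1 / m" using assms by (simp add: m_def field_simps)
    also have "\<rho> / 4 + (1 / m)\<^sup>2 = \<Lambda>" by (simp add: \<Lambda>_def power2_eq_square)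
    finally show ?thesis ..
  qed
  have pos: "sqrt \<rho> * sqrt (1 + (corr \<rho>)\<^sup>2) / 2 > 0" using assms by (simp add: add_pos_nonneg)
  have \<Lambda>0: "\<Lambda> > 0" unfolding \<Lambda> by (rule zero_less_power[OF pos])
  have Dl: "lin_approx D \<Lambda>"
    unfolding D_def[abs_def] \<Lambda>_def using m assms
    by (intro lin_approx_add lin_approx_mult lin_approx_Beta) auto
  have Nl: "lin_approx N 1"
    unfolding N_def[abs_def] using lin_approx_mult[OF lin_approx_linear[of 1 m] lin_approx_linear[of 1 "2 * m"]] by simp
  have sD: "lin_approx (\<lambda>\<epsilon>. sqrt (D \<epsilon>)) (sqrt \<Lambda>)" by (rule lin_approx_sqrt[OF Dl \<Lambda>0])
  have sN: "lin_approx (\<lambda>\<epsilon>. sqrt (N \<epsilon>)) (sqrt 1)" by (rule lin_approx_sqrt[OF Nl]) simp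
  have "lin_approx (\<lambda>\<epsilon>. sqrt (N \<epsilon>) * (1 / sqrt (D \<epsilon>))) (sqrt 1 * (1 / sqrt \<Lambda>))"
    by (intro lin_approx_mult sN lin_approx_inverse sD) (use \<Lambda>0 in simp)
  also have "sqrt 1 * (1 / sqrt \<Lambda>) = 2 / (sqrt \<rho> * sqrt (1 + (corr \<rho>)\<^sup>2))"
    unfolding \<Lambda> real_sqrt_abs abs_of_pos[OF pos] by simp
  finally show ?thesis
  proof (rule lin_approx_cong)
    have "\<forall>\<^sub>F \<epsilon> in at_right 0. 0 < D \<epsilon>" by (rule order_tendstoD(1)[OF lin_approx_tendsto[OF Dl] \<Lambda>0])
    moreover have "\<forall>\<^sub>F \<epsilon> in at_right 0. 0 < N \<epsilon>" by (rule order_tendstoD(1)[OF lin_approx_tendsto[OF Nl]]) simp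
    ultimately show "\<forall>\<^sub>F \<epsilon> in at_right 0. sqrt (N \<epsilon>) * (1 / sqrt (D \<epsilon>)) = rosenblatt_const (- 1/2 - \<epsilon>) (- 1/2 - \<epsilon> / \<rho>) / \<epsilon>"
      using eventually_at_right_less[of 0]
    proof eventually_elim
      case (elim \<epsilon>)
      define \<gamma> \<gamma>' where "\<gamma> = - 1/2 - \<epsilon>" and "\<gamma>' = - 1/2 - \<epsilon> / \<rho>"
      have args: "\<gamma> + 1 = 1/2 - 1 * \<epsilon>" "\<gamma>' + 1 = 1/2 - (1/\<rho>) * \<epsilon>" "- \<gamma> - \<gamma>' - 1 = m * \<epsilon>"
        "- 2 * \<gamma> - 1 = 2 * \<epsilon>" "- 2 * \<gamma>' - 1 = (2/\<rho>) * \<epsilon>" "\<gamma> + \<gamma>' + 2 = 1 - m * \<epsilon>" "2 * (\<gamma> + \<gamma>') + 3 = 1 - (2 * m) * \<epsilon>"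
        unfolding \<gamma>_def \<gamma>'_def m_def by (simp_all add: field_simps)
      have "rosenblatt_const \<gamma> \<gamma>' = N \<epsilon> powr (1/2) * (D \<epsilon> / \<epsilon>\<^sup>2) powr (- 1/2)"
        unfolding rosenblatt_const_def args N_def D_def using elim(3)
        by (simp add: power2_eq_square add_divide_distrib)
      also have "N \<epsilon> powr (1/2) = sqrt (N \<epsilon>)" using elim by (simp add: powr_half_sqrt)
      also have "(D \<epsilon> / \<epsilon>\<^sup>2) powr (- 1/2) = 1 / sqrt (D \<epsilon> / \<epsilon>\<^sup>2)"
        using elim powr_minus_divide[of "D \<epsilon> / \<epsilon>\<^sup>2" "1/2"] by (simp add: powr_half_sqrt)
      also have "\<dots> = \<epsilon> / sqrt (D \<epsilon>)" using elim by (simp add: real_sqrt_divide)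
      finally show ?case using elim by (simp add: \<gamma>_def \<gamma>'_def)
    qed
  qed
qed

definition partial_power_sum :: "nat \<Rightarrow> real \<Rightarrow> real" where
  "partial_power_sum K p = (\<Sum>k<K. real (Suc k) powr p)"

lemma lin_approx_partial_sum:
  assumes d: "d > 0"
    and K: "\<And>\<epsilon>. \<epsilon> > 0 \<Longrightarrow> (\<Sum>k. real (Suc k) powr (- 1 - d * \<epsilon>)) \<le> partial_power_sum (K \<epsilon>) (- 1 - d * \<epsilon>) + 1"
  shows "lin_approx (\<lambda>\<epsilon>. \<epsilon> * partial_power_sum (K \<epsilon>) (- 1 - d * \<epsilon>)) (1 / d)"
proof (rule lin_approxI[of _ _ 1], use eventually_at_right_less[of 0] in eventually_elim)
  case (elim \<epsilon>)
  let ?\<delta> = "d * \<epsilon>"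
  let ?s = "partial_power_sum (K \<epsilon>) (- 1 - ?\<delta>)" and ?S = "\<Sum>k. real (Suc k) powr (- 1 - ?\<delta>)"
  have d0: "?\<delta> > 0" using d elim by simp
  note b = power_sum_bounds[OF d0]
  have "?s \<le> ?S" unfolding partial_power_sum_def by (rule sum_le_suminf[OF b(1)]) auto
  then have "?\<delta> * ?s \<le> ?\<delta> * ?S" "?\<delta> * ?S \<le> ?\<delta> * (?s + 1)"
    using d0 K[OF elim] by (auto intro: mult_left_mono simp del: mult_le_cancel_left_pos)
  then have "\<bar>?\<delta> * ?s - 1\<bar> \<le> ?\<delta>" using b(2,3) by (simp add: distrib_left abs_le_iff)
  then have "\<bar>?\<delta> * ?s - 1\<bar> / d \<le> ?\<delta> / d" using d by (intro divide_right_mono) auto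
  moreover have "\<bar>?\<delta> * ?s - 1\<bar> / d = \<bar>\<epsilon> * ?s - 1 / d\<bar>"
  proof -
    have "\<bar>?\<delta> * ?s - 1\<bar> / d = \<bar>(?\<delta> * ?s - 1) / d\<bar>" using d by simp
    also have "(?\<delta> * ?s - 1) / d = \<epsilon> * ?s - 1 / d" using d by (simp add: diff_divide_distrib)
    finally show ?thesis .
  qed
  ultimately show ?case using d by simp
qed

text \<open>The three sums are the second moments of the two Gaussian combinations that are truncated at
  \<open>K \<epsilon>\<close>: the two variances, of order \<open>1 / (2 \<epsilon>)\<close> and \<open>\<rho> / (2 \<epsilon>)\<close>, and the covariance, of order
  \<open>\<rho> / ((1 + \<rho>) \<epsilon>)\<close>.\<close>

lemma coefficient_asymptotics:
  fixes K :: "real \<Rightarrow> nat"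
  assumes \<rho>: "0 < \<rho>" "\<rho> < 1"
    and K: "\<And>\<epsilon> d. \<epsilon> > 0 \<Longrightarrow> d \<in> {2, 2 / \<rho>, 1 + 1 / \<rho>} \<Longrightarrow>
      (\<Sum>k. real (Suc k) powr (- 1 - d * \<epsilon>)) \<le> partial_power_sum (K \<epsilon>) (- 1 - d * \<epsilon>) + 1"
  defines "A \<equiv> \<lambda>\<epsilon>. rosenblatt_const (- 1/2 - \<epsilon>) (- 1/2 - \<epsilon> / \<rho>)"
    and "s \<equiv> \<lambda>d \<epsilon>. partial_power_sum (K \<epsilon>) (- 1 - d * \<epsilon>)"
  shows "lin_approx (\<lambda>\<epsilon>. A \<epsilon> * s (1 + 1 / \<rho>) \<epsilon>) (p_coeff \<rho>)"
    and "lin_approx (\<lambda>\<epsilon>. A \<epsilon> * sqrt (s 2 \<epsilon> * s (2 / \<rho>) \<epsilon> - (s (1 + 1 / \<rho>) \<epsilon>)\<^sup>2)) (q_coeff \<rho>)"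
    and "\<forall>\<^sub>F \<epsilon> in at_right 0. s 2 \<epsilon> * s (2 / \<rho>) \<epsilon> - (s (1 + 1 / \<rho>) \<epsilon>)\<^sup>2 > 0"
proof -
  define m where "m = 1 + 1 / \<rho>"
  define S where "S = sqrt (1 + (corr \<rho>)\<^sup>2)"
  define w where "w = (1 - \<rho>) / (1 + \<rho>)"
  have m: "m > 0" using \<rho> by (simp add: m_def add_pos_pos)
  have S: "S > 0" unfolding S_def by (simp add: add_pos_nonneg)
  have w: "w > 0" using \<rho> by (simp add: w_def)
  have A: "lin_approx (\<lambda>\<epsilon>. A \<epsilon> / \<epsilon>) (2 / (sqrt \<rho> * S))"
    unfolding A_def S_def by (rule rosenblatt_const_asymp[OF \<rho>])
  have s: "lin_approx (\<lambda>\<epsilon>. \<epsilon> * s d \<epsilon>) (1 / d)" if "d \<in> {2, 2 / \<rho>, m}" for d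
    unfolding s_def using that \<rho> m by (intro lin_approx_partial_sum K) (auto simp: m_def)
  have im: "1 / m = \<rho> / (1 + \<rho>)" using \<rho> by (simp add: m_def field_simps)
  have sr: "sqrt \<rho> > 0" "\<rho> = sqrt \<rho> * sqrt \<rho>" using \<rho> by simp_all
  have "lin_approx (\<lambda>\<epsilon>. (A \<epsilon> / \<epsilon>) * (\<epsilon> * s m \<epsilon>)) (2 / (sqrt \<rho> * S) * (1 / m))"
    by (intro lin_approx_mult A s) simp
  also have "2 / (sqrt \<rho> * S) * (1 / m) = p_coeff \<rho>"
  proof -
    have "2 / (sqrt \<rho> * S) * (\<rho> / (1 + \<rho>)) = 2 / (sqrt \<rho> * S) * ((sqrt \<rho> * sqrt \<rho>) / (1 + \<rho>))" using \<rho> by simp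
    also have "\<dots> = (2 * sqrt \<rho> / (1 + \<rho>)) / S" using sr(1) S by (simp del: real_sqrt_mult_self)
    finally show ?thesis unfolding im by (simp add: p_coeff_def S_def corr_def)
  qed
  finally show "lin_approx (\<lambda>\<epsilon>. A \<epsilon> * s (1 + 1 / \<rho>) \<epsilon>) (p_coeff \<rho>)"
    unfolding m_def by (rule lin_approx_cong) (use eventually_at_right_less[of 0] in \<open>eventually_elim, simp\<close>)
  define Q where "Q \<epsilon> = (\<epsilon> * s 2 \<epsilon>) * (\<epsilon> * s (2 / \<rho>) \<epsilon>) - (\<epsilon> * s m \<epsilon>) * (\<epsilon> * s m \<epsilon>)" for \<epsilon>
  have Ql: "lin_approx Q (1 / 2 * (1 / (2 / \<rho>)) - 1 / m * (1 / m))"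
    unfolding Q_def[abs_def] by (intro lin_approx_diff lin_approx_mult s) auto
  have lim: "1 / 2 * (1 / (2 / \<rho>)) - 1 / m * (1 / m) = (sqrt \<rho> * w / 2)\<^sup>2"
  proof -
    have "(sqrt \<rho> * w / 2)\<^sup>2 = \<rho> * w\<^sup>2 / 4" using \<rho> by (simp add: power_divide power_mult_distrib)
    also have "\<dots> = \<rho> * (1 - 4 * \<rho> / (1 + \<rho>)\<^sup>2) / 4"
      unfolding w_def corr_bounds(3)[OF \<rho>] using \<rho> by (simp add: corr_def power_divide power_mult_distrib)
    also have "\<dots> = \<rho> / 4 - (\<rho> / (1 + \<rho>))\<^sup>2"
      by (simp add: power_divide power2_eq_square[of \<rho>] field_simps)
    finally show ?thesis unfolding im by (simp add: power2_eq_square)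
  qed
  have wp: "sqrt \<rho> * w / 2 > 0" using sr w by simp
  have Ql': "lin_approx Q ((sqrt \<rho> * w / 2)\<^sup>2)" using Ql unfolding lim .
  have Qev: "Q \<epsilon> = \<epsilon>\<^sup>2 * (s 2 \<epsilon> * s (2 / \<rho>) \<epsilon> - (s (1 + 1 / \<rho>) \<epsilon>)\<^sup>2)" for \<epsilon>
    by (simp add: Q_def m_def power2_eq_square algebra_simps)
  have Qpos: "\<forall>\<^sub>F \<epsilon> in at_right 0. 0 < Q \<epsilon>"
    by (rule order_tendstoD(1)[OF lin_approx_tendsto[OF Ql']]) (rule zero_less_power[OF wp])
  show "\<forall>\<^sub>F \<epsilon> in at_right 0. s 2 \<epsilon> * s (2 / \<rho>) \<epsilon> - (s (1 + 1 / \<rho>) \<epsilon>)\<^sup>2 > 0"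
    using Qpos eventually_at_right_less[of 0]
  proof eventually_elim
    case (elim \<epsilon>)
    then show ?case unfolding Qev by (simp add: zero_less_mult_iff)
  qed
  have "lin_approx (\<lambda>\<epsilon>. (A \<epsilon> / \<epsilon>) * sqrt (Q \<epsilon>)) (2 / (sqrt \<rho> * S) * sqrt ((sqrt \<rho> * w / 2)\<^sup>2))"
    by (rule lin_approx_mult[OF A lin_approx_sqrt[OF Ql' zero_less_power[OF wp]]])
  also have "2 / (sqrt \<rho> * S) * sqrt ((sqrt \<rho> * w / 2)\<^sup>2) = 2 / (sqrt \<rho> * S) * (sqrt \<rho> * w / 2)"
    by (simp only: real_sqrt_abs abs_of_pos[OF wp])
  also have "\<dots> = w / S" using sr(1) S by simp
  also have "\<dots> = q_coeff \<rho>" by (simp only: q_coeff_def w_def S_def)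
  finally show "lin_approx (\<lambda>\<epsilon>. A \<epsilon> * sqrt (s 2 \<epsilon> * s (2 / \<rho>) \<epsilon> - (s (1 + 1 / \<rho>) \<epsilon>)\<^sup>2)) (q_coeff \<rho>)"
    by (rule lin_approx_cong)
       (use eventually_at_right_less[of 0] in \<open>eventually_elim, simp add: Qev real_sqrt_mult\<close>)
qed

section \<open>The kernel on unit cells\<close>

lemma nn_integral_lborel_prod:
  fixes F :: "real \<times> real \<Rightarrow> ennreal"
  assumes [measurable]: "F \<in> borel_measurable borel"
  shows "(\<integral>\<^sup>+ z. F z \<partial>lborel) = (\<integral>\<^sup>+ x. \<integral>\<^sup>+ y. F (x, y) \<partial>lborel \<partial>lborel)"
proof -
  have m: "F \<in> borel_measurable (lborel \<Otimes>\<^sub>M lborel)" by (simp add: lborel_prod)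
  show ?thesis unfolding lborel_prod[symmetric] by (rule lborel.nn_integral_fst[OF m, symmetric])
qed

lemma nn_integral_tensor:
  fixes F G :: "real \<Rightarrow> ennreal"
  assumes [measurable]: "F \<in> borel_measurable borel" "G \<in> borel_measurable borel"
  shows "(\<integral>\<^sup>+ z. F (fst z) * G (snd z) \<partial>lborel) = (\<integral>\<^sup>+ x. F x \<partial>lborel) * (\<integral>\<^sup>+ y. G y \<partial>lborel)"
proof -
  have [measurable]: "(\<lambda>z :: real \<times> real. F (fst z) * G (snd z)) \<in> borel_measurable borel"
    unfolding borel_prod[symmetric] by measurable
  show ?thesis
    by (subst nn_integral_lborel_prod) (simp_all add: nn_integral_cmult nn_integral_multc)
qed

lemma nn_integral_translate:
  fixes G :: "real \<Rightarrow> ennreal"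
  assumes [measurable]: "G \<in> borel_measurable borel"
  shows "(\<integral>\<^sup>+ y. G (y - x) \<partial>lborel) = (\<integral>\<^sup>+ u. G u \<partial>lborel)"
    and "(\<integral>\<^sup>+ y. G (x - y) \<partial>lborel) = (\<integral>\<^sup>+ u. G u \<partial>lborel)"
  using nn_integral_real_affine[of G 1 "- x"] nn_integral_real_affine[of G "-1" x] by simp_all

lemma nn_integral_convolution:
  fixes F G :: "real \<Rightarrow> ennreal"
  assumes [measurable]: "F \<in> borel_measurable borel" "G \<in> borel_measurable borel"
  shows "(\<integral>\<^sup>+ z. F (fst z) * G (fst z - snd z) \<partial>lborel) = (\<integral>\<^sup>+ x. F x \<partial>lborel) * (\<integral>\<^sup>+ u. G u \<partial>lborel)"
proof -
  have [measurable]: "(\<lambda>z :: real \<times> real. F (fst z) * G (fst z - snd z)) \<in> borel_measurable borel"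
    unfolding borel_prod[symmetric] by measurable
  show ?thesis
    by (subst nn_integral_lborel_prod) (simp_all add: nn_integral_cmult nn_integral_multc nn_integral_translate)
qed

definition power_mass :: "real \<Rightarrow> ennreal" where
  "power_mass e = (\<integral>\<^sup>+ u. ennreal (u powr e) * indicator {0<..<2} u \<partial>lborel)"

lemma power_mass_finite:
  assumes "e > - 1"
  shows "power_mass e < \<infinity>"
proof -
  have "power_mass e \<le> (\<integral>\<^sup>+ u. ennreal (u powr e) * indicator {0..2} u \<partial>lborel)"
    unfolding power_mass_def by (intro nn_integral_mono) (auto simp: indicator_def)
  also have "\<dots> = ennreal (2 powr (e + 1) / (e + 1))"
    by (rule nn_integral_has_integral_lebesgue'[OF _ has_integral_powr_from_0]) (use assms in auto)
  finally show ?thesis by (simp add: le_less_trans)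
qed

definition cell :: "nat \<Rightarrow> real set" where
  "cell k = {- (real k + 2)<..- (real k + 1)}"

definition cell_sum :: "(nat \<Rightarrow> real) \<Rightarrow> real \<Rightarrow> ennreal" where
  "cell_sum \<phi> x = (\<Sum>k. ennreal (\<phi> k) * indicator (cell k) x)"

lemma cell_sets [measurable]: "cell k \<in> sets borel"
  by (simp add: cell_def)

lemma cell_sum_measurable [measurable]: "cell_sum \<phi> \<in> borel_measurable borel"
  unfolding cell_sum_def[abs_def] by measurable

lemma nn_integral_cell_sum: "(\<integral>\<^sup>+ x. cell_sum \<phi> x \<partial>lborel) = (\<Sum>k. ennreal (\<phi> k))"
  unfolding cell_sum_def by (subst nn_integral_suminf) (simp_all add: nn_integral_cmult cell_def)

lemma cell_sum_ge:
  assumes "x \<in> cell k"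
  shows "ennreal (\<phi> k) \<le> cell_sum \<phi> x"
proof -
  have "(\<Sum>i\<in>{k}. ennreal (\<phi> i) * indicator (cell i) x) \<le> cell_sum \<phi> x"
    unfolding cell_sum_def by (rule sum_le_suminf) auto
  then show ?thesis using assms by simp
qed

lemma obtain_cell:
  assumes "x \<le> - 1"
  obtains k where "x \<in> cell k"
proof
  define k where "k = nat \<lfloor>- x\<rfloor> - 1"
  have "1 \<le> \<lfloor>- x\<rfloor>" using assms by (simp add: le_floor_iff)
  then have "int k + 1 = \<lfloor>- x\<rfloor>" unfolding k_def by linarith
  then have "real k + 1 = of_int \<lfloor>- x\<rfloor>" by linarith
  then have "real k + 1 \<le> - x" "- x < real k + 2" by linarith+
  then show "x \<in> cell k" by (simp add: cell_def)
qed

lemma cell_unique: "x \<in> cell i \<Longrightarrow> x \<in> cell j \<Longrightarrow> i = j"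
  by (auto simp: cell_def)

text \<open>The product of \<open>(- x) powr \<gamma>\<close> and \<open>(- y) powr \<gamma>'\<close>, discretized on the first \<open>K\<close> cells in each
  direction. The cells on the diagonal are left out to stay in the domain of the elementary
  integral.\<close>

definition cell_rectangles :: "real \<Rightarrow> real \<Rightarrow> nat \<Rightarrow> rectangles" where
  "cell_rectangles \<gamma> \<gamma>' K =
     map (\<lambda>(i, j). (real (Suc i) powr \<gamma> * real (Suc j) powr \<gamma>',
         (- (real i + 2), - (real i + 1)), (- (real j + 2), - (real j + 1))))
       (filter (\<lambda>(i, j). i \<noteq> j) (List.product [0..<K] [0..<K]))"

lemma off_diagonal_cell_rectangles: "off_diagonal (cell_rectangles \<gamma> \<gamma>' K)"
  unfolding off_diagonal_def cell_rectangles_def by (auto simp: greaterThanAtMost_iff)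

lemma sum_list_cell_rectangles:
  "(\<Sum>(c, (a, b), (a', b'))\<leftarrow>cell_rectangles \<gamma> \<gamma>' K. \<psi> c a b a' b') =
   (\<Sum>i<K. \<Sum>j<K. if i \<noteq> j then \<psi> (real (Suc i) powr \<gamma> * real (Suc j) powr \<gamma>')
        (- (real i + 2)) (- (real i + 1)) (- (real j + 2)) (- (real j + 1)) else (0 :: real))"
proof -
  let ?g = "\<lambda>(i, j). \<psi> (real (Suc i) powr \<gamma> * real (Suc j) powr \<gamma>')
        (- (real i + 2)) (- (real i + 1)) (- (real j + 2)) (- (real j + 1))"
  let ?L = "filter (\<lambda>(i, j). i \<noteq> j) (List.product [0..<K] [0..<K])"
  have "(\<Sum>(c, (a, b), (a', b'))\<leftarrow>cell_rectangles \<gamma> \<gamma>' K. \<psi> c a b a' b') = (\<Sum>p\<leftarrow>?L. ?g p)"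
    unfolding cell_rectangles_def map_map by (rule arg_cong[where f=sum_list], rule map_cong) auto
  also have "\<dots> = sum ?g (set ?L)"
    by (rule sum_list_distinct_conv_sum_set) (simp add: distinct_product)
  also have "set ?L = {p \<in> {..<K} \<times> {..<K}. fst p \<noteq> snd p}" by auto
  also have "sum ?g \<dots> = (\<Sum>p\<in>{..<K} \<times> {..<K}. if fst p \<noteq> snd p then ?g p else 0)"
    by (rule sum.inter_filter) simp
  also have "\<dots> = (\<Sum>(i, j)\<in>{..<K} \<times> {..<K}. if i \<noteq> j then ?g (i, j) else 0)"
    by (rule sum.cong) auto
  also have "\<dots> = (\<Sum>i<K. \<Sum>j<K. if i \<noteq> j then ?g (i, j) else 0)"
    by (rule sum.cartesian_product[symmetric])
  finally show ?thesis unfolding prod.case .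
qed

lemma step_fun_cell_rectangles:
  "step_fun (cell_rectangles \<gamma> \<gamma>' K) (x, y) = (\<Sum>i<K. \<Sum>j<K. if i \<noteq> j then
      real (Suc i) powr \<gamma> * real (Suc j) powr \<gamma>' * indicator (cell i) x * indicator (cell j) y else 0)"
  unfolding step_fun_def prod.case cell_def by (rule sum_list_cell_rectangles)

lemma step_fun_cell_rectangles_in:
  assumes "x \<in> cell i" "y \<in> cell j"
  shows "step_fun (cell_rectangles \<gamma> \<gamma>' K) (x, y) =
    (if i < K \<and> j < K \<and> i \<noteq> j then real (Suc i) powr \<gamma> * real (Suc j) powr \<gamma>' else 0)"
proof -
  have ind: "indicator (cell i') x = (of_bool (i' = i) :: real)" "indicator (cell i') y = (of_bool (i' = j) :: real)" for i'
    using assms cell_unique by (auto simp: indicator_def)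
  have "step_fun (cell_rectangles \<gamma> \<gamma>' K) (x, y) = (\<Sum>i'<K. \<Sum>j'<K. if j' = j then (if i' = i then
      (if i \<noteq> j then real (Suc i) powr \<gamma> * real (Suc j) powr \<gamma>' else 0) else 0) else 0)"
    unfolding step_fun_cell_rectangles ind by (intro sum.cong refl) auto
  then show ?thesis by (cases "i = j"; cases "j < K"; simp add: sum.delta)
qed

lemma step_fun_cell_rectangles_out:
  assumes "x > - 1 \<or> y > - 1"
  shows "step_fun (cell_rectangles \<gamma> \<gamma>' K) (x, y) = 0"
  unfolding step_fun_cell_rectangles
  by (intro sum.neutral ballI) (use assms in \<open>auto simp: cell_def\<close>)

lemma pos_powr_measurable [measurable]: "(\<lambda>u. pos_powr u \<gamma>) \<in> borel_measurable borel"
  unfolding pos_powr_def by measurable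

lemma pos_powr_nonneg: "0 \<le> pos_powr u \<gamma>"
  by (simp add: pos_powr_def)

lemma rosenblatt_kernel_nonneg: "0 \<le> rosenblatt_kernel \<gamma> \<gamma>' z"
  unfolding rosenblatt_kernel_def set_lebesgue_integral_def
  by (cases z) (auto intro!: integral_nonneg_AE mult_nonneg_nonneg simp: pos_powr_nonneg)

lemma rosenblatt_kernel_measurable: "rosenblatt_kernel \<gamma> \<gamma>' \<in> borel_measurable borel"
proof -
  have "(\<lambda>z. LINT s|lborel. indicator {0..1} s *\<^sub>R (pos_powr (s - fst z) \<gamma> * pos_powr (s - snd z) \<gamma>')) \<in> borel_measurable (borel \<Otimes>\<^sub>M borel)"
    by measurable
  then show ?thesis
    by (simp add: rosenblatt_kernel_def set_lebesgue_integral_def borel_prod case_prod_unfold)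
qed

lemma rosenblatt_kernel_le:
  assumes "0 \<le> C" "(\<integral>\<^sup>+ s. ennreal (pos_powr (s - x) \<gamma> * pos_powr (s - y) \<gamma>') * indicator {0..1} s \<partial>lborel) \<le> ennreal C"
  shows "rosenblatt_kernel \<gamma> \<gamma>' (x, y) \<le> C"
  unfolding rosenblatt_kernel_def set_lebesgue_integral_def prod.case
proof (rule integral_real_bounded[OF assms(1)])
  have "(\<integral>\<^sup>+ s. ennreal (indicator {0..1} s *\<^sub>R (pos_powr (s - x) \<gamma> * pos_powr (s - y) \<gamma>')) \<partial>lborel) =
    (\<integral>\<^sup>+ s. ennreal (pos_powr (s - x) \<gamma> * pos_powr (s - y) \<gamma>') * indicator {0..1} s \<partial>lborel)"
    by (intro nn_integral_cong) (auto simp: indicator_def)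
  then show "(\<integral>\<^sup>+ s. ennreal (indicator {0..1} s *\<^sub>R (pos_powr (s - x) \<gamma> * pos_powr (s - y) \<gamma>')) \<partial>lborel) \<le> ennreal C"
    using assms(2) by simp
qed

lemma rosenblatt_kernel_zero:
  assumes "x \<ge> 1 \<or> y \<ge> 1"
  shows "rosenblatt_kernel \<gamma> \<gamma>' (x, y) = 0"
proof -
  have z: "indicator {0..1} s *\<^sub>R (pos_powr (s - x) \<gamma> * pos_powr (s - y) \<gamma>') = 0" for s
    using assms by (auto simp: indicator_def pos_powr_def)
  show ?thesis unfolding rosenblatt_kernel_def set_lebesgue_integral_def prod.case z by simp
qed

lemma rosenblatt_kernel_commute: "rosenblatt_kernel \<gamma> \<gamma>' (x, y) = rosenblatt_kernel \<gamma>' \<gamma> (y, x)"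
  by (simp add: rosenblatt_kernel_def mult.commute)

lemma cell_powr_bounds:
  assumes "x \<in> cell i" "s \<in> {0..1}" "\<gamma> < 0"
  shows "(real i + 3) powr \<gamma> \<le> pos_powr (s - x) \<gamma>" "pos_powr (s - x) \<gamma> \<le> real (Suc i) powr \<gamma>"
  using assms by (auto simp: pos_powr_def cell_def intro!: powr_mono2')

lemma kernel_far_far:
  assumes x: "x \<in> cell i" and y: "y \<in> cell j" and \<gamma>: "\<gamma> < 0" "\<gamma>' < 0"
  shows "(real i + 3) powr \<gamma> * (real j + 3) powr \<gamma>' \<le> rosenblatt_kernel \<gamma> \<gamma>' (x, y)"
    and "rosenblatt_kernel \<gamma> \<gamma>' (x, y) \<le> real (Suc i) powr \<gamma> * real (Suc j) powr \<gamma>'"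
proof -
  let ?h = "\<lambda>s. pos_powr (s - x) \<gamma> * pos_powr (s - y) \<gamma>'"
  let ?lo = "(real i + 3) powr \<gamma> * (real j + 3) powr \<gamma>'" and ?hi = "real (Suc i) powr \<gamma> * real (Suc j) powr \<gamma>'"
  have lo: "?lo \<le> ?h s" if "s \<in> {0..1}" for s
    using cell_powr_bounds(1)[OF x that \<gamma>(1)] cell_powr_bounds(1)[OF y that \<gamma>(2)]
    by (intro mult_mono) (auto simp: pos_powr_nonneg)
  have hi: "?h s \<le> ?hi" if "s \<in> {0..1}" for s
    using cell_powr_bounds(2)[OF x that \<gamma>(1)] cell_powr_bounds(2)[OF y that \<gamma>(2)]
    by (intro mult_mono) (auto simp: pos_powr_nonneg)
  have ci: "integrable lborel (\<lambda>s. indicator {0..1::real} s *\<^sub>R (c :: real))" for c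
    by simp
  have cv: "(LINT s|lborel. indicator {0..1::real} s *\<^sub>R (c :: real)) = c" for c by simp
  have hint: "integrable lborel (\<lambda>s. indicator {0..1} s *\<^sub>R ?h s)"
  proof (rule Bochner_Integration.integrable_bound[OF ci[of ?hi]])
    show "AE s in lborel. norm (indicator {0..1} s *\<^sub>R ?h s) \<le> norm (indicator {0..1} s *\<^sub>R ?hi)"
      using hi by (intro AE_I2) (auto simp: indicator_def pos_powr_nonneg abs_mult)
  qed simp
  have "(LINT s|lborel. indicator {0..1::real} s *\<^sub>R ?lo) \<le> (LINT s|lborel. indicator {0..1} s *\<^sub>R ?h s)"
    by (rule integral_mono[OF ci hint]) (use lo in \<open>auto simp: indicator_def\<close>)
  then show "?lo \<le> rosenblatt_kernel \<gamma> \<gamma>' (x, y)"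
    unfolding cv by (simp add: rosenblatt_kernel_def set_lebesgue_integral_def)
  have "(LINT s|lborel. indicator {0..1} s *\<^sub>R ?h s) \<le> (LINT s|lborel. indicator {0..1::real} s *\<^sub>R ?hi)"
    by (rule integral_mono[OF hint ci]) (use hi in \<open>auto simp: indicator_def\<close>)
  then show "rosenblatt_kernel \<gamma> \<gamma>' (x, y) \<le> ?hi"
    unfolding cv by (simp add: rosenblatt_kernel_def set_lebesgue_integral_def)
qed

text \<open>The fixed exponent makes the bounds near the origin uniform in \<open>\<gamma>\<close>. The value \<open>- 5/8\<close> is one
  that still leaves a margin for the split of exponents in \<open>kernel_near_near\<close>.\<close>

lemma pos_powr_le_uniform:
  assumes "u < 2" "- 5/8 \<le> \<gamma>" "\<gamma> < - 1/2"
  shows "pos_powr u \<gamma> \<le> 2 * pos_powr u (- 5/8)"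
proof (cases "u > 0")
  case True
  have "u powr (\<gamma> + 5/8) \<le> 2"
  proof (cases "u \<le> 1")
    case True
    then have "u powr (\<gamma> + 5/8) \<le> 1 powr (\<gamma> + 5/8)" using \<open>u > 0\<close> assms by (intro powr_mono2) auto
    then show ?thesis by simp
  next
    case False
    then have "u powr (\<gamma> + 5/8) \<le> u powr 1" using assms by (intro powr_mono) auto
    then show ?thesis using assms True by simp
  qed
  then have "u powr (\<gamma> + 5/8) * u powr (- 5/8) \<le> 2 * u powr (- 5/8)" by (intro mult_right_mono) auto
  also have "u powr (\<gamma> + 5/8) * u powr (- 5/8) = u powr \<gamma>" by (simp add: powr_add[symmetric])
  finally show ?thesis using True by (simp add: pos_powr_def)
qed (simp add: pos_powr_def)

lemma nn_integral_pos_powr: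
  assumes "- 1 < y"
  shows "(\<integral>\<^sup>+ s. ennreal (pos_powr (s - y) e) * indicator {0..1} s \<partial>lborel) \<le> power_mass e"
proof -
  have "(\<integral>\<^sup>+ s. ennreal (pos_powr (s - y) e) * indicator {0..1} s \<partial>lborel)
      \<le> (\<integral>\<^sup>+ s. ennreal ((s - y) powr e) * indicator {0<..<2} (s - y) \<partial>lborel)"
    using assms by (intro nn_integral_mono) (auto simp: indicator_def pos_powr_def)
  also have "\<dots> = power_mass e"
    unfolding power_mass_def by (rule nn_integral_translate(1)[where G="\<lambda>u. ennreal (u powr e) * indicator {0<..<2} u"]) measurable
  finally show ?thesis .
qed

lemma kernel_far_near:
  assumes x: "x \<in> cell i" and y: "- 1 < y" and \<gamma>: "\<gamma> < 0" "- 5/8 \<le> \<gamma>'" "\<gamma>' < - 1/2"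
  shows "rosenblatt_kernel \<gamma> \<gamma>' (x, y) \<le> real (Suc i) powr \<gamma> * (2 * enn2real (power_mass (- 5/8)))"
proof (rule rosenblatt_kernel_le)
  let ?c = "real (Suc i) powr \<gamma> * 2"
  have "(\<integral>\<^sup>+ s. ennreal (pos_powr (s - x) \<gamma> * pos_powr (s - y) \<gamma>') * indicator {0..1} s \<partial>lborel)
    \<le> (\<integral>\<^sup>+ s. ennreal ?c * (ennreal (pos_powr (s - y) (- 5/8)) * indicator {0..1} s) \<partial>lborel)"
  proof (rule nn_integral_mono)
    fix s :: real
    show "ennreal (pos_powr (s - x) \<gamma> * pos_powr (s - y) \<gamma>') * indicator {0..1} s
      \<le> ennreal ?c * (ennreal (pos_powr (s - y) (- 5/8)) * indicator {0..1} s)"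
    proof (cases "s \<in> {0..1}")
      case True
      have "pos_powr (s - x) \<gamma> * pos_powr (s - y) \<gamma>' \<le> real (Suc i) powr \<gamma> * (2 * pos_powr (s - y) (- 5/8))"
        using cell_powr_bounds(2)[OF x True \<gamma>(1)] True y \<gamma>
        by (intro mult_mono pos_powr_le_uniform) (auto simp: pos_powr_nonneg)
      then show ?thesis using True by (simp add: ennreal_mult'[symmetric] ennreal_leI mult.assoc)
    qed simp
  qed
  also have "\<dots> = ennreal ?c * (\<integral>\<^sup>+ s. ennreal (pos_powr (s - y) (- 5/8)) * indicator {0..1} s \<partial>lborel)"
    by (rule nn_integral_cmult) measurable
  also have "\<dots> \<le> ennreal ?c * power_mass (- 5/8)"
    by (intro mult_left_mono nn_integral_pos_powr y) simp
  also have "\<dots> = ennreal ?c * ennreal (enn2real (power_mass (- 5/8)))"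
    using power_mass_finite[of "- 5/8"] by (simp add: ennreal_enn2real_if)
  also have "\<dots> = ennreal (real (Suc i) powr \<gamma> * (2 * enn2real (power_mass (- 5/8))))"
    by (simp add: ennreal_mult'[symmetric] mult.assoc)
  finally show "(\<integral>\<^sup>+ s. ennreal (pos_powr (s - x) \<gamma> * pos_powr (s - y) \<gamma>') * indicator {0..1} s \<partial>lborel)
    \<le> ennreal (real (Suc i) powr \<gamma> * (2 * enn2real (power_mass (- 5/8))))" .
qed simp

text \<open>Of the two singular factors the one with the smaller coordinate is at most
  \<open>v powr (- 5/16) * \<bar>x - y\<bar> powr (- 5/16)\<close>, where \<open>v\<close> is the distance of \<open>s\<close> from the larger
  coordinate. This leaves the integrable power \<open>v powr (- 15/16)\<close> and a bound whose square is
  integrable across the diagonal.\<close>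

lemma kernel_near_near:
  assumes x: "- 1 < x" and y: "- 1 < y" and xy: "x \<noteq> y"
    and \<gamma>: "- 5/8 \<le> \<gamma>" "\<gamma> < - 1/2" "- 5/8 \<le> \<gamma>'" "\<gamma>' < - 1/2"
  shows "rosenblatt_kernel \<gamma> \<gamma>' (x, y) \<le> \<bar>x - y\<bar> powr (- 5/16) * (4 * enn2real (power_mass (- 15/16)))"
proof (rule rosenblatt_kernel_le)
  define m where "m = max x y"
  let ?d = "\<bar>x - y\<bar>"
  let ?c = "?d powr (- 5/16) * 4"
  have prod: "pos_powr (s - x) (- 5/8) * pos_powr (s - y) (- 5/8) \<le> ?d powr (- 5/16) * pos_powr (s - m) (- 15/16)" for s
  proof (cases "s > m")
    case True
    \<comment> \<open>the factor with the larger coordinate is \<open>v powr (- 5/8)\<close>, the other one is \<open>(v + \<bar>x - y\<bar>) powr (- 5/8)\<close>\<close>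
    define v where "v = s - m"
    have v: "v > 0" using True by (simp add: v_def)
    have d: "?d > 0" using xy by simp
    have "pos_powr (s - x) (- 5/8) * pos_powr (s - y) (- 5/8) = v powr (- 5/8) * (v + ?d) powr (- 5/8)"
      using v d unfolding v_def m_def pos_powr_def by (cases "x \<le> y") (auto simp: max_def abs_if)
    also have "(v + ?d) powr (- 5/8) = (v + ?d) powr (- 5/16) * (v + ?d) powr (- 5/16)"
      by (simp add: powr_add[symmetric])
    also have "v powr (- 5/8) * ((v + ?d) powr (- 5/16) * (v + ?d) powr (- 5/16)) \<le> v powr (- 5/8) * (v powr (- 5/16) * ?d powr (- 5/16))"
      using v d by (intro mult_left_mono mult_mono powr_mono2') auto
    also have "\<dots> = ?d powr (- 5/16) * v powr (- 15/16)"
      by (simp add: mult.assoc[symmetric] powr_add[symmetric] mult.commute)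
    finally show ?thesis using v by (simp add: pos_powr_def v_def)
  next
    case False
    then show ?thesis by (auto simp: pos_powr_def m_def)
  qed
  have "(\<integral>\<^sup>+ s. ennreal (pos_powr (s - x) \<gamma> * pos_powr (s - y) \<gamma>') * indicator {0..1} s \<partial>lborel)
    \<le> (\<integral>\<^sup>+ s. ennreal ?c * (ennreal (pos_powr (s - m) (- 15/16)) * indicator {0..1} s) \<partial>lborel)"
  proof (rule nn_integral_mono)
    fix s :: real
    show "ennreal (pos_powr (s - x) \<gamma> * pos_powr (s - y) \<gamma>') * indicator {0..1} s
      \<le> ennreal ?c * (ennreal (pos_powr (s - m) (- 15/16)) * indicator {0..1} s)"
    proof (cases "s \<in> {0..1}")
      case True
      have "pos_powr (s - x) \<gamma> * pos_powr (s - y) \<gamma>' \<le> (2 * pos_powr (s - x) (- 5/8)) * (2 * pos_powr (s - y) (- 5/8))"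
        using True x y \<gamma> by (intro mult_mono pos_powr_le_uniform) (auto simp: pos_powr_nonneg)
      also have "\<dots> = 4 * (pos_powr (s - x) (- 5/8) * pos_powr (s - y) (- 5/8))" by simp
      also have "\<dots> \<le> 4 * (?d powr (- 5/16) * pos_powr (s - m) (- 15/16))" by (intro mult_left_mono prod) simp
      finally show ?thesis using True 
        by (simp add: ennreal_mult'[symmetric] pos_powr_nonneg ennreal_leI mult_ac)
    qed simp
  qed
  also have "\<dots> = ennreal ?c * (\<integral>\<^sup>+ s. ennreal (pos_powr (s - m) (- 15/16)) * indicator {0..1} s \<partial>lborel)"
    by (rule nn_integral_cmult) measurable
  also have "\<dots> \<le> ennreal ?c * power_mass (- 15/16)"
    by (intro mult_left_mono nn_integral_pos_powr) (use x in \<open>auto simp: m_def\<close>)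
  also have "\<dots> = ennreal ?c * ennreal (enn2real (power_mass (- 15/16)))"
    using power_mass_finite[of "- 15/16"] by (simp add: ennreal_enn2real_if)
  also have "\<dots> = ennreal (?d powr (- 5/16) * (4 * enn2real (power_mass (- 15/16))))"
    by (simp add: ennreal_mult'[symmetric] mult.assoc)
  finally show "(\<integral>\<^sup>+ s. ennreal (pos_powr (s - x) \<gamma> * pos_powr (s - y) \<gamma>') * indicator {0..1} s \<partial>lborel)
    \<le> ennreal (?d powr (- 5/16) * (4 * enn2real (power_mass (- 15/16))))" .
qed simp

section \<open>Distance of the kernel from its product part\<close>

definition near_mass :: "real \<Rightarrow> ennreal" where
  "near_mass u = ennreal (\<bar>u\<bar> powr (- 5/8)) * indicator {- 2<..<2} u"

lemma near_mass_measurable [measurable]: "near_mass \<in> borel_measurable borel"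
  unfolding near_mass_def[abs_def] by measurable

lemma near_mass_finite: "(\<integral>\<^sup>+ u. near_mass u \<partial>lborel) < \<infinity>"
proof -
  let ?g = "\<lambda>u. ennreal (u powr (- 5/8)) * indicator {0<..<2::real} u"
  have "(\<integral>\<^sup>+ u. near_mass u \<partial>lborel) \<le> (\<integral>\<^sup>+ u. ?g u + ?g (0 - u) \<partial>lborel)"
  proof (rule nn_integral_mono)
    fix u :: real
    consider "u > 0" | "u = 0" | "u < 0" by linarith
    then show "near_mass u \<le> ?g u + ?g (0 - u)"
      by cases (auto simp: near_mass_def indicator_def)
  qed
  also have "\<dots> = (\<integral>\<^sup>+ u. ?g u \<partial>lborel) + (\<integral>\<^sup>+ u. ?g (0 - u) \<partial>lborel)"
    by (rule nn_integral_add) measurable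
  also have "(\<integral>\<^sup>+ u. ?g (0 - u) \<partial>lborel) = (\<integral>\<^sup>+ u. ?g u \<partial>lborel)"
    by (rule nn_integral_translate(2)[of ?g]) measurable
  also have "(\<integral>\<^sup>+ u. ?g u \<partial>lborel) + (\<integral>\<^sup>+ u. ?g u \<partial>lborel) < \<infinity>"
    using power_mass_finite[of "- 5/8"] by (simp add: power_mass_def)
  finally show ?thesis .
qed

lemma power_sum_le_2:
  assumes "\<delta> \<ge> 1"
  shows "(\<Sum>k. ennreal (real (Suc k) powr (- 1 - \<delta>))) \<le> 2"
proof -
  have d: "\<delta> > 0" using assms by simp
  note b = power_sum_bounds[OF d]
  let ?S = "\<Sum>k. real (Suc k) powr (- 1 - \<delta>)"
  have "\<delta> * ?S \<le> \<delta> * 2" using b(3) assms by linarith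
  then have "?S \<le> 2" using d by simp
  moreover have "(\<Sum>k. ennreal (real (Suc k) powr (- 1 - \<delta>))) = ennreal ?S"
    by (rule suminf_ennreal2) (use b(1) in auto)
  ultimately show ?thesis by (metis ennreal_leI ennreal_numeral)
qed

text \<open>Each factor loses one power when its argument is shifted by 2; since
  \<open>\<gamma> - 1 \<le> - 3/2\<close>, the squares are summable in that variable.\<close>

lemma product_powr_difference:
  fixes a b \<gamma> \<gamma>' :: real
  assumes ab: "1 \<le> a" "1 \<le> b" and \<gamma>: "- 1 \<le> \<gamma>" "\<gamma> < - 1/2" "- 1 \<le> \<gamma>'" "\<gamma>' < - 1/2"
    and f: "(a + 2) powr \<gamma> * (b + 2) powr \<gamma>' \<le> f" "f \<le> a powr \<gamma> * b powr \<gamma>'"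
  shows "(f - a powr \<gamma> * b powr \<gamma>')\<^sup>2 \<le> 8 * (a powr (- 3) * b powr (2 * \<gamma>')) + 8 * (a powr (2 * \<gamma>) * b powr (- 3))"
proof -
  have dec: "c powr \<eta> - (c + 2) powr \<eta> \<le> 2 * c powr (- 3/2)"
    if "1 \<le> c" "- 1 \<le> \<eta>" "\<eta> < - 1/2" for c \<eta> :: real
  proof -
    have "c powr \<eta> - (c + 2) powr \<eta> \<le> - \<eta> * (c + 2 - c) * c powr (\<eta> - 1)"
      using that by (intro powr_decrement_bounds(2)) auto
    also have "\<dots> = (- \<eta> * 2) * c powr (\<eta> - 1)" by simp
    also have "\<dots> \<le> 2 * c powr (- 3/2)"
      using that by (intro mult_mono powr_mono) auto
    finally show ?thesis .
  qed
  have le: "(b + 2) powr \<gamma>' \<le> b powr \<gamma>'" "(a + 2) powr \<gamma> \<le> a powr \<gamma>"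
    using ab \<gamma> by (auto intro!: powr_mono2')
  let ?u = "a powr (- 3/2) * b powr \<gamma>'" and ?v = "a powr \<gamma> * b powr (- 3/2)"
  have "a powr \<gamma> * b powr \<gamma>' - f \<le> a powr \<gamma> * b powr \<gamma>' - (a + 2) powr \<gamma> * (b + 2) powr \<gamma>'" using f by simp
  also have "\<dots> = (a powr \<gamma> - (a + 2) powr \<gamma>) * b powr \<gamma>' + (a + 2) powr \<gamma> * (b powr \<gamma>' - (b + 2) powr \<gamma>')"
    by (simp add: algebra_simps)
  also have "\<dots> \<le> (2 * a powr (- 3/2)) * b powr \<gamma>' + a powr \<gamma> * (2 * b powr (- 3/2))"
    using dec[OF ab(1) \<gamma>(1,2)] dec[OF ab(2) \<gamma>(3,4)] le by (intro add_mono mult_mono) auto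
  also have "\<dots> = 2 * ?u + 2 * ?v" by simp
  finally have d: "a powr \<gamma> * b powr \<gamma>' - f \<le> 2 * ?u + 2 * ?v" .
  have "(f - a powr \<gamma> * b powr \<gamma>')\<^sup>2 = (a powr \<gamma> * b powr \<gamma>' - f)\<^sup>2" by (rule power2_commute)
  also have "\<dots> \<le> (2 * ?u + 2 * ?v)\<^sup>2" using d f by (intro power_mono) auto
  also have "\<dots> \<le> 2 * (2 * ?u)\<^sup>2 + 2 * (2 * ?v)\<^sup>2" by (rule power2_sum_le)
  also have "\<dots> = 8 * ?u\<^sup>2 + 8 * ?v\<^sup>2" by (simp add: power_mult_distrib)
  also have "?u\<^sup>2 = a powr (- 3) * b powr (2 * \<gamma>')" using ab by (simp add: power2_eq_square powr_add[symmetric] mult_ac flip: mult.assoc)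
  also have "?v\<^sup>2 = a powr (2 * \<gamma>) * b powr (- 3)" using ab by (simp add: power2_eq_square powr_add[symmetric] mult_ac flip: mult.assoc)
  finally show ?thesis .
qed

definition near :: "real \<Rightarrow> ennreal" where
  "near = indicator {- 1<..<1}"

definition cell_power :: "real \<Rightarrow> real \<Rightarrow> ennreal" where
  "cell_power e = cell_sum (\<lambda>k. real (Suc k) powr e)"

definition c_near :: real where "c_near = 2 * enn2real (power_mass (- 5/8))"
definition c_both :: real where "c_both = 4 * enn2real (power_mass (- 15/16))"

lemma near_measurable [measurable]: "near \<in> borel_measurable borel" unfolding near_def by simp
lemma cell_power_measurable [measurable]: "cell_power e \<in> borel_measurable borel" unfolding cell_power_def by simp

lemma cell_power_ge: "x \<in> cell i \<Longrightarrow> ennreal (real (Suc i) powr e) \<le> cell_power e x"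
  unfolding cell_power_def by (rule cell_sum_ge)

context
  fixes \<gamma> \<gamma>' S :: real and K :: nat
  assumes \<gamma>: "- 5/8 \<le> \<gamma>" "\<gamma> < - 1/2" and \<gamma>': "- 5/8 \<le> \<gamma>'" "\<gamma>' < - 1/2" and S: "1 \<le> S"
    and sums: "(\<Sum>k. ennreal (real (Suc k) powr (2 * \<gamma>))) \<le> ennreal S" "(\<Sum>k. ennreal (real (Suc k) powr (2 * \<gamma>'))) \<le> ennreal S"
    and tails: "(\<Sum>k. ennreal (if k < K then 0 else real (Suc k) powr (2 * \<gamma>))) \<le> 1"
      "(\<Sum>k. ennreal (if k < K then 0 else real (Suc k) powr (2 * \<gamma>'))) \<le> 1"
begin

definition cell_tail :: "real \<Rightarrow> real \<Rightarrow> ennreal" where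
  "cell_tail e = cell_sum (\<lambda>k. if k < K then 0 else real (Suc k) powr e)"

text \<open>One dominating function for each region of the plane. In this order: both coordinates near 0;
  only the second near 0; only the first near 0; both far away in distinct cells of the
  discretization; both in the same cell, where the step function vanishes; the second, or the
  first, coordinate beyond the last cell.\<close>

definition dominating_terms :: "(real \<times> real \<Rightarrow> ennreal) list" where
  "dominating_terms = [
     \<lambda>z. (ennreal (c_both\<^sup>2) * near (fst z)) * near_mass (fst z - snd z),
     \<lambda>z. (ennreal (c_near\<^sup>2) * cell_power (2 * \<gamma>) (fst z)) * near (snd z),
     \<lambda>z. (ennreal (c_near\<^sup>2) * near (fst z)) * cell_power (2 * \<gamma>') (snd z),
     \<lambda>z. (8 * cell_power (- 3) (fst z)) * cell_power (2 * \<gamma>') (snd z) + (8 * cell_power (2 * \<gamma>) (fst z)) * cell_power (- 3) (snd z),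
     \<lambda>z. cell_power (- 2) (fst z) * indicator {- 1..1} (fst z - snd z),
     \<lambda>z. cell_power (2 * \<gamma>) (fst z) * cell_tail (2 * \<gamma>') (snd z),
     \<lambda>z. cell_tail (2 * \<gamma>) (fst z) * cell_power (2 * \<gamma>') (snd z)]"

lemma cell_tail_measurable [measurable]: "cell_tail e \<in> borel_measurable borel" unfolding cell_tail_def by simp

lemma cell_tail_ge: "x \<in> cell i \<Longrightarrow> K \<le> i \<Longrightarrow> ennreal (real (Suc i) powr e) \<le> cell_tail e x"
  unfolding cell_tail_def using cell_sum_ge[of x i "\<lambda>k. if k < K then 0 else real (Suc k) powr e"] by simp

lemma kernel_step_pointwise:
  assumes xy: "x \<noteq> y"
  shows "ennreal ((rosenblatt_kernel \<gamma> \<gamma>' (x, y) - step_fun (cell_rectangles \<gamma> \<gamma>' K) (x, y))\<^sup>2)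
    \<le> (\<Sum>T\<leftarrow>dominating_terms. T (x, y))"
proof -
  let ?f = "rosenblatt_kernel \<gamma> \<gamma>' (x, y)" and ?h = "step_fun (cell_rectangles \<gamma> \<gamma>' K) (x, y)"
  have g0: "\<gamma> < 0" "\<gamma>' < 0" using \<gamma> \<gamma>' by auto
  have f0: "0 \<le> ?f" by (rule rosenblatt_kernel_nonneg)
  have by_term: "ennreal ((?f - ?h)\<^sup>2) \<le> (\<Sum>T\<leftarrow>dominating_terms. T (x, y))"
    if "T \<in> set dominating_terms" "ennreal ((?f - ?h)\<^sup>2) \<le> T (x, y)" for T
  proof -
    have "T (x, y) \<in> set (map (\<lambda>T. T (x, y)) dominating_terms)" using that(1) by auto
    then have "T (x, y) \<le> (\<Sum>T\<leftarrow>dominating_terms. T (x, y))"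
      by (intro member_le_sum_list) auto
    with that(2) show ?thesis by (rule order_trans)
  qed
  consider (zero) "x \<ge> 1 \<or> y \<ge> 1" | (nn) "- 1 < x" "x < 1" "- 1 < y" "y < 1" | (fn) "x \<le> - 1" "- 1 < y" "y < 1"
    | (nf) "- 1 < x" "x < 1" "y \<le> - 1" | (ff) "x \<le> - 1" "y \<le> - 1" by linarith
  then show ?thesis
  proof cases
    case zero
    then have "?f = 0" by (rule rosenblatt_kernel_zero)
    moreover have "?h = 0" using zero by (intro step_fun_cell_rectangles_out) auto
    ultimately show ?thesis by simp
  next
    case nn
    have h: "?h = 0" using nn by (intro step_fun_cell_rectangles_out) auto
    have "?f \<le> \<bar>x - y\<bar> powr (- 5/16) * c_both"
      unfolding c_both_def using nn xy \<gamma> \<gamma>' by (intro kernel_near_near) auto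
    then have "?f\<^sup>2 \<le> (\<bar>x - y\<bar> powr (- 5/16) * c_both)\<^sup>2" using f0 by (intro power_mono)
    also have "\<dots> = c_both\<^sup>2 * \<bar>x - y\<bar> powr (- 5/8)"
      using xy by (simp add: power_mult_distrib power2_eq_square[of "_ powr _"] powr_add[symmetric] mult.commute)
    finally have "ennreal (?f\<^sup>2) \<le> ennreal (c_both\<^sup>2 * \<bar>x - y\<bar> powr (- 5/8))" by (rule ennreal_leI)
    also have "\<dots> = (ennreal (c_both\<^sup>2) * near (fst (x, y))) * near_mass (fst (x, y) - snd (x, y))"
      using nn by (simp add: ennreal_mult near_def near_mass_def)
    finally show ?thesis
      by (intro by_term[where T="\<lambda>z. (ennreal (c_both\<^sup>2) * near (fst z)) * near_mass (fst z - snd z)"])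
         (simp_all only: h diff_zero dominating_terms_def list.set insert_iff simp_thms)
  next
    case fn
    obtain i where i: "x \<in> cell i" using obtain_cell[OF fn(1)] .
    have h: "?h = 0" using fn by (intro step_fun_cell_rectangles_out) auto
    have "?f \<le> real (Suc i) powr \<gamma> * c_near"
      unfolding c_near_def using i fn g0 \<gamma>' by (intro kernel_far_near) auto
    then have "?f\<^sup>2 \<le> (real (Suc i) powr \<gamma> * c_near)\<^sup>2" using f0 by (intro power_mono)
    also have "\<dots> = c_near\<^sup>2 * real (Suc i) powr (2 * \<gamma>)"
      by (simp add: power_mult_distrib power2_eq_square[of "_ powr _"] powr_add[symmetric] mult.commute)
    finally have "ennreal (?f\<^sup>2) \<le> ennreal (c_near\<^sup>2) * ennreal (real (Suc i) powr (2 * \<gamma>))"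
      by (simp add: ennreal_mult[symmetric] ennreal_leI)
    also have "\<dots> \<le> ennreal (c_near\<^sup>2) * cell_power (2 * \<gamma>) x" by (intro mult_left_mono cell_power_ge i) simp
    also have "\<dots> = (ennreal (c_near\<^sup>2) * cell_power (2 * \<gamma>) (fst (x, y))) * near (snd (x, y))"
      using fn by (simp add: near_def)
    finally show ?thesis
      by (intro by_term[where T="\<lambda>z. (ennreal (c_near\<^sup>2) * cell_power (2 * \<gamma>) (fst z)) * near (snd z)"])
         (simp_all only: h diff_zero dominating_terms_def list.set insert_iff simp_thms)
  next
    case nf
    obtain j where j: "y \<in> cell j" using obtain_cell[OF nf(3)] .
    have h: "?h = 0" using nf by (intro step_fun_cell_rectangles_out) auto
    have "?f \<le> real (Suc j) powr \<gamma>' * c_near"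
      unfolding c_near_def rosenblatt_kernel_commute[of \<gamma>] using j nf g0 \<gamma> by (intro kernel_far_near) auto
    then have "?f\<^sup>2 \<le> (real (Suc j) powr \<gamma>' * c_near)\<^sup>2" using f0 by (intro power_mono)
    also have "\<dots> = c_near\<^sup>2 * real (Suc j) powr (2 * \<gamma>')"
      by (simp add: power_mult_distrib power2_eq_square[of "_ powr _"] powr_add[symmetric] mult.commute)
    finally have "ennreal (?f\<^sup>2) \<le> ennreal (c_near\<^sup>2) * ennreal (real (Suc j) powr (2 * \<gamma>'))"
      by (simp add: ennreal_mult[symmetric] ennreal_leI)
    also have "\<dots> \<le> ennreal (c_near\<^sup>2) * cell_power (2 * \<gamma>') y" by (intro mult_left_mono cell_power_ge j) simp
    also have "\<dots> = (ennreal (c_near\<^sup>2) * near (fst (x, y))) * cell_power (2 * \<gamma>') (snd (x, y))"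
      using nf by (simp add: near_def)
    finally show ?thesis
      by (intro by_term[where T="\<lambda>z. (ennreal (c_near\<^sup>2) * near (fst z)) * cell_power (2 * \<gamma>') (snd z)"])
         (simp_all only: h diff_zero dominating_terms_def list.set insert_iff simp_thms)
  next
    case ff
    obtain i where i: "x \<in> cell i" using obtain_cell[OF ff(1)] .
    obtain j where j: "y \<in> cell j" using obtain_cell[OF ff(2)] .
    let ?a = "real (Suc i)" and ?b = "real (Suc j)"
    note f = kernel_far_far[OF i j g0]
    note h = step_fun_cell_rectangles_in[OF i j, of \<gamma> \<gamma>' K]
    have sq: "?f\<^sup>2 \<le> ?a powr (2 * \<gamma>) * ?b powr (2 * \<gamma>')"
    proof -
      have "?f\<^sup>2 \<le> (?a powr \<gamma> * ?b powr \<gamma>')\<^sup>2" using f f0 by (intro power_mono)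
      also have "\<dots> = ?a powr (2 * \<gamma>) * ?b powr (2 * \<gamma>')"
        unfolding power_mult_distrib by (simp add: power2_eq_square powr_add[symmetric])
      finally show ?thesis .
    qed
    show ?thesis
    proof (cases "i = j")
      case True
      then have h0: "?h = 0" using h by simp
      have "?a powr (2 * \<gamma>) * ?b powr (2 * \<gamma>') = ?a powr (2 * \<gamma> + 2 * \<gamma>')" using True by (simp add: powr_add)
      also have "\<dots> \<le> ?a powr (- 2)" using \<gamma> \<gamma>' by (intro powr_mono) auto
      finally have "?f\<^sup>2 \<le> ?a powr (- 2)" using sq by linarith
      then have "ennreal (?f\<^sup>2) \<le> ennreal (?a powr (- 2))" by (rule ennreal_leI)
      also have "\<dots> \<le> cell_power (- 2) x" by (rule cell_power_ge[OF i])
      also have "\<dots> = cell_power (- 2) (fst (x, y)) * indicator {- 1..1} (fst (x, y) - snd (x, y))"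
        using i j True by (simp add: cell_def)
      finally show ?thesis
        by (intro by_term[where T="\<lambda>z. cell_power (- 2) (fst z) * indicator {- 1..1} (fst z - snd z)"])
           (simp_all only: h0 diff_zero dominating_terms_def list.set insert_iff simp_thms)
    next
      case ij: False
      consider (main) "i < K" "j < K" | (itail) "K \<le> i" | (jtail) "K \<le> j" by linarith
      then show ?thesis
      proof cases
        case main
        then have h': "?h = ?a powr \<gamma> * ?b powr \<gamma>'" using h ij by simp
        have "(?f - ?h)\<^sup>2 \<le> 8 * (?a powr (- 3) * ?b powr (2 * \<gamma>')) + 8 * (?a powr (2 * \<gamma>) * ?b powr (- 3))"
          unfolding h' by (rule product_powr_difference) (use \<gamma> \<gamma>' f in \<open>auto simp: add_ac\<close>)
        then have "ennreal ((?f - ?h)\<^sup>2) \<le> ennreal (8 * (?a powr (- 3) * ?b powr (2 * \<gamma>')) + 8 * (?a powr (2 * \<gamma>) * ?b powr (- 3)))"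
          by (rule ennreal_leI)
        also have "\<dots> = (8 * ennreal (?a powr (- 3))) * ennreal (?b powr (2 * \<gamma>')) + (8 * ennreal (?a powr (2 * \<gamma>))) * ennreal (?b powr (- 3))"
          by (simp add: ennreal_mult mult.assoc)
        also have "\<dots> \<le> (8 * cell_power (- 3) x) * cell_power (2 * \<gamma>') y + (8 * cell_power (2 * \<gamma>) x) * cell_power (- 3) y"
          by (intro add_mono mult_mono cell_power_ge i j order_refl) auto
        also have "\<dots> = (\<lambda>z. (8 * cell_power (- 3) (fst z)) * cell_power (2 * \<gamma>') (snd z) + (8 * cell_power (2 * \<gamma>) (fst z)) * cell_power (- 3) (snd z)) (x, y)"
          by simp
        finally show ?thesis by (rule by_term[rotated]) (simp only: dominating_terms_def list.set insert_iff simp_thms)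
      next
        case itail
        then have h0: "?h = 0" using h by simp
        have "ennreal (?f\<^sup>2) \<le> ennreal (?a powr (2 * \<gamma>)) * ennreal (?b powr (2 * \<gamma>'))"
          using ennreal_leI[OF sq] by (simp add: ennreal_mult)
        also have "\<dots> \<le> cell_tail (2 * \<gamma>) x * cell_power (2 * \<gamma>') y"
          by (intro mult_mono cell_power_ge cell_tail_ge i j itail) auto
        also have "\<dots> = (\<lambda>z. cell_tail (2 * \<gamma>) (fst z) * cell_power (2 * \<gamma>') (snd z)) (x, y)" by simp
        finally have "ennreal ((?f - ?h)\<^sup>2) \<le> (\<lambda>z. cell_tail (2 * \<gamma>) (fst z) * cell_power (2 * \<gamma>') (snd z)) (x, y)"
          unfolding h0 diff_zero .
        then show ?thesis by (rule by_term[rotated]) (simp only: dominating_terms_def list.set insert_iff simp_thms)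
      next
        case jtail
        then have h0: "?h = 0" using h by simp
        have "ennreal (?f\<^sup>2) \<le> ennreal (?a powr (2 * \<gamma>)) * ennreal (?b powr (2 * \<gamma>'))"
          using ennreal_leI[OF sq] by (simp add: ennreal_mult)
        also have "\<dots> \<le> cell_power (2 * \<gamma>) x * cell_tail (2 * \<gamma>') y"
          by (intro mult_mono cell_power_ge cell_tail_ge i j jtail) auto
        also have "\<dots> = (\<lambda>z. cell_power (2 * \<gamma>) (fst z) * cell_tail (2 * \<gamma>') (snd z)) (x, y)" by simp
        finally have "ennreal ((?f - ?h)\<^sup>2) \<le> (\<lambda>z. cell_power (2 * \<gamma>) (fst z) * cell_tail (2 * \<gamma>') (snd z)) (x, y)"
          unfolding h0 diff_zero .
        then show ?thesis by (rule by_term[rotated]) (simp only: dominating_terms_def list.set insert_iff simp_thms)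
      qed
    qed
  qed
qed

lemma dominating_terms_integral:
  "(\<integral>\<^sup>+ z. (\<Sum>T\<leftarrow>dominating_terms. T z) \<partial>lborel) \<le>
    ennreal (c_both\<^sup>2) * 2 * (\<integral>\<^sup>+ u. near_mass u \<partial>lborel) + ennreal (c_near\<^sup>2) * ennreal S * 2
    + ennreal (c_near\<^sup>2) * 2 * ennreal S + (8 * 2 * ennreal S + 8 * ennreal S * 2) + 2 * 2 + ennreal S * 1 + 1 * ennreal S"
proof -
  have [measurable]: "(\<lambda>z :: real \<times> real. F (fst z) * G (snd z)) \<in> borel_measurable borel"
    if [measurable]: "F \<in> borel_measurable borel" "G \<in> borel_measurable borel" for F G :: "real \<Rightarrow> ennreal"
    unfolding borel_prod[symmetric] by measurable
  have [measurable]: "(\<lambda>z :: real \<times> real. F (fst z) * G (fst z - snd z)) \<in> borel_measurable borel"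
    if [measurable]: "F \<in> borel_measurable borel" "G \<in> borel_measurable borel" for F G :: "real \<Rightarrow> ennreal"
    unfolding borel_prod[symmetric] by measurable
  have tc: "(\<integral>\<^sup>+ z. (c * F (fst z)) * G (snd z) \<partial>lborel) = c * (\<integral>\<^sup>+ x. F x \<partial>lborel) * (\<integral>\<^sup>+ x. G x \<partial>lborel)"
    if [measurable]: "F \<in> borel_measurable borel" "G \<in> borel_measurable borel" for c :: ennreal and F G :: "real \<Rightarrow> ennreal"
    using nn_integral_tensor[of "\<lambda>x. c * F x" G] by (simp add: nn_integral_cmult)
  have cc: "(\<integral>\<^sup>+ z. (c * F (fst z)) * G (fst z - snd z) \<partial>lborel) = c * (\<integral>\<^sup>+ x. F x \<partial>lborel) * (\<integral>\<^sup>+ x. G x \<partial>lborel)"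
    if [measurable]: "F \<in> borel_measurable borel" "G \<in> borel_measurable borel" for c :: ennreal and F G :: "real \<Rightarrow> ennreal"
    using nn_integral_convolution[of "\<lambda>x. c * F x" G] by (simp add: nn_integral_cmult)
  have n: "(\<integral>\<^sup>+ x. near x \<partial>lborel) = 2" by (simp add: near_def)
  have u: "(\<integral>\<^sup>+ u. indicator {- 1..1::real} u \<partial>lborel) = (2 :: ennreal)" by simp
  have p: "(\<integral>\<^sup>+ x. cell_power (2 * \<gamma>) x \<partial>lborel) \<le> ennreal S" "(\<integral>\<^sup>+ x. cell_power (2 * \<gamma>') x \<partial>lborel) \<le> ennreal S"
    unfolding cell_power_def nn_integral_cell_sum by (rule sums)+
  have t: "(\<integral>\<^sup>+ x. cell_tail (2 * \<gamma>) x \<partial>lborel) \<le> 1" "(\<integral>\<^sup>+ x. cell_tail (2 * \<gamma>') x \<partial>lborel) \<le> 1"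
    unfolding cell_tail_def nn_integral_cell_sum by (rule tails)+
  have e: "- 1 - 2 = (- 3 :: real)" "- 1 - 1 = (- 2 :: real)" by simp_all
  have q3: "(\<integral>\<^sup>+ x. cell_power (- 3) x \<partial>lborel) \<le> 2"
    unfolding cell_power_def nn_integral_cell_sum by (rule power_sum_le_2[of 2, unfolded e]) simp
  have q2: "(\<integral>\<^sup>+ x. cell_power (- 2) x \<partial>lborel) \<le> 2"
    unfolding cell_power_def nn_integral_cell_sum by (rule power_sum_le_2[of 1, unfolded e]) simp
  have "(\<integral>\<^sup>+ z. (\<Sum>T\<leftarrow>dominating_terms. T z) \<partial>lborel) =
    ennreal (c_both\<^sup>2) * (\<integral>\<^sup>+ x. near x \<partial>lborel) * (\<integral>\<^sup>+ u. near_mass u \<partial>lborel)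
    + ennreal (c_near\<^sup>2) * (\<integral>\<^sup>+ x. cell_power (2 * \<gamma>) x \<partial>lborel) * (\<integral>\<^sup>+ x. near x \<partial>lborel)
    + ennreal (c_near\<^sup>2) * (\<integral>\<^sup>+ x. near x \<partial>lborel) * (\<integral>\<^sup>+ x. cell_power (2 * \<gamma>') x \<partial>lborel)
    + (8 * (\<integral>\<^sup>+ x. cell_power (- 3) x \<partial>lborel) * (\<integral>\<^sup>+ x. cell_power (2 * \<gamma>') x \<partial>lborel)
       + 8 * (\<integral>\<^sup>+ x. cell_power (2 * \<gamma>) x \<partial>lborel) * (\<integral>\<^sup>+ x. cell_power (- 3) x \<partial>lborel))
    + (\<integral>\<^sup>+ x. cell_power (- 2) x \<partial>lborel) * (\<integral>\<^sup>+ u. indicator {- 1..1::real} u \<partial>lborel)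
    + (\<integral>\<^sup>+ x. cell_power (2 * \<gamma>) x \<partial>lborel) * (\<integral>\<^sup>+ x. cell_tail (2 * \<gamma>') x \<partial>lborel)
    + (\<integral>\<^sup>+ x. cell_tail (2 * \<gamma>) x \<partial>lborel) * (\<integral>\<^sup>+ x. cell_power (2 * \<gamma>') x \<partial>lborel)"
    unfolding dominating_terms_def
    by (simp add: nn_integral_add nn_integral_tensor nn_integral_convolution tc cc add.assoc
        del: nn_integral_indicator)
  also have "\<dots> \<le> ennreal (c_both\<^sup>2) * 2 * (\<integral>\<^sup>+ u. near_mass u \<partial>lborel) + ennreal (c_near\<^sup>2) * ennreal S * 2
    + ennreal (c_near\<^sup>2) * 2 * ennreal S + (8 * 2 * ennreal S + 8 * ennreal S * 2) + 2 * 2 + ennreal S * 1 + 1 * ennreal S"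
    unfolding n u by (intro add_mono mult_mono p t q2 q3 order_refl) auto
  finally show ?thesis .
qed

lemma kernel_step_distance:
  "(\<integral>\<^sup>+ z. ennreal ((rosenblatt_kernel \<gamma> \<gamma>' z - step_fun (cell_rectangles \<gamma> \<gamma>' K) z)\<^sup>2) \<partial>lborel)
    \<le> ennreal ((c_both\<^sup>2 * 2 * enn2real (\<integral>\<^sup>+ u. near_mass u \<partial>lborel) + 4 * c_near\<^sup>2 + 38) * S)"
proof -
  define I where "I = enn2real (\<integral>\<^sup>+ u. near_mass u \<partial>lborel)"
  have I0: "0 \<le> I" by (simp add: I_def)
  have I: "(\<integral>\<^sup>+ u. near_mass u \<partial>lborel) = ennreal I"
    unfolding I_def using near_mass_finite by (simp add: ennreal_enn2real_if)
  have "(\<integral>\<^sup>+ z. ennreal ((rosenblatt_kernel \<gamma> \<gamma>' z - step_fun (cell_rectangles \<gamma> \<gamma>' K) z)\<^sup>2) \<partial>lborel)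
      \<le> (\<integral>\<^sup>+ z. (\<Sum>T\<leftarrow>dominating_terms. T z) \<partial>lborel)"
  proof (rule nn_integral_mono_AE, use diagonal_null in eventually_elim)
    case (elim z)
    then show ?case using kernel_step_pointwise[of "fst z" "snd z"] by simp
  qed
  also note dominating_terms_integral
  also have "ennreal (c_both\<^sup>2) * 2 * (\<integral>\<^sup>+ u. near_mass u \<partial>lborel) + ennreal (c_near\<^sup>2) * ennreal S * 2
    + ennreal (c_near\<^sup>2) * 2 * ennreal S + (8 * 2 * ennreal S + 8 * ennreal S * 2) + 2 * 2 + ennreal S * 1 + 1 * ennreal S
    = ennreal (c_both\<^sup>2 * 2 * I + c_near\<^sup>2 * S * 2 + c_near\<^sup>2 * 2 * S + (8 * 2 * S + 8 * S * 2) + 2 * 2 + S * 1 + 1 * S)"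
    unfolding I using S I0
    by (simp add: ennreal_mult'[symmetric] ennreal_plus[symmetric] flip: ennreal_numeral del: ennreal_plus)
  also have "\<dots> \<le> ennreal ((c_both\<^sup>2 * 2 * I + 4 * c_near\<^sup>2 + 38) * S)"
  proof (rule ennreal_leI)
    have "c_both\<^sup>2 * 2 * I * 1 \<le> c_both\<^sup>2 * 2 * I * S" using S I0 by (intro mult_left_mono) auto
    then show "c_both\<^sup>2 * 2 * I + c_near\<^sup>2 * S * 2 + c_near\<^sup>2 * 2 * S + (8 * 2 * S + 8 * S * 2) + 2 * 2 + S * 1 + 1 * S
       \<le> (c_both\<^sup>2 * 2 * I + 4 * c_near\<^sup>2 + 38) * S"
      using S by (simp add: algebra_simps)
  qed
  finally show ?thesis unfolding I_def .
qed

end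

section \<open>Coupling two quadratic forms\<close>

lemma (in prob_space) indep_centred_normal:
  assumes ind: "indep_vars (\<lambda>_. borel) X {..<n}"
    and D: "\<And>i. i < n \<Longrightarrow> distributed M lborel (X i) std_normal_density"
  shows "indep_centred M X n (\<lambda>_. 1)" and "\<And>i. i < n \<Longrightarrow> expectation (\<lambda>\<omega>. X i \<omega> ^ 4) = 3"
proof -
  show "indep_centred M X n (\<lambda>_. 1)"
  proof
    fix i k assume i: "i < n"
    show "integrable M (\<lambda>\<omega>. X i \<omega> ^ k)"
      using integrable_std_normal_moment[of k] distributed_integrable[OF D[OF i], of "\<lambda>x. x ^ k"] by simp
    show "expectation (X i) = 0" by (rule standard_normal_distributed_expectation[OF D[OF i]])
    then show "expectation (\<lambda>\<omega>. (X i \<omega>)\<^sup>2) = 1"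
      using standard_normal_distributed_variance[OF D[OF i]] by simp
  qed (rule ind)
  fix i assume i: "i < n"
  have "expectation (\<lambda>\<omega>. X i \<omega> ^ 4) = (\<integral>x. std_normal_density x * x ^ 4 \<partial>lborel)"
    using distributed_integral[OF D[OF i], of "\<lambda>x. x ^ 4"] by simp
  also have "\<dots> = 3" using integral_std_normal_moment_even[of 2] by (simp add: fact_numeral)
  finally show "expectation (\<lambda>\<omega>. X i \<omega> ^ 4) = 3" .
qed

text \<open>The Gram--Schmidt procedure for the coefficient vectors \<open>x\<close> and \<open>y\<close>.\<close>

lemma orthonormalise:
  fixes x y :: "nat \<Rightarrow> real" and n :: nat
  defines "s \<equiv> \<Sum>i<n. (x i)\<^sup>2" and "t \<equiv> \<Sum>i<n. x i * y i" and "u \<equiv> \<Sum>i<n. (y i)\<^sup>2"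
  assumes D: "s * u - t\<^sup>2 > 0"
  obtains e f where "(\<Sum>i<n. (e i)\<^sup>2) = 1" "(\<Sum>i<n. (f i)\<^sup>2) = 1" "(\<Sum>i<n. e i * f i) = 0"
    "\<And>\<xi>. (\<Sum>i<n. x i * \<xi> i) * (\<Sum>i<n. y i * \<xi> i) =
        t * (\<Sum>i<n. e i * \<xi> i)\<^sup>2 + sqrt (s * u - t\<^sup>2) * ((\<Sum>i<n. e i * \<xi> i) * (\<Sum>i<n. f i * \<xi> i))"
proof -
  have "s \<ge> 0" unfolding s_def by (intro sum_nonneg) auto
  moreover have "s \<noteq> 0" using D by (auto simp: not_less)
  ultimately have s: "s > 0" by simp
  define d where "d = sqrt (s * u - t\<^sup>2)"
  have d: "d > 0" "d\<^sup>2 = s * u - t\<^sup>2" using D by (simp_all add: d_def)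
  define e where "e i = x i / sqrt s" for i
  define f where "f i = (s * y i - t * x i) / (sqrt s * d)" for i
  have ee: "(\<Sum>i<n. (e i)\<^sup>2) = 1"
    using s unfolding e_def power_divide by (simp add: sum_divide_distrib[symmetric] s_def)
  have "(\<Sum>i<n. (s * y i - t * x i)\<^sup>2) = (\<Sum>i<n. s\<^sup>2 * (y i)\<^sup>2 + t\<^sup>2 * (x i)\<^sup>2 - 2 * s * t * (x i * y i))"
    by (intro sum.cong refl) (simp add: power2_diff power_mult_distrib mult_ac)
  also have "\<dots> = s\<^sup>2 * u + t\<^sup>2 * s - 2 * s * t * t"
    unfolding sum.distrib sum_subtractf sum_distrib_left[symmetric] s_def[symmetric] t_def[symmetric] u_def[symmetric] ..
  also have "\<dots> = s * d\<^sup>2" unfolding d(2) by (simp add: power2_eq_square algebra_simps)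
  finally have ff: "(\<Sum>i<n. (f i)\<^sup>2) = 1"
    using s d(1) unfolding f_def power_divide by (simp add: sum_divide_distrib[symmetric] power_mult_distrib)
  have "(\<Sum>i<n. x i * (s * y i - t * x i)) = (\<Sum>i<n. s * (x i * y i) - t * (x i)\<^sup>2)"
    by (intro sum.cong refl) (simp add: power2_eq_square algebra_simps)
  also have "\<dots> = s * t - t * s"
    unfolding sum_subtractf sum_distrib_left[symmetric] s_def[symmetric] t_def[symmetric] ..
  finally have "(\<Sum>i<n. x i * (s * y i - t * x i)) = 0" by simp
  then have "(\<Sum>i<n. x i * (s * y i - t * x i)) / (sqrt s * (sqrt s * d)) = 0" by simp
  then have ef: "(\<Sum>i<n. e i * f i) = 0"
    unfolding e_def f_def by (simp add: sum_divide_distrib)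
  have id: "(\<Sum>i<n. x i * \<xi> i) * (\<Sum>i<n. y i * \<xi> i) =
        t * (\<Sum>i<n. e i * \<xi> i)\<^sup>2 + d * ((\<Sum>i<n. e i * \<xi> i) * (\<Sum>i<n. f i * \<xi> i))" for \<xi>
  proof -
    define P Q where "P = (\<Sum>i<n. x i * \<xi> i)" and "Q = (\<Sum>i<n. y i * \<xi> i)"
    have E: "(\<Sum>i<n. e i * \<xi> i) = P / sqrt s"
      unfolding e_def P_def by (simp add: sum_divide_distrib)
    have F: "(\<Sum>i<n. f i * \<xi> i) = (s * Q - t * P) / (sqrt s * d)"
      unfolding f_def P_def Q_def
      by (simp add: sum_divide_distrib[symmetric] left_diff_distrib sum_subtractf sum_distrib_left mult.assoc)
    have ss: "sqrt s * sqrt s = s" using s by simp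
    have "d * (P / sqrt s * ((s * Q - t * P) / (sqrt s * d))) = P * (s * Q - t * P) / (sqrt s * sqrt s)"
      using d(1) by simp
    also have "\<dots> = P * Q - t * P\<^sup>2 / s" unfolding ss using s by (simp add: field_simps power2_eq_square)
    finally show ?thesis unfolding E F P_def[symmetric] Q_def[symmetric] using s by (simp add: power_divide)
  qed
  show ?thesis by (rule that[OF ee ff ef]) (use id d_def in simp)
qed

lemma std_normal_pair_moment:
  "(\<integral>\<^sup>+ z. ennreal ((\<alpha> * ((fst z)\<^sup>2 - 1) + \<beta> * (fst z * snd z))\<^sup>2) \<partial>(std_normal_distribution \<Otimes>\<^sub>M std_normal_distribution))
    \<le> ennreal (4 * (\<alpha>\<^sup>2 + \<beta>\<^sup>2))"
proof -
  interpret S: real_distribution std_normal_distribution by (rule real_dist_normal_dist)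
  let ?S = "std_normal_distribution"
  have m2: "(\<integral>\<^sup>+ x. ennreal (x\<^sup>2) \<partial>?S) = 1"
  proof -
    have "(\<integral>\<^sup>+ x. ennreal (x\<^sup>2) \<partial>?S) = ennreal (LINT x|?S. x\<^sup>2)"
      by (rule nn_integral_eq_integral[OF integrable_std_normal_distribution_moment]) simp
    then show ?thesis using std_normal_distribution_even_moments(1)[of 1] by simp
  qed
  have m4: "(\<integral>\<^sup>+ x. ennreal ((x\<^sup>2 - 1)\<^sup>2) \<partial>?S) = 2"
  proof -
    have e: "(x\<^sup>2 - 1)\<^sup>2 = x ^ 4 - 2 * x\<^sup>2 + 1" for x :: real by (simp add: power2_eq_square power4_eq_xxxx algebra_simps)
    have "(\<integral>\<^sup>+ x. ennreal ((x\<^sup>2 - 1)\<^sup>2) \<partial>?S) = ennreal (LINT x|?S. x ^ 4 - 2 * x\<^sup>2 + 1)"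
      unfolding e
    proof (rule nn_integral_eq_integral)
      show "integrable ?S (\<lambda>x. x ^ 4 - 2 * x\<^sup>2 + 1)"
        by (intro Bochner_Integration.integrable_add Bochner_Integration.integrable_diff integrable_mult_right
            integrable_std_normal_distribution_moment) simp
      show "AE x in ?S. 0 \<le> x ^ 4 - 2 * x\<^sup>2 + 1" unfolding e[symmetric] by simp
    qed
    also have "(LINT x|?S. x ^ 4 - 2 * x\<^sup>2 + 1) = (LINT x|?S. x ^ 4) - 2 * (LINT x|?S. x\<^sup>2) + 1"
      using S.prob_space by (simp add: integrable_std_normal_distribution_moment)
    also have "\<dots> = 2"
      using std_normal_distribution_even_moments(1)[of 1] std_normal_distribution_even_moments(1)[of 2] by (simp add: fact_numeral)
    finally show ?thesis by simp
  qed
  have tens: "(\<integral>\<^sup>+ z. F (fst z) * G (snd z) \<partial>(?S \<Otimes>\<^sub>M ?S)) = (\<integral>\<^sup>+ x. F x \<partial>?S) * (\<integral>\<^sup>+ y. G y \<partial>?S)"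
    if [measurable]: "F \<in> borel_measurable borel" "G \<in> borel_measurable borel" for F G :: "real \<Rightarrow> ennreal"
    by (subst S.nn_integral_fst[symmetric]) (simp_all add: nn_integral_cmult nn_integral_multc)
  have "(\<integral>\<^sup>+ z. ennreal ((\<alpha> * ((fst z)\<^sup>2 - 1) + \<beta> * (fst z * snd z))\<^sup>2) \<partial>(?S \<Otimes>\<^sub>M ?S)) \<le>
     (\<integral>\<^sup>+ z. ennreal (2 * \<alpha>\<^sup>2) * (ennreal (((fst z)\<^sup>2 - 1)\<^sup>2) * 1) + ennreal (2 * \<beta>\<^sup>2) * (ennreal ((fst z)\<^sup>2) * ennreal ((snd z)\<^sup>2)) \<partial>(?S \<Otimes>\<^sub>M ?S))"
  proof (rule nn_integral_mono)
    fix z :: "real \<times> real"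
    have "(\<alpha> * ((fst z)\<^sup>2 - 1) + \<beta> * (fst z * snd z))\<^sup>2 \<le> 2 * (\<alpha> * ((fst z)\<^sup>2 - 1))\<^sup>2 + 2 * (\<beta> * (fst z * snd z))\<^sup>2"
      by (rule power2_sum_le)
    also have "\<dots> = 2 * \<alpha>\<^sup>2 * ((fst z)\<^sup>2 - 1)\<^sup>2 + 2 * \<beta>\<^sup>2 * ((fst z)\<^sup>2 * (snd z)\<^sup>2)" by (simp add: power_mult_distrib)
    finally have "ennreal ((\<alpha> * ((fst z)\<^sup>2 - 1) + \<beta> * (fst z * snd z))\<^sup>2) \<le> ennreal (2 * \<alpha>\<^sup>2 * ((fst z)\<^sup>2 - 1)\<^sup>2 + 2 * \<beta>\<^sup>2 * ((fst z)\<^sup>2 * (snd z)\<^sup>2))"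
      by (rule ennreal_leI)
    also have "\<dots> = ennreal (2 * \<alpha>\<^sup>2) * (ennreal (((fst z)\<^sup>2 - 1)\<^sup>2) * 1) + ennreal (2 * \<beta>\<^sup>2) * (ennreal ((fst z)\<^sup>2) * ennreal ((snd z)\<^sup>2))"
      by (simp only: ennreal_plus ennreal_mult' mult_nonneg_nonneg zero_le_power2 zero_le_numeral mult_1_right)
    finally show "ennreal ((\<alpha> * ((fst z)\<^sup>2 - 1) + \<beta> * (fst z * snd z))\<^sup>2) \<le> ennreal (2 * \<alpha>\<^sup>2) * (ennreal (((fst z)\<^sup>2 - 1)\<^sup>2) * 1) + ennreal (2 * \<beta>\<^sup>2) * (ennreal ((fst z)\<^sup>2) * ennreal ((snd z)\<^sup>2))" .
  qed
  also have "\<dots> = ennreal (2 * \<alpha>\<^sup>2) * (\<integral>\<^sup>+ z. ennreal (((fst z)\<^sup>2 - 1)\<^sup>2) * 1 \<partial>(?S \<Otimes>\<^sub>M ?S)) +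
      ennreal (2 * \<beta>\<^sup>2) * (\<integral>\<^sup>+ z. ennreal ((fst z)\<^sup>2) * ennreal ((snd z)\<^sup>2) \<partial>(?S \<Otimes>\<^sub>M ?S))"
    by (subst nn_integral_add, measurable, subst nn_integral_cmult, measurable, subst nn_integral_cmult, measurable)
  also have "(\<integral>\<^sup>+ z. ennreal (((fst z)\<^sup>2 - 1)\<^sup>2) * 1 \<partial>(?S \<Otimes>\<^sub>M ?S)) = 2"
    using tens[of "\<lambda>x. ennreal ((x\<^sup>2 - 1)\<^sup>2)" "\<lambda>_. 1"] m4 S.emeasure_space_1 by simp
  also have "(\<integral>\<^sup>+ z. ennreal ((fst z)\<^sup>2) * ennreal ((snd z)\<^sup>2) \<partial>(?S \<Otimes>\<^sub>M ?S)) = 1"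
    using tens[of "\<lambda>x. ennreal (x\<^sup>2)" "\<lambda>x. ennreal (x\<^sup>2)"] m2 by simp
  also have "ennreal (2 * \<alpha>\<^sup>2) * 2 + ennreal (2 * \<beta>\<^sup>2) * 1 = ennreal (4 * \<alpha>\<^sup>2 + 2 * \<beta>\<^sup>2)"
    by (simp add: ennreal_mult'[symmetric] ennreal_plus[symmetric] flip: ennreal_numeral del: ennreal_plus)
  also have "\<dots> \<le> ennreal (4 * (\<alpha>\<^sup>2 + \<beta>\<^sup>2))" by (rule ennreal_leI) simp
  finally show ?thesis .
qed

lemma (in prob_space) wasserstein2_le:
  assumes [measurable]: "random_variable borel X" "random_variable borel Y"
    and le: "(square_dist M X Y) \<le> ennreal c" and c: "0 \<le> c"
  shows "wasserstein2 (distr M borel X) (distr M borel Y) \<le> ennreal (sqrt c)"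
proof -
  define \<pi> where "\<pi> = distr M borel (\<lambda>\<omega>. (X \<omega>, Y \<omega>))"
  have pm[measurable]: "(\<lambda>\<omega>. (X \<omega>, Y \<omega>)) \<in> measurable M borel"
    unfolding borel_prod[symmetric] by measurable
  have fs[measurable]: "fst \<in> borel_measurable (borel :: (real \<times> real) measure)" "snd \<in> borel_measurable (borel :: (real \<times> real) measure)"
    unfolding borel_prod[symmetric] by measurable
  have "\<pi> \<in> couplings (distr M borel X) (distr M borel Y)"
    unfolding couplings_def \<pi>_def
    by (auto simp: distr_distr comp_def intro!: prob_space_distr)
  then have "(INF \<pi>\<in>couplings (distr M borel X) (distr M borel Y). \<integral>\<^sup>+ (x, y). ennreal (\<bar>x - y\<bar>\<^sup>2) \<partial>\<pi>)
      \<le> (\<integral>\<^sup>+ (x, y). ennreal (\<bar>x - y\<bar>\<^sup>2) \<partial>\<pi>)" (is "?I \<le> _") by (rule INF_lower)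
  also have "\<dots> = (square_dist M X Y)"
    unfolding \<pi>_def case_prod_unfold by (subst nn_integral_distr) auto
  also note le
  finally have "?I \<le> ennreal c" .
  then obtain I where I: "I = ?I" "I \<le> ennreal c" by blast
  have "I \<noteq> \<top>" using le_less_trans[OF I(2) ennreal_less_top] by simp
  moreover have "enn2real I \<le> c" using I(2) c by (simp add: enn2real_leI)
  ultimately have "ennreal_sqrt I \<le> ennreal (sqrt c)" by (simp add: ennreal_sqrt_def ennreal_leI)
  then show ?thesis unfolding wasserstein2_def I(1) .
qed

lemma limit_var_law:
  assumes N: "prob_space N" and Z: "distributed N lborel Z\<^sub>1 std_normal_density" "distributed N lborel Z\<^sub>2 std_normal_density"
    and ind: "prob_space.indep_var N borel Z\<^sub>1 borel Z\<^sub>2"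
    and U: "U \<in> borel_measurable M" "V \<in> borel_measurable M"
    and law: "distr M (borel \<Otimes>\<^sub>M borel) (\<lambda>\<omega>. (U \<omega>, V \<omega>)) = std_normal_distribution \<Otimes>\<^sub>M std_normal_distribution"
  shows "distr N borel (limit_var \<rho> Z\<^sub>1 Z\<^sub>2) = distr M borel (limit_var \<rho> U V)"
proof -
  interpret N: prob_space N by fact
  have d: "distr N borel Z = std_normal_distribution" if "distributed N lborel Z std_normal_density" for Z
  proof -
    have "distr N borel Z = distr N lborel Z" by (rule distr_cong) auto
    also have "\<dots> = std_normal_distribution" using that by (simp add: distributed_def)
    finally show ?thesis .
  qed
  have zm: "Z\<^sub>1 \<in> borel_measurable N" "Z\<^sub>2 \<in> borel_measurable N" using Z by (auto simp: distributed_def)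
  have zl: "distr N (borel \<Otimes>\<^sub>M borel) (\<lambda>\<omega>. (Z\<^sub>1 \<omega>, Z\<^sub>2 \<omega>)) = std_normal_distribution \<Otimes>\<^sub>M std_normal_distribution"
    using ind[unfolded N.indep_var_distribution_eq] d Z by simp
  have eq: "distr M' borel (limit_var \<rho> U V) = distr (std_normal_distribution \<Otimes>\<^sub>M std_normal_distribution) borel (limit_var \<rho> fst snd)"
    if m[measurable]: "U \<in> borel_measurable M'" "V \<in> borel_measurable M'"
    and l: "distr M' (borel \<Otimes>\<^sub>M borel) (\<lambda>\<omega>. (U \<omega>, V \<omega>)) = std_normal_distribution \<Otimes>\<^sub>M std_normal_distribution"
    for M' :: "'c measure" and U V
  proof -
    have "limit_var \<rho> fst snd \<in> borel_measurable (borel \<Otimes>\<^sub>M borel)" unfolding limit_var_def[abs_def] by measurable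
    moreover have "limit_var \<rho> fst snd \<circ> (\<lambda>\<omega>. (U \<omega>, V \<omega>)) = limit_var \<rho> U V"
      by (auto simp: limit_var_def)
    ultimately show ?thesis unfolding l[symmetric] by (subst distr_distr) simp_all
  qed
  show ?thesis unfolding eq[OF zm zl] eq[OF U law] ..
qed

context two_sided_brownian_motion
begin

text \<open>The increments are numbered from left to right because independence is available for increasing
  sequences of times; the increment over \<open>cell k\<close> has the number \<open>K - Suc k\<close>.\<close>

definition unit_increment :: "nat \<Rightarrow> nat \<Rightarrow> 'a \<Rightarrow> real" where
  "unit_increment K i \<omega> = B (real (Suc i) - (real K + 1)) \<omega> - B (real i - (real K + 1)) \<omega>"

lemma unit_increments:
  shows "indep_vars (\<lambda>_. borel) (unit_increment K) {..<K}"
    and "distributed M lborel (unit_increment K i) std_normal_density"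
proof -
  have "strict_mono_on {..K} (\<lambda>i. real i - (real K + 1))" by (auto simp: strict_mono_on_def)
  then show "indep_vars (\<lambda>_. borel) (unit_increment K) {..<K}"
    unfolding unit_increment_def[abs_def] by (rule BM_indep_increments)
  show "distributed M lborel (unit_increment K i) std_normal_density"
    using BM_gaussian_increments[of "real i - (real K + 1)" "real (Suc i) - (real K + 1)"]
    unfolding unit_increment_def[abs_def] by simp
qed

lemma step_integral_cell_rectangles:
  fixes K :: nat
  defines "w \<equiv> \<lambda>p i. real (Suc (K - Suc i)) powr p"
  shows "step_integral B (cell_rectangles \<gamma> \<gamma>' K) \<omega> =
    (\<Sum>i<K. w \<gamma> i * unit_increment K i \<omega>) * (\<Sum>i<K. w \<gamma>' i * unit_increment K i \<omega>)
    - (\<Sum>i<K. w \<gamma> i * w \<gamma>' i * (unit_increment K i \<omega>)\<^sup>2)"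
proof -
  define \<eta> where "\<eta> k = B (- (real k + 1)) \<omega> - B (- (real k + 2)) \<omega>" for k
  have \<eta>: "unit_increment K i \<omega> = \<eta> (K - Suc i)" if "i < K" for i
  proof -
    have "real (K - Suc i) = real K - real i - 1" using that by (simp add: of_nat_diff)
    then show ?thesis unfolding unit_increment_def \<eta>_def by (simp add: algebra_simps)
  qed
  have r: "(\<Sum>i<K. F (w \<gamma> i) (w \<gamma>' i) (unit_increment K i \<omega>)) = (\<Sum>k<K. F (real (Suc k) powr \<gamma>) (real (Suc k) powr \<gamma>') (\<eta> k))"
    for F :: "real \<Rightarrow> real \<Rightarrow> real \<Rightarrow> real"
  proof -
    have "(\<Sum>i<K. F (w \<gamma> i) (w \<gamma>' i) (unit_increment K i \<omega>)) =
       (\<Sum>i<K. (\<lambda>k. F (real (Suc k) powr \<gamma>) (real (Suc k) powr \<gamma>') (\<eta> k)) (K - Suc i))"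
      by (intro sum.cong refl) (simp add: w_def \<eta>)
    also have "\<dots> = (\<Sum>k<K. F (real (Suc k) powr \<gamma>) (real (Suc k) powr \<gamma>') (\<eta> k))"
      by (rule sum.nat_diff_reindex[of "\<lambda>k. F (real (Suc k) powr \<gamma>) (real (Suc k) powr \<gamma>') (\<eta> k)"])
    finally show ?thesis .
  qed
  let ?u = "\<lambda>k. real (Suc k) powr \<gamma> * \<eta> k" and ?v = "\<lambda>k. real (Suc k) powr \<gamma>' * \<eta> k"
  have "step_integral B (cell_rectangles \<gamma> \<gamma>' K) \<omega> = (\<Sum>i<K. \<Sum>j<K. if i \<noteq> j then ?u i * ?v j else 0)"
    unfolding step_integral_def sum_list_cell_rectangles \<eta>_def by (intro sum.cong refl) simp
  also have "\<dots> = (\<Sum>i<K. \<Sum>j<K. ?u i * ?v j - (if i = j then ?u i * ?v j else 0))"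
    by (intro sum.cong refl) simp
  also have "\<dots> = (\<Sum>i<K. ?u i) * (\<Sum>j<K. ?v j) - (\<Sum>i<K. ?u i * ?v i)"
    by (simp add: sum_subtractf sum_product)
  also have "(\<Sum>i<K. ?u i * ?v i) = (\<Sum>i<K. real (Suc i) powr \<gamma> * real (Suc i) powr \<gamma>' * (\<eta> i)\<^sup>2)"
    by (intro sum.cong refl) (simp add: power2_eq_square mult_ac)
  finally show ?thesis
    using r[of "\<lambda>a b x. a * x"] r[of "\<lambda>a b x. b * x"] r[of "\<lambda>a b x. a * b * x\<^sup>2"] by simp
qed

text \<open>The three errors are: replacing the kernel by the step function; adding the diagonal terms
  \<open>\<xi>\<^sub>i\<^sup>2 - 1\<close>, whose coefficients are square summable uniformly in the exponents; and the
  difference between the coefficients of the form in \<open>N\<close>, \<open>N'\<close> and their limits.\<close>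

lemma rosenblatt_coupling:
  fixes A S \<rho> \<gamma> \<gamma>' Ck :: real and K :: nat
  defines "s \<equiv> partial_power_sum K (2 * \<gamma>)" and "u \<equiv> partial_power_sum K (2 * \<gamma>')" and "t \<equiv> partial_power_sum K (\<gamma> + \<gamma>')"
  assumes \<rho>: "0 < \<rho>" "\<rho> < 1" and D: "s * u - t\<^sup>2 > 0" and g: "\<gamma> < - 1/2" "\<gamma>' < - 1/2"
    and kernel: "(\<integral>\<^sup>+ z. ennreal ((rosenblatt_kernel \<gamma> \<gamma>' z - step_fun (cell_rectangles \<gamma> \<gamma>' K) z)\<^sup>2) \<partial>lborel) \<le> ennreal (Ck * S)"
      "0 \<le> Ck * S"
  obtains U V where "U \<in> borel_measurable M" "V \<in> borel_measurable M"
    "distr M (borel \<Otimes>\<^sub>M borel) (\<lambda>\<omega>. (U \<omega>, V \<omega>)) = std_normal_distribution \<Otimes>\<^sub>M std_normal_distribution"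
    "double_wiener_integral M B (rosenblatt_kernel \<gamma> \<gamma>') \<in> borel_measurable M"
    "(\<integral>\<^sup>+ \<omega>. ennreal ((A * double_wiener_integral M B (rosenblatt_kernel \<gamma> \<gamma>') \<omega> - limit_var \<rho> U V \<omega>)\<^sup>2) \<partial>M)
      \<le> ennreal (16 * A\<^sup>2 * (Ck * S) + 16 * A\<^sup>2 + 16 * ((A * t - p_coeff \<rho>)\<^sup>2 + (A * sqrt (s * u - t\<^sup>2) - q_coeff \<rho>)\<^sup>2))"
proof -
  define f where "f = rosenblatt_kernel \<gamma> \<gamma>'"
  define h where "h = cell_rectangles \<gamma> \<gamma>' K"
  define \<xi> where "\<xi> = unit_increment K"
  define w where "w p i = real (Suc (K - Suc i)) powr p" for p i
  note ind = unit_increments(1)[of K, folded \<xi>_def]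
  note nor = unit_increments(2)[of K, folded \<xi>_def]
  have \<xi>m[measurable]: "\<xi> i \<in> borel_measurable M" for i using nor[of i] by (simp add: distributed_def)
  have fm[measurable]: "f \<in> borel_measurable borel" unfolding f_def by (rule rosenblatt_kernel_measurable)
  have wsum: "(\<Sum>i<K. F (w p i) (w p' i)) = (\<Sum>k<K. F (real (Suc k) powr p) (real (Suc k) powr p'))" for F :: "real \<Rightarrow> real \<Rightarrow> real" and p p'
    unfolding w_def by (rule sum.nat_diff_reindex[of "\<lambda>k. F (real (Suc k) powr p) (real (Suc k) powr p')"])
  have sums: "(\<Sum>i<K. (w \<gamma> i)\<^sup>2) = s" "(\<Sum>i<K. (w \<gamma>' i)\<^sup>2) = u" "(\<Sum>i<K. w \<gamma> i * w \<gamma>' i) = t"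
    using wsum[of "\<lambda>a b. a\<^sup>2" \<gamma> \<gamma>] wsum[of "\<lambda>a b. a\<^sup>2" \<gamma>' \<gamma>'] wsum[of "\<lambda>a b. a * b" \<gamma> \<gamma>']
    by (simp_all add: s_def u_def t_def partial_power_sum_def power2_eq_square powr_add[symmetric])
  \<comment> \<open>the chosen version of the double integral is close to the step integral\<close>
  have hfin: "(\<integral>\<^sup>+ z. ennreal ((step_fun h z)\<^sup>2) \<partial>lborel) < \<infinity>"
  proof -
    have "finite (endpoints h)" by (auto simp: endpoints_def)
    then obtain n :: nat and t where "strict_mono_on {..n} t" "endpoints h \<subseteq> t ` {..n}" by (rule finite_partition)
    then show ?thesis by (simp add: nn_integral_step_fun_square h_def off_diagonal_cell_rectangles)
  qed
  have "(\<integral>\<^sup>+ z. ennreal ((f z - 0)\<^sup>2) \<partial>lborel) \<le> 2 * (square_dist lborel f (step_fun h)) + 2 * (\<integral>\<^sup>+ z. ennreal ((step_fun h z - 0)\<^sup>2) \<partial>lborel)"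
    by (rule nn_integral_square_triangle) auto
  also have "\<dots> < \<infinity>"
    using le_less_trans[OF kernel(1) ennreal_less_top] hfin unfolding f_def[symmetric] h_def[symmetric]
    by (simp add: ennreal_mult_less_top)
  finally have ffin: "(\<integral>\<^sup>+ z. ennreal ((f z)\<^sup>2) \<partial>lborel) < \<infinity>" by simp
  have f0: "0 \<le> f z" for z unfolding f_def by (rule rosenblatt_kernel_nonneg)
  define Z where "Z = double_wiener_integral M B f"
  have Z: "has_double_wiener_integral M B f Z"
    unfolding Z_def double_wiener_integral_def by (rule someI_ex[OF double_wiener_integral_exists[OF fm f0 ffin]])
  have Zm[measurable]: "Z \<in> borel_measurable M" using Z by (simp add: has_double_wiener_integral_def)
  have 1: "(square_dist M Z (step_integral B h)) \<le> ennreal (8 * (Ck * S))"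
  proof -
    have "(square_dist M Z (step_integral B h)) \<le> 8 * (square_dist lborel f (step_fun h))"
      by (rule double_wiener_integral_approx[OF Z]) (simp add: h_def off_diagonal_cell_rectangles)
    also have "\<dots> \<le> 8 * ennreal (Ck * S)" using kernel(1) by (intro mult_left_mono) (auto simp: f_def h_def)
    also have "\<dots> = ennreal (8 * (Ck * S))" using kernel(2) by (simp add: ennreal_mult')
    finally show ?thesis .
  qed
  \<comment> \<open>restoring the diagonal costs a bounded error\<close>
  define P where "P \<omega> = (\<Sum>i<K. w \<gamma> i * \<xi> i \<omega>) * (\<Sum>i<K. w \<gamma>' i * \<xi> i \<omega>) - t" for \<omega>
  have Pm[measurable]: "P \<in> borel_measurable M" unfolding P_def[abs_def] by measurable
  interpret I: indep_centred M \<xi> K "\<lambda>_. 1" by (rule indep_centred_normal[OF ind nor])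
  have 2: "(square_dist M (step_integral B h) P) \<le> ennreal 4"
  proof -
    have "step_integral B h \<omega> - P \<omega> = - (\<Sum>i<K. (w \<gamma> i * w \<gamma>' i) * ((\<xi> i \<omega>)\<^sup>2 - 1))" for \<omega>
      unfolding h_def P_def step_integral_cell_rectangles \<xi>_def[symmetric] w_def[symmetric] sums(3)[symmetric]
      by (simp add: right_diff_distrib sum_subtractf)
    then have "(square_dist M (step_integral B h) P) = (\<integral>\<^sup>+ \<omega>. ennreal ((\<Sum>i<K. (w \<gamma> i * w \<gamma>' i) * ((\<xi> i \<omega>)\<^sup>2 - 1))\<^sup>2) \<partial>M)"
      by (simp add: power2_eq_square)
    also have "\<dots> = ennreal (2 * (\<Sum>i<K. (w \<gamma> i * w \<gamma>' i)\<^sup>2))"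
      by (rule I.diagonal_form_second_moment) (auto intro: indep_centred_normal(2)[OF ind nor])
    also have "\<dots> \<le> ennreal 4"
    proof (rule ennreal_leI)
      have e: "- 1 - 1 = (- 2 :: real)" by simp
      note b = power_sum_bounds[of 1, unfolded e, OF zero_less_one]
      have "(\<Sum>i<K. (w \<gamma> i * w \<gamma>' i)\<^sup>2) = (\<Sum>k<K. (real (Suc k) powr \<gamma> * real (Suc k) powr \<gamma>')\<^sup>2)"
        by (rule wsum[of "\<lambda>a b. (a * b)\<^sup>2"])
      also have "\<dots> \<le> (\<Sum>k<K. real (Suc k) powr (- 2))"
      proof (rule sum_mono)
        fix k
        have "(real (Suc k) powr \<gamma> * real (Suc k) powr \<gamma>')\<^sup>2 = real (Suc k) powr (2 * (\<gamma> + \<gamma>'))"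
          by (simp add: power2_eq_square powr_add[symmetric])
        also have "\<dots> \<le> real (Suc k) powr (- 2)" using g by (intro powr_mono) auto
        finally show "(real (Suc k) powr \<gamma> * real (Suc k) powr \<gamma>')\<^sup>2 \<le> real (Suc k) powr (- 2)" .
      qed
      also have "\<dots> \<le> (\<Sum>k. real (Suc k) powr (- 2))" by (rule sum_le_suminf[OF b(1)]) auto
      also have "\<dots> \<le> 2" using b(3) by simp
      finally show "2 * (\<Sum>i<K. (w \<gamma> i * w \<gamma>' i)\<^sup>2) \<le> 4" by simp
    qed
    finally show ?thesis .
  qed
  \<comment> \<open>two orthonormal combinations of the increments carry the product\<close>
  have D': "(\<Sum>i<K. (w \<gamma> i)\<^sup>2) * (\<Sum>i<K. (w \<gamma>' i)\<^sup>2) - (\<Sum>i<K. w \<gamma> i * w \<gamma>' i)\<^sup>2 > 0" unfolding sums by (rule D)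
  obtain e e' where on: "(\<Sum>i<K. (e i)\<^sup>2) = 1" "(\<Sum>i<K. (e' i)\<^sup>2) = 1" "(\<Sum>i<K. e i * e' i) = 0"
    and prod: "\<And>x. (\<Sum>i<K. w \<gamma> i * x i) * (\<Sum>i<K. w \<gamma>' i * x i) =
        t * (\<Sum>i<K. e i * x i)\<^sup>2 + sqrt (s * u - t\<^sup>2) * ((\<Sum>i<K. e i * x i) * (\<Sum>i<K. e' i * x i))"
    using orthonormalise[OF D'] unfolding sums by blast
  define N N' where "N \<omega> = (\<Sum>i<K. e i * \<xi> i \<omega>)" and "N' \<omega> = (\<Sum>i<K. e' i * \<xi> i \<omega>)" for \<omega>
  have Nm[measurable]: "N \<in> borel_measurable M" "N' \<in> borel_measurable M" unfolding N_def[abs_def] N'_def[abs_def] by measurable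
  have Nlaw: "distr M (borel \<Otimes>\<^sub>M borel) (\<lambda>\<omega>. (N \<omega>, N' \<omega>)) = std_normal_distribution \<Otimes>\<^sub>M std_normal_distribution"
    unfolding N_def N'_def by (rule orthonormal_combinations_law[OF ind nor on])
  define c d where "c = rot_cos \<rho>" and "d = rot_sin \<rho>"
  define U V where "U \<omega> = c * N \<omega> + d * N' \<omega>" and "V \<omega> = d * N \<omega> - c * N' \<omega>" for \<omega>
  have Um: "U \<in> borel_measurable M" "V \<in> borel_measurable M" unfolding U_def[abs_def] V_def[abs_def] by measurable
  have cd: "c\<^sup>2 + d\<^sup>2 = 1" using rot_squares[OF \<rho>] by (simp add: c_def d_def field_simps)
  have UVlaw: "distr M (borel \<Otimes>\<^sub>M borel) (\<lambda>\<omega>. (U \<omega>, V \<omega>)) = std_normal_distribution \<Otimes>\<^sub>M std_normal_distribution"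
  proof -
    have expand: "(\<Sum>i<K. (a * e i + b * e' i) * (a' * e i + b' * e' i)) = a * a' + b * b'" for a b a' b'
    proof -
      have "(\<Sum>i<K. (a * e i + b * e' i) * (a' * e i + b' * e' i)) =
        (\<Sum>i<K. (a * a') * (e i)\<^sup>2 + (b * b') * (e' i)\<^sup>2 + (a * b' + b * a') * (e i * e' i))"
        by (intro sum.cong refl) (simp add: power2_eq_square algebra_simps)
      also have "\<dots> = a * a' * 1 + b * b' * 1 + (a * b' + b * a') * 0"
        unfolding sum.distrib sum_distrib_left[symmetric] on ..
      finally show ?thesis by simp
    qed
    have "distr M (borel \<Otimes>\<^sub>M borel) (\<lambda>\<omega>. (\<Sum>i<K. (c * e i + d * e' i) * \<xi> i \<omega>, \<Sum>i<K. (d * e i + (- c) * e' i) * \<xi> i \<omega>)) =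
        std_normal_distribution \<Otimes>\<^sub>M std_normal_distribution"
      by (rule orthonormal_combinations_law[OF ind nor])
         (unfold power2_eq_square expand, use cd in \<open>simp_all add: power2_eq_square\<close>)
    moreover have "U \<omega> = (\<Sum>i<K. (c * e i + d * e' i) * \<xi> i \<omega>)" "V \<omega> = (\<Sum>i<K. (d * e i + (- c) * e' i) * \<xi> i \<omega>)" for \<omega>
      unfolding U_def V_def N_def N'_def by (simp_all add: sum_distrib_left sum.distrib sum_subtractf distrib_right left_diff_distrib mult.assoc)
    ultimately show ?thesis by simp
  qed
  have lim: "limit_var \<rho> U V \<omega> = p_coeff \<rho> * ((N \<omega>)\<^sup>2 - 1) + q_coeff \<rho> * (N \<omega> * N' \<omega>)" for \<omega>
    unfolding limit_var_def U_def V_def c_def d_def by (rule limit_rotated[OF \<rho>])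
  have Lm[measurable]: "limit_var \<rho> U V \<in> borel_measurable M" unfolding lim[abs_def] by measurable
  let ?\<alpha> = "A * t - p_coeff \<rho>" and ?\<beta> = "A * sqrt (s * u - t\<^sup>2) - q_coeff \<rho>"
  have 3: "(\<integral>\<^sup>+ \<omega>. ennreal ((A * P \<omega> - limit_var \<rho> U V \<omega>)\<^sup>2) \<partial>M) \<le> ennreal (4 * (?\<alpha>\<^sup>2 + ?\<beta>\<^sup>2))"
  proof -
    have "A * P \<omega> - limit_var \<rho> U V \<omega> = ?\<alpha> * ((N \<omega>)\<^sup>2 - 1) + ?\<beta> * (N \<omega> * N' \<omega>)" for \<omega>
      unfolding lim P_def prod N_def[symmetric] N'_def[symmetric] by (simp add: algebra_simps)
    then have "(\<integral>\<^sup>+ \<omega>. ennreal ((A * P \<omega> - limit_var \<rho> U V \<omega>)\<^sup>2) \<partial>M) =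
      (\<integral>\<^sup>+ z. ennreal ((?\<alpha> * ((fst z)\<^sup>2 - 1) + ?\<beta> * (fst z * snd z))\<^sup>2) \<partial>distr M (borel \<Otimes>\<^sub>M borel) (\<lambda>\<omega>. (N \<omega>, N' \<omega>)))"
      by (subst nn_integral_distr) simp_all
    also have "\<dots> \<le> ennreal (4 * (?\<alpha>\<^sup>2 + ?\<beta>\<^sup>2))" unfolding Nlaw by (rule std_normal_pair_moment)
    finally show ?thesis .
  qed
  have scale: "(\<integral>\<^sup>+ \<omega>. ennreal ((A * X \<omega> - A * Y \<omega>)\<^sup>2) \<partial>M) \<le> ennreal (A\<^sup>2 * b)"
    if le: "(square_dist M X Y) \<le> ennreal b" and [measurable]: "X \<in> borel_measurable M" "Y \<in> borel_measurable M" for X Y b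
  proof -
    have "(\<integral>\<^sup>+ \<omega>. ennreal ((A * X \<omega> - A * Y \<omega>)\<^sup>2) \<partial>M) = (\<integral>\<^sup>+ \<omega>. ennreal (A\<^sup>2) * ennreal ((X \<omega> - Y \<omega>)\<^sup>2) \<partial>M)"
      by (intro nn_integral_cong) (simp add: ennreal_mult'[symmetric] right_diff_distrib[symmetric] power_mult_distrib)
    also have "\<dots> = ennreal (A\<^sup>2) * (square_dist M X Y)" by (rule nn_integral_cmult) measurable
    also have "\<dots> \<le> ennreal (A\<^sup>2) * ennreal b" by (rule mult_left_mono[OF le]) simp
    finally show ?thesis by (simp add: ennreal_mult')
  qed
  let ?tot = "16 * A\<^sup>2 * (Ck * S) + 16 * A\<^sup>2 + 16 * (?\<alpha>\<^sup>2 + ?\<beta>\<^sup>2)"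
  have "(\<integral>\<^sup>+ \<omega>. ennreal ((A * Z \<omega> - limit_var \<rho> U V \<omega>)\<^sup>2) \<partial>M) \<le>
     2 * (\<integral>\<^sup>+ \<omega>. ennreal ((A * Z \<omega> - A * step_integral B h \<omega>)\<^sup>2) \<partial>M) + 2 * (\<integral>\<^sup>+ \<omega>. ennreal ((A * step_integral B h \<omega> - limit_var \<rho> U V \<omega>)\<^sup>2) \<partial>M)"
    by (rule nn_integral_square_triangle) measurable
  also have "\<dots> \<le> 2 * ennreal (A\<^sup>2 * (8 * (Ck * S))) + 2 * (2 * ennreal (A\<^sup>2 * 4) + 2 * ennreal (4 * (?\<alpha>\<^sup>2 + ?\<beta>\<^sup>2)))"
  proof (intro add_mono mult_left_mono scale 1)
    have "(\<integral>\<^sup>+ \<omega>. ennreal ((A * step_integral B h \<omega> - limit_var \<rho> U V \<omega>)\<^sup>2) \<partial>M) \<le>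
      2 * (\<integral>\<^sup>+ \<omega>. ennreal ((A * step_integral B h \<omega> - A * P \<omega>)\<^sup>2) \<partial>M) + 2 * (\<integral>\<^sup>+ \<omega>. ennreal ((A * P \<omega> - limit_var \<rho> U V \<omega>)\<^sup>2) \<partial>M)"
      by (rule nn_integral_square_triangle) measurable
    also have "\<dots> \<le> 2 * ennreal (A\<^sup>2 * 4) + 2 * ennreal (4 * (?\<alpha>\<^sup>2 + ?\<beta>\<^sup>2))"
      by (intro add_mono mult_left_mono scale 2 3) auto
    finally show "(\<integral>\<^sup>+ \<omega>. ennreal ((A * step_integral B h \<omega> - limit_var \<rho> U V \<omega>)\<^sup>2) \<partial>M) \<le> 2 * ennreal (A\<^sup>2 * 4) + 2 * ennreal (4 * (?\<alpha>\<^sup>2 + ?\<beta>\<^sup>2))" .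
  qed auto
  also have "\<dots> = ennreal (2 * (A\<^sup>2 * (8 * (Ck * S))) + 2 * (2 * (A\<^sup>2 * 4) + 2 * (4 * (?\<alpha>\<^sup>2 + ?\<beta>\<^sup>2))))"
  proof -
    have "0 \<le> A\<^sup>2 * (8 * (Ck * S))" using kernel(2) by simp
    then show ?thesis
      by (simp only: ennreal_plus ennreal_mult' ennreal_numeral add_nonneg_nonneg mult_nonneg_nonneg zero_le_power2 zero_le_numeral)
  qed
  also have "2 * (A\<^sup>2 * (8 * (Ck * S))) + 2 * (2 * (A\<^sup>2 * 4) + 2 * (4 * (?\<alpha>\<^sup>2 + ?\<beta>\<^sup>2))) = ?tot" by simp
  finally have fin: "(\<integral>\<^sup>+ \<omega>. ennreal ((A * Z \<omega> - limit_var \<rho> U V \<omega>)\<^sup>2) \<partial>M) \<le> ennreal ?tot" .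
  show ?thesis
    by (rule that[OF Um UVlaw]) (use Zm fin in \<open>simp_all add: Z_def f_def\<close>)
qed

end

section \<open>The rate of convergence\<close>

lemma partial_sum_eventually:
  fixes a :: "nat \<Rightarrow> real"
  assumes "summable a"
  shows "\<forall>\<^sub>F K in sequentially. suminf a \<le> (\<Sum>k<K. a k) + 1"
proof -
  have "\<forall>\<^sub>F K in sequentially. suminf a - 1 < (\<Sum>k<K. a k)"
    by (rule order_tendstoD(1)[OF summable_LIMSEQ[OF assms]]) simp
  then show ?thesis by eventually_elim simp
qed

lemma tail_sum_le_1:
  fixes a :: "nat \<Rightarrow> real"
  assumes a: "summable a" "\<And>k. 0 \<le> a k" and K: "suminf a \<le> (\<Sum>k<K. a k) + 1"
  shows "(\<Sum>k. ennreal (if k < K then 0 else a k)) \<le> 1"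
proof -
  have "(\<lambda>k. if k \<in> {..<K} then a k else 0) sums (\<Sum>k\<in>{..<K}. a k)" by (rule sums_If_finite_set) simp
  from sums_diff[OF summable_sums[OF a(1)] this]
  have "(\<lambda>k. a k - (if k \<in> {..<K} then a k else 0)) sums (suminf a - (\<Sum>k<K. a k))" .
  moreover have "(\<lambda>k. a k - (if k \<in> {..<K} then a k else 0)) = (\<lambda>k. if k < K then 0 else a k)" by auto
  ultimately have s: "(\<lambda>k. if k < K then 0 else a k) sums (suminf a - (\<Sum>k<K. a k))" by simp
  have "(\<Sum>k. ennreal (if k < K then 0 else a k)) = ennreal (\<Sum>k. if k < K then 0 else a k)"
    by (rule suminf_ennreal2) (use a s in \<open>auto simp: sums_iff\<close>)
  also have "\<dots> \<le> ennreal 1" using s K by (intro ennreal_leI) (simp add: sums_iff)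
  finally show ?thesis by simp
qed

text \<open>The truncation may depend on \<open>\<epsilon>\<close> in any way, since a tail of mass at most 1 is negligible
  compared to sums of order \<open>1 / \<epsilon>\<close>.\<close>

lemma truncation_index:
  assumes \<rho>: "0 < \<rho>"
  obtains K :: "real \<Rightarrow> nat" where "\<And>\<epsilon> d. \<epsilon> > 0 \<Longrightarrow> d \<in> {2, 2 / \<rho>, 1 + 1 / \<rho>} \<Longrightarrow>
      (\<Sum>k. real (Suc k) powr (- 1 - d * \<epsilon>)) \<le> partial_power_sum (K \<epsilon>) (- 1 - d * \<epsilon>) + 1"
proof -
  have "\<exists>K. \<forall>d\<in>{2, 2 / \<rho>, 1 + 1 / \<rho>}. (\<Sum>k. real (Suc k) powr (- 1 - d * \<epsilon>)) \<le> partial_power_sum K (- 1 - d * \<epsilon>) + 1"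
    if e: "\<epsilon> > 0" for \<epsilon>
  proof -
    have "\<forall>\<^sub>F K in sequentially. \<forall>d\<in>{2, 2 / \<rho>, 1 + 1 / \<rho>}. (\<Sum>k. real (Suc k) powr (- 1 - d * \<epsilon>)) \<le> partial_power_sum K (- 1 - d * \<epsilon>) + 1"
    proof (rule eventually_ball_finite)
      show "\<forall>d\<in>{2, 2 / \<rho>, 1 + 1 / \<rho>}. \<forall>\<^sub>F K in sequentially. (\<Sum>k. real (Suc k) powr (- 1 - d * \<epsilon>)) \<le> partial_power_sum K (- 1 - d * \<epsilon>) + 1"
      proof
        fix d assume "d \<in> {2, 2 / \<rho>, 1 + 1 / \<rho>}"
        then have "d > 0" using \<rho> by (auto intro: add_pos_pos)
        then have "d * \<epsilon> > 0" using e by simp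
        from partial_sum_eventually[OF power_sum_bounds(1)[OF this]]
        show "\<forall>\<^sub>F K in sequentially. (\<Sum>k. real (Suc k) powr (- 1 - d * \<epsilon>)) \<le> partial_power_sum K (- 1 - d * \<epsilon>) + 1"
          unfolding partial_power_sum_def .
      qed
    qed simp
    then show ?thesis by (auto simp: eventually_sequentially)
  qed
  then obtain K where "\<And>\<epsilon>. \<epsilon> > 0 \<Longrightarrow> \<forall>d\<in>{2, 2 / \<rho>, 1 + 1 / \<rho>}. (\<Sum>k. real (Suc k) powr (- 1 - d * \<epsilon>)) \<le> partial_power_sum (K \<epsilon>) (- 1 - d * \<epsilon>) + 1"
    by metis
  then show ?thesis by (intro that[of K]) blast
qed

lemma kernel_error:
  fixes K :: "real \<Rightarrow> nat"
  assumes \<rho>: "0 < \<rho>" "\<rho> < 1"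
    and K: "\<And>\<epsilon> d. \<epsilon> > 0 \<Longrightarrow> d \<in> {2, 2 / \<rho>, 1 + 1 / \<rho>} \<Longrightarrow>
      (\<Sum>k. real (Suc k) powr (- 1 - d * \<epsilon>)) \<le> partial_power_sum (K \<epsilon>) (- 1 - d * \<epsilon>) + 1"
  obtains C where "0 \<le> C" and "\<And>\<epsilon>. 0 < \<epsilon> \<Longrightarrow> \<epsilon> \<le> \<rho> / 8 \<Longrightarrow>
     (\<integral>\<^sup>+ z. ennreal ((rosenblatt_kernel (- 1/2 - \<epsilon>) (- 1/2 - \<epsilon> / \<rho>) z -
        step_fun (cell_rectangles (- 1/2 - \<epsilon>) (- 1/2 - \<epsilon> / \<rho>) (K \<epsilon>)) z)\<^sup>2) \<partial>lborel) \<le> ennreal (C * (2 / \<epsilon>))"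
proof
  let ?C = "c_both\<^sup>2 * 2 * enn2real (\<integral>\<^sup>+ u. near_mass u \<partial>lborel) + 4 * c_near\<^sup>2 + 38"
  show "0 \<le> ?C" by (intro add_nonneg_nonneg mult_nonneg_nonneg) auto
  fix \<epsilon> :: real assume e: "0 < \<epsilon>" "\<epsilon> \<le> \<rho> / 8"
  define \<gamma> \<gamma>' where "\<gamma> = - 1/2 - \<epsilon>" and "\<gamma>' = - 1/2 - \<epsilon> / \<rho>"
  have er: "\<epsilon> / \<rho> \<le> 1/8" "0 < \<epsilon> / \<rho>" using e \<rho> by (simp_all add: field_simps)
  have g: "- 5/8 \<le> \<gamma>" "\<gamma> < - 1/2" "- 5/8 \<le> \<gamma>'" "\<gamma>' < - 1/2"
    unfolding \<gamma>_def \<gamma>'_def using e er \<rho> by linarith+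
  have ex: "2 * \<gamma> = - 1 - 2 * \<epsilon>" "2 * \<gamma>' = - 1 - (2 / \<rho>) * \<epsilon>" by (simp_all add: \<gamma>_def \<gamma>'_def)
  have S: "1 \<le> 2 / \<epsilon>" using e \<rho> by (simp add: field_simps)
  have sum: "(\<Sum>k. ennreal (real (Suc k) powr (- 1 - d * \<epsilon>))) \<le> ennreal (2 / \<epsilon>)"
    and tail: "(\<Sum>k. ennreal (if k < K \<epsilon> then 0 else real (Suc k) powr (- 1 - d * \<epsilon>))) \<le> 1"
    if d: "d \<in> {2, 2 / \<rho>}" for d
  proof -
    have "2 \<le> 2 / \<rho>" using \<rho> by (simp add: le_divide_eq)
    then have d2: "d \<ge> 2" using d by auto
    then have de: "d * \<epsilon> > 0" using e by simp
    note b = power_sum_bounds[OF de]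
    let ?s = "\<Sum>k. real (Suc k) powr (- 1 - d * \<epsilon>)"
    have "?s \<le> (1 + d * \<epsilon>) / (d * \<epsilon>)" using b(3) de by (simp add: field_simps)
    also have "\<dots> = 1 / (d * \<epsilon>) + 1"
      using e(1) d2 by (simp add: add_divide_distrib)
    also have "1 / (d * \<epsilon>) \<le> 1 / (1 * \<epsilon>)" using e(1) d2 de by (intro divide_left_mono mult_right_mono) auto
    also have "1 / (1 * \<epsilon>) + 1 \<le> 2 / \<epsilon>" using e \<rho> by (simp add: field_simps)
    finally have "?s \<le> 2 / \<epsilon>" by simp
    moreover have "(\<Sum>k. ennreal (real (Suc k) powr (- 1 - d * \<epsilon>))) = ennreal ?s"
      by (rule suminf_ennreal2) (use b(1) in auto)
    ultimately show "(\<Sum>k. ennreal (real (Suc k) powr (- 1 - d * \<epsilon>))) \<le> ennreal (2 / \<epsilon>)" by (simp add: ennreal_leI)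
    show "(\<Sum>k. ennreal (if k < K \<epsilon> then 0 else real (Suc k) powr (- 1 - d * \<epsilon>))) \<le> 1"
      by (rule tail_sum_le_1[OF b(1)]) (use K[OF e(1), of d] d in \<open>auto simp: partial_power_sum_def\<close>)
  qed
  show "(\<integral>\<^sup>+ z. ennreal ((rosenblatt_kernel (- 1/2 - \<epsilon>) (- 1/2 - \<epsilon> / \<rho>) z -
        step_fun (cell_rectangles (- 1/2 - \<epsilon>) (- 1/2 - \<epsilon> / \<rho>) (K \<epsilon>)) z)\<^sup>2) \<partial>lborel) \<le> ennreal (?C * (2 / \<epsilon>))"
    unfolding \<gamma>_def[symmetric] \<gamma>'_def[symmetric]
    by (rule kernel_step_distance[OF g S]) (unfold ex, (rule sum tail; simp)+)
qed

lemma eventually_at_left_reflect: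
  fixes a :: real
  assumes "\<forall>\<^sub>F \<epsilon> in at_right 0. P (a - \<epsilon>)"
  shows "\<forall>\<^sub>F x in at_left a. P x"
proof -
  obtain b where b: "b > 0" "\<And>\<epsilon>. 0 < \<epsilon> \<Longrightarrow> \<epsilon> < b \<Longrightarrow> P (a - \<epsilon>)"
    using assms unfolding eventually_at_right_field by auto
  show ?thesis unfolding eventually_at_left_field
  proof (intro exI[of _ "a - b"] conjI allI impI)
    fix y assume "a - b < y" "y < a"
    then show "P y" using b(2)[of "a - y"] by simp
  qed (use b in simp)
qed

theorem mainTheorem12:
  fixes \<rho> :: real
  assumes "0 < \<rho>" and "\<rho> < 1"
  shows "\<exists>C>0. \<forall>\<^sub>F \<gamma>\<^sub>1 in at_left (- 1/2).
    (let \<gamma>\<^sub>2 = (\<gamma>\<^sub>1 + 1/2) / \<rho> - 1/2 in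
       \<gamma>\<^sub>2 \<le> \<gamma>\<^sub>1 \<and> \<gamma>\<^sub>1 \<in> {-1<..<-1/2} \<and> \<gamma>\<^sub>2 \<in> {-1<..<-1/2} \<and> \<gamma>\<^sub>1 + \<gamma>\<^sub>2 > -3/2 \<and>
       (\<forall>(M :: 'a measure) B (N :: 'b measure) Z\<^sub>1 Z\<^sub>2.
          two_sided_brownian_motion M B \<longrightarrow>
          prob_space N \<longrightarrow>
          distributed N lborel Z\<^sub>1 std_normal_density \<longrightarrow>
          distributed N lborel Z\<^sub>2 std_normal_density \<longrightarrow>
          prob_space.indep_var N borel Z\<^sub>1 borel Z\<^sub>2 \<longrightarrow>
          wasserstein2 (distr M borel (rosenblatt_var M B \<gamma>\<^sub>1 \<gamma>\<^sub>2)) (distr N borel (limit_var \<rho> Z\<^sub>1 Z\<^sub>2))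
            \<le> ennreal (C * sqrt (- \<gamma>\<^sub>1 - 1/2))))"
proof -
  note \<rho> = assms
  obtain K where K: "\<And>\<epsilon> d. \<epsilon> > 0 \<Longrightarrow> d \<in> {2, 2 / \<rho>, 1 + 1 / \<rho>} \<Longrightarrow>
      (\<Sum>k. real (Suc k) powr (- 1 - d * \<epsilon>)) \<le> partial_power_sum (K \<epsilon>) (- 1 - d * \<epsilon>) + 1"
    using truncation_index[OF \<rho>(1)] by blast
  obtain Ck where Ck: "0 \<le> Ck" "\<And>\<epsilon>. 0 < \<epsilon> \<Longrightarrow> \<epsilon> \<le> \<rho> / 8 \<Longrightarrow>
     (\<integral>\<^sup>+ z. ennreal ((rosenblatt_kernel (- 1/2 - \<epsilon>) (- 1/2 - \<epsilon> / \<rho>) z -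
        step_fun (cell_rectangles (- 1/2 - \<epsilon>) (- 1/2 - \<epsilon> / \<rho>) (K \<epsilon>)) z)\<^sup>2) \<partial>lborel) \<le> ennreal (Ck * (2 / \<epsilon>))"
    using kernel_error[OF \<rho> K] by blast
  define A where "A \<epsilon> = rosenblatt_const (- 1/2 - \<epsilon>) (- 1/2 - \<epsilon> / \<rho>)" for \<epsilon>
  define s where "s d \<epsilon> = partial_power_sum (K \<epsilon>) (- 1 - d * \<epsilon>)" for d \<epsilon>
  have as: "lin_approx (\<lambda>\<epsilon>. A \<epsilon> * s (1 + 1 / \<rho>) \<epsilon>) (p_coeff \<rho>)"
    "lin_approx (\<lambda>\<epsilon>. A \<epsilon> * sqrt (s 2 \<epsilon> * s (2 / \<rho>) \<epsilon> - (s (1 + 1 / \<rho>) \<epsilon>)\<^sup>2)) (q_coeff \<rho>)"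
    "\<forall>\<^sub>F \<epsilon> in at_right 0. s 2 \<epsilon> * s (2 / \<rho>) \<epsilon> - (s (1 + 1 / \<rho>) \<epsilon>)\<^sup>2 > 0"
    unfolding A_def s_def by (rule coefficient_asymptotics[OF \<rho>], rule K; assumption)+
  obtain C\<^sub>0 where C0: "\<forall>\<^sub>F \<epsilon> in at_right 0. \<bar>A \<epsilon> / \<epsilon> - 2 / (sqrt \<rho> * sqrt (1 + (corr \<rho>)\<^sup>2))\<bar> \<le> C\<^sub>0 * \<epsilon>"
    using rosenblatt_const_asymp[OF \<rho>, folded A_def] by (auto simp: lin_approx_def)
  obtain C\<^sub>1 where C1: "\<forall>\<^sub>F \<epsilon> in at_right 0. \<bar>A \<epsilon> * s (1 + 1 / \<rho>) \<epsilon> - p_coeff \<rho>\<bar> \<le> C\<^sub>1 * \<epsilon>"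
    using as(1) by (auto simp: lin_approx_def)
  obtain C\<^sub>2 where C2: "\<forall>\<^sub>F \<epsilon> in at_right 0. \<bar>A \<epsilon> * sqrt (s 2 \<epsilon> * s (2 / \<rho>) \<epsilon> - (s (1 + 1 / \<rho>) \<epsilon>)\<^sup>2) - q_coeff \<rho>\<bar> \<le> C\<^sub>2 * \<epsilon>"
    using as(2) by (auto simp: lin_approx_def)
  define L where "L = \<bar>2 / (sqrt \<rho> * sqrt (1 + (corr \<rho>)\<^sup>2))\<bar> + \<bar>C\<^sub>0\<bar>"
  define Q where "Q = 32 * L\<^sup>2 * Ck + 16 * L\<^sup>2 + 16 * (C\<^sub>1\<^sup>2 + C\<^sub>2\<^sup>2) + 1"
  have Q: "Q > 0" unfolding Q_def using Ck(1) by (intro add_nonneg_pos add_nonneg_nonneg mult_nonneg_nonneg) auto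
  have small: "\<forall>\<^sub>F \<epsilon> in at_right 0. \<epsilon> < \<rho> / 8"
    by (rule eventually_at_rightI[of 0 "\<rho> / 8"]) (use \<rho> in auto)
  have sQ: "sqrt Q > 0" using Q by simp
  show ?thesis
  proof (rule exI[of _ "sqrt Q"], rule conjI[OF sQ], rule eventually_at_left_reflect,
      use eventually_at_right_less[of 0] small C0 C1 C2 as(3) in eventually_elim)
    case (elim \<epsilon>)
    define \<gamma> \<gamma>' where "\<gamma> = - 1/2 - \<epsilon>" and "\<gamma>' = - 1/2 - \<epsilon> / \<rho>"
    have g2: "((- 1/2 - \<epsilon>) + 1/2) / \<rho> - 1/2 = \<gamma>'" by (simp add: \<gamma>'_def)
    have er: "\<epsilon> / \<rho> < 1/8" "0 < \<epsilon> / \<rho>" "\<epsilon> \<le> \<epsilon> / \<rho>" using elim(1,2) \<rho> by (simp_all add: field_simps)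
    have ex: "2 * \<gamma> = - 1 - 2 * \<epsilon>" "2 * \<gamma>' = - 1 - (2 / \<rho>) * \<epsilon>" "\<gamma> + \<gamma>' = - 1 - (1 + 1 / \<rho>) * \<epsilon>"
      by (simp_all add: \<gamma>_def \<gamma>'_def distrib_right)
    have S0: "0 \<le> Ck * (2 / \<epsilon>)" using Ck(1) elim(1) by simp
    have "\<bar>A \<epsilon> / \<epsilon>\<bar> \<le> L"
    proof -
      have "C\<^sub>0 * \<epsilon> \<le> \<bar>C\<^sub>0\<bar> * 1" using elim(1,2) \<rho> by (intro mult_mono) auto
      then show ?thesis unfolding L_def using elim(3) by linarith
    qed
    then have "\<bar>A \<epsilon>\<bar> \<le> L * \<epsilon>" using elim(1) by (simp add: abs_divide field_simps)
    then have "\<bar>A \<epsilon>\<bar>\<^sup>2 \<le> (L * \<epsilon>)\<^sup>2" by (intro power_mono) auto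
    \<comment> \<open>the constant is of order \<open>\<epsilon>\<close> and the squared distance of the kernel from the step function of order \<open>1 / \<epsilon>\<close>\<close>
    then have A2: "(A \<epsilon>)\<^sup>2 \<le> L\<^sup>2 * \<epsilon>\<^sup>2" by (simp add: power_mult_distrib)
    have sq: "v\<^sup>2 \<le> c\<^sup>2 * \<epsilon>\<^sup>2" if "\<bar>v\<bar> \<le> c * \<epsilon>" for v c
    proof -
      have "\<bar>v\<bar>\<^sup>2 \<le> (c * \<epsilon>)\<^sup>2" using that by (intro power_mono) auto
      then show ?thesis by (simp add: power_mult_distrib)
    qed
    have e2: "\<epsilon>\<^sup>2 \<le> \<epsilon>" using elim(1,2) \<rho> by (simp add: power2_eq_square mult_left_le)
    let ?\<alpha> = "A \<epsilon> * s (1 + 1 / \<rho>) \<epsilon> - p_coeff \<rho>"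
    let ?\<beta> = "A \<epsilon> * sqrt (s 2 \<epsilon> * s (2 / \<rho>) \<epsilon> - (s (1 + 1 / \<rho>) \<epsilon>)\<^sup>2) - q_coeff \<rho>"
    have tot: "16 * (A \<epsilon>)\<^sup>2 * (Ck * (2 / \<epsilon>)) + 16 * (A \<epsilon>)\<^sup>2 + 16 * (?\<alpha>\<^sup>2 + ?\<beta>\<^sup>2) \<le> Q * \<epsilon>"
    proof -
      have "16 * (A \<epsilon>)\<^sup>2 * (Ck * (2 / \<epsilon>)) \<le> 16 * (L\<^sup>2 * \<epsilon>\<^sup>2) * (Ck * (2 / \<epsilon>))"
        using A2 S0 by (intro mult_right_mono mult_left_mono) auto
      also have "\<dots> = (32 * L\<^sup>2 * Ck) * \<epsilon>" using elim(1) by (simp add: power2_eq_square)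
      finally have 1: "16 * (A \<epsilon>)\<^sup>2 * (Ck * (2 / \<epsilon>)) \<le> (32 * L\<^sup>2 * Ck) * \<epsilon>" .
      have 2: "(A \<epsilon>)\<^sup>2 \<le> L\<^sup>2 * \<epsilon>" by (rule order_trans[OF A2]) (intro mult_left_mono e2, simp)
      have 3: "?\<alpha>\<^sup>2 \<le> C\<^sub>1\<^sup>2 * \<epsilon>" by (rule order_trans[OF sq[OF elim(4)]]) (intro mult_left_mono e2, simp)
      have 4: "?\<beta>\<^sup>2 \<le> C\<^sub>2\<^sup>2 * \<epsilon>" by (rule order_trans[OF sq[OF elim(5)]]) (intro mult_left_mono e2, simp)
      have "16 * (A \<epsilon>)\<^sup>2 * (Ck * (2 / \<epsilon>)) + 16 * (A \<epsilon>)\<^sup>2 + 16 * (?\<alpha>\<^sup>2 + ?\<beta>\<^sup>2)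
          \<le> (32 * L\<^sup>2 * Ck) * \<epsilon> + 16 * (L\<^sup>2 * \<epsilon>) + 16 * (C\<^sub>1\<^sup>2 * \<epsilon> + C\<^sub>2\<^sup>2 * \<epsilon>)"
        by (intro add_mono mult_left_mono 1 2 3 4) auto
      also have "\<dots> \<le> \<dots> + \<epsilon>" using elim(1) by simp
      also have "\<dots> = Q * \<epsilon>" unfolding Q_def by (simp add: algebra_simps)
      finally show ?thesis .
    qed
    have W: "wasserstein2 (distr M borel (rosenblatt_var M B \<gamma> \<gamma>')) (distr N borel (limit_var \<rho> Z\<^sub>1 Z\<^sub>2)) \<le> ennreal (sqrt Q * sqrt \<epsilon>)"
      if BM: "two_sided_brownian_motion M B" and N: "prob_space N" "distributed N lborel Z\<^sub>1 std_normal_density"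
        "distributed N lborel Z\<^sub>2 std_normal_density" "prob_space.indep_var N borel Z\<^sub>1 borel Z\<^sub>2"
      for M :: "'a measure" and B and N :: "'b measure" and Z\<^sub>1 Z\<^sub>2
    proof -
      interpret two_sided_brownian_motion M B by fact
      let ?I = "double_wiener_integral M B (rosenblatt_kernel \<gamma> \<gamma>')"
      have D: "partial_power_sum (K \<epsilon>) (2 * \<gamma>) * partial_power_sum (K \<epsilon>) (2 * \<gamma>') - (partial_power_sum (K \<epsilon>) (\<gamma> + \<gamma>'))\<^sup>2 > 0"
        unfolding ex using elim(6) unfolding s_def .
      have g: "\<gamma> < - 1/2" "\<gamma>' < - 1/2" using elim(1) er by (simp_all add: \<gamma>_def \<gamma>'_def)
      have kern: "(\<integral>\<^sup>+ z. ennreal ((rosenblatt_kernel \<gamma> \<gamma>' z - step_fun (cell_rectangles \<gamma> \<gamma>' (K \<epsilon>)) z)\<^sup>2) \<partial>lborel) \<le> ennreal (Ck * (2 / \<epsilon>))"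
        unfolding \<gamma>_def \<gamma>'_def using elim(1,2) by (intro Ck(2)) auto
      obtain U V where UV: "U \<in> borel_measurable M" "V \<in> borel_measurable M"
        "distr M (borel \<Otimes>\<^sub>M borel) (\<lambda>\<omega>. (U \<omega>, V \<omega>)) = std_normal_distribution \<Otimes>\<^sub>M std_normal_distribution"
        and I[measurable]: "?I \<in> borel_measurable M"
        and le: "(\<integral>\<^sup>+ \<omega>. ennreal ((A \<epsilon> * ?I \<omega> - limit_var \<rho> U V \<omega>)\<^sup>2) \<partial>M)
          \<le> ennreal (16 * (A \<epsilon>)\<^sup>2 * (Ck * (2 / \<epsilon>)) + 16 * (A \<epsilon>)\<^sup>2 + 16 * (?\<alpha>\<^sup>2 + ?\<beta>\<^sup>2))"
        using rosenblatt_coupling[OF \<rho> D g kern S0, of "A \<epsilon>"] unfolding ex s_def by blast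
      note [measurable] = UV(1,2)
      have R: "rosenblatt_var M B \<gamma> \<gamma>' = (\<lambda>\<omega>. A \<epsilon> * ?I \<omega>)"
        by (intro ext) (simp add: rosenblatt_var_def A_def \<gamma>_def \<gamma>'_def)
      have Lm: "limit_var \<rho> U V \<in> borel_measurable M" unfolding limit_var_def[abs_def] by measurable
      have "wasserstein2 (distr M borel (rosenblatt_var M B \<gamma> \<gamma>')) (distr M borel (limit_var \<rho> U V)) \<le> ennreal (sqrt (Q * \<epsilon>))"
      proof (rule wasserstein2_le)
        show "(\<integral>\<^sup>+ \<omega>. ennreal ((rosenblatt_var M B \<gamma> \<gamma>' \<omega> - limit_var \<rho> U V \<omega>)\<^sup>2) \<partial>M) \<le> ennreal (Q * \<epsilon>)"
          unfolding R by (rule order_trans[OF le ennreal_leI[OF tot]])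
      qed (use Q elim(1) Lm in \<open>auto simp: R\<close>)
      then show ?thesis unfolding limit_var_law[OF N UV] real_sqrt_mult .
    qed
    have range: "\<gamma>' \<le> \<gamma>" "-1 < \<gamma>" "\<gamma> < -1/2" "-1 < \<gamma>'" "\<gamma>' < -1/2" "\<gamma> + \<gamma>' > -3/2"
      unfolding \<gamma>_def \<gamma>'_def using er elim(1,2) \<rho> by linarith+
    have e: "- \<gamma> - 1/2 = \<epsilon>" by (simp add: \<gamma>_def)
    show ?case
      unfolding Let_def g2 unfolding \<gamma>_def[symmetric] e greaterThanLessThan_iff
      by (intro conjI allI impI range W)
  qed
qed

end
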